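(* The following decision problem $UI_1$ is coNP-complete. Input: a finite simple graph $G$ with nonnegative integer vertex weights, and a set $I$ of vertices of $G$. Question: is $I$ the unique maximum weight independent set of $G$?
   Context: The weight of a vertex set is the sum of the weights of its vertices; an independent set is a set of pairwise nonadjacent vertices; $I$ is the unique maximum weight independent set if $I$ is independent and every other independent set has strictly smaller weight than $I$. *)

theory Defs
  imports "HOL-Computational_Algebra.Polynomial"
begin

section \<open>Deterministic multi-tape Turing machines\<close>

text \<open>
  States and tape symbols are initial segments of the natural numbers. In one step a machine reads
  the symbols under all heads, and for each tape writes a symbol and moves the head by at most one
  cell. Tapes are two-way infinite.
\<close>

datatype head_move = Move_Left | Stay | Move_Right

record machine =
  num_tapes :: nat
  num_states :: nat
  num_symbols :: nat
  start_state :: nat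
  halt_state :: nat
  delta :: "nat \<Rightarrow> nat list \<Rightarrow> nat \<times> (nat \<times> head_move) list"

text \<open>
  Symbol \<open>0\<close> is the blank and the symbols \<open>1\<close>, \<open>2\<close> are the two bits, so every machine has at least
  these three symbols.
\<close>

definition blank :: nat where
  "blank = 0"

definition bit_symbol :: "bool \<Rightarrow> nat" where
  "bit_symbol b = (if b then 2 else 1)"

definition turing_machine :: "machine \<Rightarrow> bool" where
  "turing_machine M \<longleftrightarrow>
     num_tapes M \<ge> 1 \<and> num_symbols M \<ge> 3 \<and>
     start_state M < num_states M \<and> halt_state M < num_states M \<and>
     (\<forall>q ss. q < num_states M \<and> length ss = num_tapes M \<and> (\<forall>s\<in>set ss. s < num_symbols M) \<longrightarrow>
       (case delta M q ss of (q', as) \<Rightarrow>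
         q' < num_states M \<and> length as = num_tapes M \<and> (\<forall>(s, d)\<in>set as. s < num_symbols M)))"

text \<open>A tape is its content together with the position of its head.\<close>

type_synonym tape = "(int \<Rightarrow> nat) \<times> int"

type_synonym config = "nat \<times> tape list"

fun move_offset :: "head_move \<Rightarrow> int" where
  "move_offset Move_Left = -1"
| "move_offset Stay = 0"
| "move_offset Move_Right = 1"

definition read_tape :: "tape \<Rightarrow> nat" where
  "read_tape = (\<lambda>(c, p). c p)"

definition update_tape :: "nat \<times> head_move \<Rightarrow> tape \<Rightarrow> tape" where
  "update_tape = (\<lambda>(s, d) (c, p). (c(p := s), p + move_offset d))"

text \<open>A halted configuration is left unchanged by a step.\<close>

definition step :: "machine \<Rightarrow> config \<Rightarrow> config" where
  "step M = (\<lambda>(q, ts).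
     if q = halt_state M then (q, ts)
     else (case delta M q (map read_tape ts) of (q', as) \<Rightarrow> (q', map2 update_tape as ts)))"

definition word_tape :: "bool list \<Rightarrow> tape" where
  "word_tape x =
     (\<lambda>i. if 0 \<le> i \<and> i < int (length x) then bit_symbol (x ! nat i) else blank, 0)"

text \<open>The input is on the first tape, all other tapes are blank; all heads start on cell \<open>0\<close>.\<close>

definition init_config :: "machine \<Rightarrow> bool list \<Rightarrow> config" where
  "init_config M x =
     (start_state M, word_tape x # replicate (num_tapes M - 1) (word_tape []))"

text \<open>
  The output is the word on the last tape that starts in cell \<open>0\<close> and ends before the first blank;
  the position of the head does not matter.
\<close>

definition tape_holds :: "tape \<Rightarrow> bool list \<Rightarrow> bool" where
  "tape_holds = (\<lambda>(c, p) y.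
     (\<forall>i<length y. c (int i) = bit_symbol (y ! i)) \<and> c (int (length y)) = blank)"

text \<open>
  As halted configurations are fixed points of \<^term>\<open>step M\<close>, looking at the configuration
  after exactly \<open>T (length x)\<close> steps expresses that \<open>M\<close> halts within that many steps.
\<close>

definition computes_in_time ::
  "machine \<Rightarrow> (bool list \<Rightarrow> bool list) \<Rightarrow> (nat \<Rightarrow> nat) \<Rightarrow> bool" where
  "computes_in_time M f T \<longleftrightarrow>
     (\<forall>x. case (step M ^^ T (length x)) (init_config M x) of (q, ts) \<Rightarrow>
        q = halt_state M \<and> tape_holds (last ts) (f x))"

section \<open>Complexity classes and reductions\<close>

type_synonym language = "bool list set"

definition polytime :: "(bool list \<Rightarrow> bool list) \<Rightarrow> bool" where
  "polytime f \<longleftrightarrow> (\<exists>M (p :: nat poly). turing_machine M \<and> computes_in_time M f (poly p))"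

definition class_P :: "language set" where
  "class_P = {L. polytime (\<lambda>x. [x \<in> L])}"

text \<open>
  Self-delimiting form of a word: every bit is preceded by \<open>True\<close>, and the end is marked by
  \<open>False\<close>.
\<close>

definition delimit :: "bool list \<Rightarrow> bool list" where
  "delimit x = concat (map (\<lambda>b. [True, b]) x) @ [False]"

definition pair :: "bool list \<Rightarrow> bool list \<Rightarrow> bool list" where
  "pair x u = delimit x @ u"

definition class_NP :: "language set" where
  "class_NP = {L. \<exists>R\<in>class_P. \<exists>p :: nat poly.
     \<forall>x. x \<in> L \<longleftrightarrow> (\<exists>u. length u \<le> poly p (length x) \<and> pair x u \<in> R)}"

definition class_coNP :: "language set" where
  "class_coNP = {L. - L \<in> class_NP}"

definition polytime_reducible :: "language \<Rightarrow> language \<Rightarrow> bool" where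
  "polytime_reducible L L' \<longleftrightarrow> (\<exists>f. polytime f \<and> (\<forall>x. x \<in> L \<longleftrightarrow> f x \<in> L'))"

definition coNP_complete :: "language \<Rightarrow> bool" where
  "coNP_complete L \<longleftrightarrow> L \<in> class_coNP \<and> (\<forall>L'\<in>class_coNP. polytime_reducible L' L)"

section \<open>Maximum weight independent sets\<close>

definition simple_graph :: "'a set \<Rightarrow> 'a set set \<Rightarrow> bool" where
  "simple_graph V E \<longleftrightarrow> finite V \<and> (\<forall>e\<in>E. e \<subseteq> V \<and> card e = 2)"

definition independent_set :: "'a set \<Rightarrow> 'a set set \<Rightarrow> 'a set \<Rightarrow> bool" where
  "independent_set V E S \<longleftrightarrow> S \<subseteq> V \<and> (\<forall>u\<in>S. \<forall>v\<in>S. u \<noteq> v \<longrightarrow> {u, v} \<notin> E)"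

definition set_weight :: "('a \<Rightarrow> nat) \<Rightarrow> 'a set \<Rightarrow> nat" where
  "set_weight w S = (\<Sum>v\<in>S. w v)"

definition unique_max_weight_independent_set ::
  "'a set \<Rightarrow> 'a set set \<Rightarrow> ('a \<Rightarrow> nat) \<Rightarrow> 'a set \<Rightarrow> bool" where
  "unique_max_weight_independent_set V E w I \<longleftrightarrow>
     independent_set V E I \<and>
     (\<forall>S. independent_set V E S \<and> S \<noteq> I \<longrightarrow> set_weight w S < set_weight w I)"

section \<open>The decision problem as a language\<close>

text \<open>Binary representation, least significant bit first, without superfluous zeros.\<close>

fun binary :: "nat \<Rightarrow> bool list" where
  "binary n = (if n = 0 then [] else odd n # binary (n div 2))"

declare binary.simps [simp del]

text \<open>
  The vertices of an instance are \<open>0, \<dots>, n - 1\<close>. Its encoding consists of \<open>n\<close> in unary, the strictly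
  lower triangle of the adjacency matrix (row by row), the characteristic vector of \<open>I\<close>, and the
  vertex weights in binary. Words that do not encode an instance are no-instances.
\<close>

definition encode_instance ::
  "nat \<Rightarrow> nat set set \<Rightarrow> (nat \<Rightarrow> nat) \<Rightarrow> nat set \<Rightarrow> bool list" where
  "encode_instance n E w I =
     replicate n True @ [False] @
     concat (map (\<lambda>i. map (\<lambda>j. {i, j} \<in> E) [0..<i]) [0..<n]) @
     map (\<lambda>i. i \<in> I) [0..<n] @
     concat (map (\<lambda>i. delimit (binary (w i))) [0..<n])"

definition UI\<^sub>1 :: language where
  "UI\<^sub>1 = {encode_instance n E w I | n E w I.
     simple_graph {..<n} E \<and> I \<subseteq> {..<n} \<and>
     unique_max_weight_independent_set {..<n} E w I}"

text \<open>The encodings are unambiguous.\<close>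

lemma delimit_append_eq_iff: "delimit x @ u = delimit y @ v \<longleftrightarrow> x = y \<and> u = v"
proof (induction x arbitrary: y)
  case Nil
  then show ?case by (cases y) (auto simp: delimit_def)
next
  case (Cons a x)
  then show ?case by (cases y) (auto simp: delimit_def)
qed

lemma pair_eq_iff: "pair x u = pair y v \<longleftrightarrow> x = y \<and> u = v"
  by (simp add: pair_def delimit_append_eq_iff)

lemma binary_eq_iff: "binary m = binary n \<longleftrightarrow> m = n"
proof
  show "binary m = binary n \<Longrightarrow> m = n"
  proof (induction m arbitrary: n rule: less_induct)
    case (less m)
    show ?case
    proof (cases "m = 0 \<or> n = 0")
      case True
      with less.prems show ?thesis
        by (simp add: binary.simps[of m] binary.simps[of n] split: if_splits)
    next
      case False
      with less.prems have odd: "odd m \<longleftrightarrow> odd n" and "binary (m div 2) = binary (n div 2)"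
        by (simp_all add: binary.simps[of m] binary.simps[of n])
      with less.IH[of "m div 2" "n div 2"] False have "m div 2 = n div 2" by simp
      with odd show ?thesis by (metis odd_two_times_div_two_succ even_two_times_div_two)
    qed
  qed
qed simp

lemma concat_delimit_eq:
  assumes "concat (map (\<lambda>i. delimit (f i)) xs) = concat (map (\<lambda>i. delimit (g i)) xs)"
  shows "\<forall>i\<in>set xs. f i = g i"
  using assms by (induction xs) (auto simp: delimit_append_eq_iff)

lemma encode_instance_inject:
  assumes eq: "encode_instance n E w I = encode_instance n' E' w' I'"
    and E: "simple_graph {..<n} E" "I \<subseteq> {..<n}"
    and E': "simple_graph {..<n'} E'" "I' \<subseteq> {..<n'}"
  shows "n = n' \<and> E = E' \<and> I = I' \<and> (\<forall>i<n. w i = w' i)"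
proof -
  have tW: "takeWhile id (encode_instance m F v J) = replicate m True" for m F v J
    unfolding encode_instance_def by (subst takeWhile_append2) auto
  have n: "n = n'"
    using arg_cong[OF eq, of "\<lambda>x. length (takeWhile id x)"] by (simp add: tW)
  define rows where "rows F = map (\<lambda>i. map (\<lambda>j. {i, j} \<in> F) [0..<i]) [0..<n]"
    for F :: "nat set set"
  have "length (concat (rows F)) = (\<Sum>i\<leftarrow>[0..<n]. i)" for F
    by (simp add: rows_def length_concat o_def)
  then have len: "length (concat (rows E)) = length (concat (rows E'))" by simp
  from eq have "concat (rows E) = concat (rows E') \<and>
      map (\<lambda>i. i \<in> I) [0..<n] = map (\<lambda>i. i \<in> I') [0..<n] \<and>
      concat (map (\<lambda>i. delimit (binary (w i))) [0..<n]) =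
      concat (map (\<lambda>i. delimit (binary (w' i))) [0..<n])"
    using len by (simp add: encode_instance_def n[symmetric] rows_def[symmetric])
  then have rows: "concat (rows E) = concat (rows E')"
    and I: "\<forall>i<n. i \<in> I \<longleftrightarrow> i \<in> I'"
    and w: "\<forall>i\<in>set [0..<n]. binary (w i) = binary (w' i)"
    using concat_delimit_eq[of "\<lambda>i. binary (w i)" "[0..<n]" "\<lambda>i. binary (w' i)"] by simp_all
  have "rows E = rows E'"
    by (rule concat_injective[OF rows]) (auto simp: rows_def zip_map_map zip_same_conv_map)
  then have adj: "{i, j} \<in> E \<longleftrightarrow> {i, j} \<in> E'" if "j < i" "i < n" for i j
    using that by (auto simp: rows_def)
  have "e \<in> E \<longleftrightarrow> e \<in> E'" for e
  proof (cases "\<exists>i j. j < i \<and> i < n \<and> e = {i, j}")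
    case True
    then show ?thesis using adj by auto
  next
    case False
    have "\<not> (e \<subseteq> {..<n} \<and> card e = 2)"
    proof
      assume e: "e \<subseteq> {..<n} \<and> card e = 2"
      then obtain a b where "e = {a, b}" "a \<noteq> b" by (meson card_2_iff)
      with e False show False
        by (metis insert_commute insert_subset lessThan_iff linorder_neqE_nat)
    qed
    then show ?thesis using E E' n unfolding simple_graph_def by blast
  qed
  moreover have "I = I'" using I E(2) E'(2) n by auto
  ultimately show ?thesis using n w by (auto simp: binary_eq_iff)
qed

end

theory Submission
  imports Defs
begin

text \<open>
  Hardness. Let \<open>L\<close> be in coNP, so that \<open>x \<notin> L\<close> means that some short \<open>u\<close> makes a polynomial-time
  machine accept \<open>pair x u\<close>. The tableau of such a computation is a binary constraint system: one
  variable for each time and position, whose value records the control state, the symbols under all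
  heads, and the symbol and head flag of every tape at that position. Because each value carries the
  whole local snapshot, all constraints relate two variables. The reduction outputs its conflict graph
  (one clique per variable), joined completely to an independent set \<open>I\<close> with one vertex of weight
  one per variable. An independent set other than \<open>I\<close> weighs as much as \<open>I\<close> exactly if it solves the
  constraint system, so \<open>I\<close> is the unique optimum exactly if \<open>x \<in> L\<close>. Adjacency of two vertices is a
  first-order property of their indices over a word describing the start of the computation, which
  makes the graph printable by nested loops.

  Membership. A certificate for non-uniqueness is a competing set together with a copy of \<open>I\<close>; it is
  checked in one pass over the word, with binary accumulators for the two weights.

  Machines are programmed with stack programs whose only loop runs once per input letter; their
  running time is then bounded by a polynomial that can be read off the program text.
\<close>

section \<open>Structured tape programs\<close>

text \<open>The number \<open>m\<close> of values of a variable does not depend on the input, so the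
  printing program can have one branch per pair of values in its text; only time and position are
  loops at run time. Both range over the indices of one word of polynomial length \<open>N\<close>,
  which gives \<open>N * N\<close> variables. In a usual tableau a cell depends on three neighbours
  in the previous row. Here the snapshot guesses the symbols under all heads, a cell with a head
  flag certifies the guess for its tape, and cells of equal time must agree on the guess; this is
  what makes binary constraints sufficient. Certificates shorter than the bound need no length
  field, because the guessed region is forced to be a word followed by blanks. Hardness uses only
  the weights \<open>0\<close> and \<open>1\<close>, while the verifier has to add arbitrary binary
  weights. Words that encode no instance are no-instances, so the verifier, which decides about the
  complement, has to accept them.\<close>

datatype tcom =
    Skip
  | Act nat "(nat \<Rightarrow> nat) \<Rightarrow> nat \<times> head_move"
  | Seq tcom tcom
  | Cond "(nat \<Rightarrow> nat) \<Rightarrow> bool" tcom tcom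
  | While "(nat \<Rightarrow> nat) \<Rightarrow> bool" tcom

fun next_com :: "tcom \<Rightarrow> (nat \<Rightarrow> nat) \<Rightarrow> tcom \<times> (nat \<times> nat \<times> head_move) option" where
  "next_com Skip r = (Skip, None)"
| "next_com (Act v g) r = (Skip, Some (v, g r))"
| "next_com (Seq c d) r =
     (if c = Skip then (d, None) else (case next_com c r of (c', a) \<Rightarrow> (Seq c' d, a)))"
| "next_com (Cond b c d) r = (if b r then c else d, None)"
| "next_com (While b c) r = (if b r then Seq c (While b c) else Skip, None)"

text \<open>Contains every program reachable by \<open>next_com\<close>. It is finite because the
  body of a loop runs as \<open>Seq c' (While b c)\<close>, with \<open>c'\<close> a continuation of
  the body, and then falls back to the loop itself.\<close>

fun conts :: "tcom \<Rightarrow> tcom set" where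
  "conts Skip = {Skip}"
| "conts (Act v g) = {Act v g, Skip}"
| "conts (Seq c d) = (\<lambda>c'. Seq c' d) ` conts c \<union> conts d"
| "conts (Cond b c d) = {Cond b c d} \<union> conts c \<union> conts d"
| "conts (While b c) = {While b c, Skip} \<union> (\<lambda>c'. Seq c' (While b c)) ` conts c"

lemma finite_conts: "finite (conts c)"
  by (induction c) auto

lemma self_in_conts: "c \<in> conts c"
  by (induction c) auto

lemma Skip_in_conts: "Skip \<in> conts c"
  by (induction c) auto

lemma next_Seq_in:
  "c' \<in> A \<Longrightarrow> fst (next_com c' r) \<in> A \<Longrightarrow> d \<in> B \<Longrightarrow>
   fst (next_com (Seq c' d) r) \<in> (\<lambda>c'. Seq c' d) ` A \<union> B"
  by (simp add: case_prod_beta)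

lemma next_in_conts: "c' \<in> conts c \<Longrightarrow> fst (next_com c' r) \<in> conts c"
proof (induction c arbitrary: c')
  case (Seq c d)
  show ?case
  proof (cases "c' \<in> conts d")
    case True
    then show ?thesis using Seq.IH(2) by simp
  next
    case False
    then obtain e where "c' = Seq e d" "e \<in> conts c" using Seq.prems by auto
    then show ?thesis
      using next_Seq_in[OF _ Seq.IH(1) self_in_conts] by (simp del: next_com.simps)
  qed
next
  case (Cond b c d)
  then show ?case by (auto simp: self_in_conts)
next
  case (While b c)
  show ?case
  proof (cases "c' \<in> {While b c, Skip}")
    case True
    then show ?thesis by (auto simp: self_in_conts)
  next
    case False
    then obtain e where "c' = Seq e (While b c)" "e \<in> conts c" using While.prems by auto
    then show ?thesis
      using next_Seq_in[OF _ While.IH, of e "While b c" "{While b c}"]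
      by (simp del: next_com.simps) blast
  qed
qed auto

definition closed_act :: "nat \<Rightarrow> ((nat \<Rightarrow> nat) \<Rightarrow> nat \<times> head_move) \<Rightarrow> bool" where
  "closed_act G g \<longleftrightarrow> (\<forall>r. (\<forall>u. r u < G) \<longrightarrow> fst (g r) < G)"

fun wf_tcom :: "nat \<Rightarrow> tcom \<Rightarrow> bool" where
  "wf_tcom G Skip = True"
| "wf_tcom G (Act v g) = closed_act G g"
| "wf_tcom G (Seq c d) = (wf_tcom G c \<and> wf_tcom G d)"
| "wf_tcom G (Cond b c d) = (wf_tcom G c \<and> wf_tcom G d)"
| "wf_tcom G (While b c) = wf_tcom G c"

lemma wf_conts: "wf_tcom G c \<Longrightarrow> conts c \<subseteq> Collect (wf_tcom G)"
proof (induction c)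
  case (Seq c d)
  then have "conts c \<subseteq> Collect (wf_tcom G)" "conts d \<subseteq> Collect (wf_tcom G)" "wf_tcom G d"
    by simp_all
  then show ?case unfolding conts.simps by (auto simp only: wf_tcom.simps mem_Collect_eq)
next
  case (Cond b c d)
  then have "conts c \<subseteq> Collect (wf_tcom G)" "conts d \<subseteq> Collect (wf_tcom G)" "wf_tcom G (Cond b c d)"
    by simp_all
  then show ?case unfolding conts.simps by blast
next
  case (While b c)
  then have "conts c \<subseteq> Collect (wf_tcom G)" "wf_tcom G (While b c)"
    by simp_all
  then show ?case unfolding conts.simps by (auto simp only: wf_tcom.simps mem_Collect_eq)
qed simp_all

lemma wf_next:
  "wf_tcom G c \<Longrightarrow> (\<forall>u. r u < G) \<Longrightarrow> next_com c r = (c', Some (v, s, d)) \<Longrightarrow> s < G"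
proof (induction c arbitrary: c')
  case (Act u g)
  have "fst (g r) < G" using Act.prems(1,2) unfolding wf_tcom.simps closed_act_def by blast
  then show ?case using Act.prems(3) by simp
qed (auto split: if_splits prod.splits)

section \<open>Timed execution of tape programs\<close>

type_synonym tapes = "nat \<Rightarrow> tape"

text \<open>The machine has no tapes from \<open>K\<close> on. Reading \<open>0\<close> there makes
  this function agree with the one that the machine decodes from its list of \<open>K\<close>
  symbols.\<close>

definition reads :: "nat \<Rightarrow> tapes \<Rightarrow> nat \<Rightarrow> nat" where
  "reads K \<sigma> = (\<lambda>v. if v < K then read_tape (\<sigma> v) else 0)"

fun apply_act :: "(nat \<times> nat \<times> head_move) option \<Rightarrow> tapes \<Rightarrow> tapes" where
  "apply_act None \<sigma> = \<sigma>"
| "apply_act (Some (v, a)) \<sigma> = \<sigma>(v := update_tape a (\<sigma> v))"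

definition com_step :: "nat \<Rightarrow> tcom \<times> tapes \<Rightarrow> tcom \<times> tapes" where
  "com_step K = (\<lambda>(c, \<sigma>). case next_com c (reads K \<sigma>) of (c', a) \<Rightarrow> (c', apply_act a \<sigma>))"

text \<open>\<open>t\<close> is only an upper bound on the running time, since \<open>Skip\<close>
  steps to itself. This is the convention of \<open>computes_in_time\<close> as well.\<close>

definition exec :: "nat \<Rightarrow> tcom \<Rightarrow> tapes \<Rightarrow> nat \<Rightarrow> tapes \<Rightarrow> bool" where
  "exec K c \<sigma> t \<sigma>' \<longleftrightarrow> (com_step K ^^ t) (c, \<sigma>) = (Skip, \<sigma>')"

lemma com_step_Skip: "(com_step K ^^ t) (Skip, \<sigma>) = (Skip, \<sigma>)"
  by (induction t) (simp_all add: com_step_def)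

lemma exec_Skip: "exec K Skip \<sigma> t \<sigma>"
  by (simp add: exec_def com_step_Skip)

lemma exec_mono:
  assumes "exec K c \<sigma> t \<sigma>'" "t \<le> t'"
  shows "exec K c \<sigma> t' \<sigma>'"
proof -
  obtain k where "t' = k + t" using assms(2) by (metis le_add_diff_inverse2)
  with assms(1) show ?thesis by (simp add: exec_def funpow_add com_step_Skip)
qed

lemma exec_step:
  "com_step K (c, \<sigma>) = (c', \<sigma>1) \<Longrightarrow> exec K c' \<sigma>1 t \<sigma>' \<Longrightarrow> exec K c \<sigma> (Suc t) \<sigma>'"
  by (simp add: exec_def funpow_swap1)

lemma exec_stepD:
  "exec K c \<sigma> (Suc t) \<sigma>' \<Longrightarrow> com_step K (c, \<sigma>) = (c', \<sigma>1) \<Longrightarrow> exec K c' \<sigma>1 t \<sigma>'"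
  by (simp add: exec_def funpow_swap1)

lemma exec_Act: "exec K (Act v g) \<sigma> 1 (\<sigma>(v := update_tape (g (reads K \<sigma>)) (\<sigma> v)))"
  by (simp add: exec_def com_step_def)

text \<open>The extra step replaces \<open>Seq Skip d\<close> by \<open>d\<close>. If
  \<open>c\<close> reaches \<open>Skip\<close> early, the time left over is absorbed by
  \<open>exec_mono\<close>.\<close>

lemma exec_Seq:
  "exec K c \<sigma> t \<sigma>1 \<Longrightarrow> exec K d \<sigma>1 u \<sigma>2 \<Longrightarrow> exec K (Seq c d) \<sigma> (t + 1 + u) \<sigma>2"
proof (induction t arbitrary: c \<sigma>)
  case 0
  then have "c = Skip" "\<sigma> = \<sigma>1" by (simp_all add: exec_def)
  with 0(2) show ?case by (auto intro!: exec_step simp: com_step_def)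
next
  case (Suc t)
  show ?case
  proof (cases "c = Skip")
    case True
    then have "\<sigma> = \<sigma>1" using Suc.prems(1) by (simp add: exec_def com_step_Skip del: funpow.simps)
    then have "exec K (Seq c d) \<sigma> (Suc u) \<sigma>2"
      using True Suc.prems(2) by (auto intro!: exec_step simp: com_step_def)
    then show ?thesis by (rule exec_mono) simp
  next
    case False
    obtain c' \<sigma>' where st: "com_step K (c, \<sigma>) = (c', \<sigma>')" by fastforce
    then have "com_step K (Seq c d, \<sigma>) = (Seq c' d, \<sigma>')"
      using False by (auto simp: com_step_def split: prod.splits)
    moreover have "exec K (Seq c' d) \<sigma>' (t + 1 + u) \<sigma>2"
      using Suc.IH[OF exec_stepD[OF Suc.prems(1) st] Suc.prems(2)] .
    ultimately show ?thesis using exec_step by fastforce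
  qed
qed

lemma exec_Cond:
  "exec K (if b (reads K \<sigma>) then c else d) \<sigma> t \<sigma>' \<Longrightarrow> exec K (Cond b c d) \<sigma> (Suc t) \<sigma>'"
  by (rule exec_step) (auto simp: com_step_def)

text \<open>A round costs two steps besides its body, one to unfold the loop and one to leave the
  \<open>Seq\<close>; the last step is the failing test. The induction is on the number
  \<open>j\<close> of rounds still to come, hence the states \<open>S (n - j)\<close>.\<close>

lemma exec_While_iter:
  assumes "\<And>k. k < n \<Longrightarrow> b (reads K (S k))"
    and "\<And>k. k < n \<Longrightarrow> exec K c (S k) t (S (Suc k))"
    and "\<not> b (reads K (S n))"
  shows "exec K (While b c) (S 0) (n * (t + 2) + 1) (S n)"
proof -
  have "exec K (While b c) (S (n - j)) (j * (t + 2) + 1) (S n)" if "j \<le> n" for j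
    using that
  proof (induction j)
    case 0
    have "exec K (While b c) (S n) (Suc 0) (S n)"
      by (rule exec_step[OF _ exec_Skip]) (simp add: com_step_def assms(3))
    then show ?case by simp
  next
    case (Suc j)
    have lt: "n - Suc j < n" and eq: "Suc (n - Suc j) = n - j" using Suc.prems by auto
    have "exec K (Seq c (While b c)) (S (n - Suc j)) (t + 1 + (j * (t + 2) + 1)) (S n)"
      by (rule exec_Seq[OF assms(2)[OF lt]]) (unfold eq, rule Suc.IH, use Suc.prems in simp)
    then have "exec K (While b c) (S (n - Suc j)) (Suc (t + 1 + (j * (t + 2) + 1))) (S n)"
      by (rule exec_step[rotated]) (simp add: com_step_def assms(1)[OF lt])
    then show ?case by (rule exec_mono) simp
  qed
  from this[of n] show ?thesis by simp
qed

text \<open>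
  The states of the machine are the finitely many continuations of the program. The tapes are
  numbered backwards, so that tape \<open>0\<close> of the program is the output tape.
\<close>

definition tape_list :: "nat \<Rightarrow> (nat \<Rightarrow> 'a) \<Rightarrow> 'a list" where
  "tape_list K \<sigma> = map \<sigma> (rev [0..<K])"

lemma length_tape_list [simp]: "length (tape_list K \<sigma>) = K"
  by (simp add: tape_list_def)

lemma tape_list_nth [simp]: "v < K \<Longrightarrow> tape_list K \<sigma> ! (K - Suc v) = \<sigma> v"
  by (simp add: tape_list_def rev_nth)

text \<open>Decoding with \<open>dec\<close> makes one machine step on \<open>cfg\<close> the same
  as one program step, and only \<open>Skip\<close> is numbered as the halting state. Tape
  \<open>K - 1\<close> of the program is the first tape of the machine and so carries the
  input.\<close>

theorem polytime_tcom:
  assumes wf: "wf_tcom G c" and G: "G \<ge> 3" and K: "K \<ge> 1"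
    and ex: "\<And>x. \<exists>\<sigma>'. exec K c (\<lambda>v. if v = K - 1 then word_tape x else word_tape [])
                (poly p (length x)) \<sigma>' \<and> tape_holds (\<sigma>' 0) (f x)"
  shows "polytime f"
proof -
  obtain e where e: "bij_betw e (conts c) {0..<card (conts c)}"
    using ex_bij_betw_finite_nat[OF finite_conts] by blast
  define dec where "dec = inv_into (conts c) e"
  have dec: "dec (e d) = d" if "d \<in> conts c" for d
    using that e by (simp add: dec_def bij_betw_def)
  have e_less: "e d < card (conts c)" if "d \<in> conts c" for d
    using that e by (auto simp: bij_betw_def)
  have dec_in: "dec q \<in> conts c" if "q < card (conts c)" for q
    using that e unfolding dec_def by (metis atLeastLessThan_iff bij_betw_def inv_into_into zero_le)
  define rd where "rd ss = (\<lambda>v. if v < K then ss ! (K - 1 - v) else 0)" for ss :: "nat list"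
  \<comment> \<open>A machine acts on all tapes at once; the tapes that the program does not address
    rewrite the symbol just read and stay.\<close>
  define acts where "acts ss a = tape_list K (\<lambda>v. case a of
      None \<Rightarrow> (rd ss v, Stay) | Some (u, sd) \<Rightarrow> if u = v then sd else (rd ss v, Stay))"
    for ss and a :: "(nat \<times> nat \<times> head_move) option"
  define M where "M = \<lparr>num_tapes = K, num_states = card (conts c), num_symbols = G,
     start_state = e c, halt_state = e Skip,
     delta = (\<lambda>q ss. case next_com (dec q) (rd ss) of (c', a) \<Rightarrow> (e c', acts ss a))\<rparr>"
  have tm: "turing_machine M"
    unfolding turing_machine_def
  proof (intro conjI allI impI)
    fix q ss
    assume a: "q < num_states M \<and> length ss = num_tapes M \<and> (\<forall>s\<in>set ss. s < num_symbols M)"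
    then have rd: "\<forall>v. rd ss v < G" using G K by (auto simp: rd_def M_def)
    obtain c' a where n: "next_com (dec q) (rd ss) = (c', a)" by fastforce
    have "dec q \<in> conts c" using a by (simp add: M_def dec_in)
    then have "c' \<in> conts c" and "wf_tcom G (dec q)"
      using next_in_conts[of "dec q" c "rd ss"] n wf_conts[OF wf] by auto
    moreover have "\<forall>(s, d)\<in>set (acts ss a). s < G"
    proof (cases a)
      case None
      then show ?thesis using rd by (auto simp: acts_def tape_list_def)
    next
      case (Some b)
      obtain u s d where "b = (u, s, d)" by (cases b)
      with Some rd wf_next[OF \<open>wf_tcom G (dec q)\<close> rd, of c' u s d] n show ?thesis
        by (auto simp: acts_def tape_list_def split: if_splits)
    qed
    ultimately show "case delta M q ss of (q', as) \<Rightarrow>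
         q' < num_states M \<and> length as = num_tapes M \<and> (\<forall>(s, d)\<in>set as. s < num_symbols M)"
      by (simp add: M_def n e_less acts_def)
  qed (use K G in \<open>simp_all add: M_def e_less self_in_conts Skip_in_conts\<close>)
  define cfg :: "tcom \<times> tapes \<Rightarrow> config" where "cfg = (\<lambda>(d, \<sigma>). (e d, tape_list K \<sigma>))"
  have rd_eq: "rd (map read_tape (tape_list K \<sigma>)) = reads K \<sigma>" for \<sigma>
    by (auto simp: rd_def reads_def)
  have sim1: "step M (cfg (d, \<sigma>)) = cfg (com_step K (d, \<sigma>)) \<and> fst (com_step K (d, \<sigma>)) \<in> conts c"
    if d: "d \<in> conts c" for d \<sigma>
  proof (cases "d = Skip")
    case True
    then show ?thesis using d by (simp add: step_def cfg_def M_def com_step_def)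
  next
    case False
    have ne: "e d \<noteq> e Skip"
      using False dec[OF d] dec[OF Skip_in_conts] by metis
    obtain c' a where n: "next_com d (reads K \<sigma>) = (c', a)" by fastforce
    have stay: "update_tape (reads K \<sigma> v, Stay) (\<sigma> v) = \<sigma> v" if "v < K" for v
      using that by (cases "\<sigma> v") (simp add: reads_def read_tape_def update_tape_def)
    have "map2 update_tape (acts (map read_tape (tape_list K \<sigma>)) a) (tape_list K \<sigma>)
        = tape_list K (apply_act a \<sigma>)"
      unfolding acts_def rd_eq
      by (cases a) (auto simp: tape_list_def map2_map_map stay split: prod.splits)
    then have "step M (cfg (d, \<sigma>)) = cfg (c', apply_act a \<sigma>)"
      using ne by (simp add: step_def cfg_def M_def rd_eq dec[OF d] n)
    then show ?thesis using n next_in_conts[OF d, of "reads K \<sigma>"] by (simp add: com_step_def)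
  qed
  have sim: "(step M ^^ t) (cfg (c, \<sigma>)) = cfg ((com_step K ^^ t) (c, \<sigma>)) \<and>
      fst ((com_step K ^^ t) (c, \<sigma>)) \<in> conts c" for t \<sigma>
  proof (induction t)
    case 0
    then show ?case by (simp add: self_in_conts)
  next
    case (Suc t)
    then show ?case using sim1[of "fst ((com_step K ^^ t) (c, \<sigma>))"
        "snd ((com_step K ^^ t) (c, \<sigma>))"] by simp
  qed
  have "computes_in_time M f (poly p)"
    unfolding computes_in_time_def
  proof
    fix x
    let ?\<sigma> = "\<lambda>v. if v = K - 1 then word_tape x else word_tape []"
    obtain \<sigma>' where s: "exec K c ?\<sigma> (poly p (length x)) \<sigma>'" "tape_holds (\<sigma>' 0) (f x)"
      using ex by blast
    obtain k where k: "K = Suc k" using K by (cases K) auto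
    have "map ?\<sigma> (rev [0..<k]) = map (\<lambda>_. word_tape []) (rev [0..<k])"
      by (rule map_cong) (auto simp: k)
    then have "init_config M x = cfg (c, ?\<sigma>)"
      by (simp add: init_config_def cfg_def M_def tape_list_def k map_replicate_const)
    moreover have "last (tape_list K \<sigma>') = \<sigma>' 0"
      by (simp add: tape_list_def k upt_rec[of 0] del: upt_Suc)
    ultimately show "case (step M ^^ poly p (length x)) (init_config M x) of
        (q, ts) \<Rightarrow> q = halt_state M \<and> tape_holds (last ts) (f x)"
      using s sim[of "poly p (length x)" ?\<sigma>] by (simp add: exec_def cfg_def M_def)
  qed
  with tm show ?thesis unfolding polytime_def by blast
qed

section \<open>Stack programs\<close>

text \<open>An empty stack shows the blank \<open>0\<close>. Emptiness can therefore be tested like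
  any other top symbol, provided that \<open>0\<close> is never an entry.\<close>

definition top_sym :: "nat list \<Rightarrow> nat" where
  "top_sym xs = (case xs of [] \<Rightarrow> 0 | a # _ \<Rightarrow> a)"

lemma top_sym_simps [simp]: "top_sym [] = 0" "top_sym (a # xs) = a"
  by (simp_all add: top_sym_def)

datatype com =
    Nop
  | Push nat nat
  | Pop nat
  | Copy nat nat
  | Comp com com (infixr \<open>;;\<close> 60)
  | Test nat "nat set" com com
  | Loop com

type_synonym store = "nat \<Rightarrow> nat list"

fun run :: "nat \<Rightarrow> com \<Rightarrow> store \<Rightarrow> store" where
  "run m Nop s = s"
| "run m (Push v a) s = s(v := a # s v)"
| "run m (Pop v) s = s(v := tl (s v))"
| "run m (Copy u v) s = s(v := (if s u = [] then s v else hd (s u) # s v))"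
| "run m (c ;; d) s = run m d (run m c s)"
| "run m (Test v A c d) s = (if top_sym (s v) \<in> A then run m c s else run m d s)"
| "run m (Loop c) s = (run m c ^^ m) s"

fun wf_com :: "nat \<Rightarrow> nat \<Rightarrow> com \<Rightarrow> bool" where
  "wf_com V G Nop = True"
| "wf_com V G (Push v a) = (v < V \<and> 0 < a \<and> a < G)"
| "wf_com V G (Pop v) = (v < V)"
| "wf_com V G (Copy u v) = (u < V \<and> v < V \<and> u \<noteq> v)"
| "wf_com V G (c ;; d) = (wf_com V G c \<and> wf_com V G d)"
| "wf_com V G (Test v A c d) = (v < V \<and> wf_com V G c \<and> wf_com V G d)"
| "wf_com V G (Loop c) = wf_com V G c"

fun depth :: "com \<Rightarrow> nat" where
  "depth (c ;; d) = max (depth c) (depth d)"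
| "depth (Test v A c d) = max (depth c) (depth d)"
| "depth (Loop c) = Suc (depth c)"
| "depth _ = 0"

text \<open>The constants have slack: a copy takes four steps, and a round of a loop takes fifteen
  besides its body. The two branches of a test are added, because the maximum of two polynomials
  need not be a polynomial.\<close>

fun time :: "com \<Rightarrow> nat poly" where
  "time (c ;; d) = time c + time d + 1"
| "time (Test v A c d) = time c + time d + 1"
| "time (Loop c) = [:0, 1:] * (time c + [:20:]) + [:5:]"
| "time _ = [:5:]"

section \<open>Stacks and their representation on tapes\<close>

definition no_blank :: "store \<Rightarrow> bool" where
  "no_blank s \<longleftrightarrow> (\<forall>v. 0 \<notin> set (s v))"

lemma no_blank_run: "wf_com V G c \<Longrightarrow> no_blank s \<Longrightarrow> no_blank (run m c s)"
proof (induction c arbitrary: s)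
  case (Pop v)
  then have "0 \<notin> set (tl (s v))" by (cases "s v") (auto simp: no_blank_def, metis list.set_intros(2))
  with Pop show ?case by (simp add: no_blank_def)
next
  case (Copy u v)
  then have "s u \<noteq> [] \<Longrightarrow> hd (s u) \<noteq> 0" by (metis list.set_sel(1) no_blank_def)
  with Copy show ?case by (auto simp: no_blank_def)
next
  case (Loop c)
  have "no_blank ((run m c ^^ k) s)" for k
    by (induction k) (use Loop in auto)
  then show ?case by simp
qed (auto simp: no_blank_def)

text \<open>The bottom of the stack is in cell \<open>0\<close> and the head is on the top, so the
  head of an empty stack is on the blank cell \<open>-1\<close>. Read from cell \<open>0\<close> on,
  the tape shows the stack in reverse; this is the origin of the \<open>rev\<close> in front of all
  outputs.\<close>

definition stack_tape :: "nat list \<Rightarrow> tape" where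
  "stack_tape xs =
     (\<lambda>i. if 0 \<le> i \<and> i < int (length xs) then rev xs ! nat i else blank, int (length xs) - 1)"

lemma read_stack_tape: "read_tape (stack_tape xs) = top_sym xs"
  by (cases xs) (auto simp: read_tape_def stack_tape_def blank_def nth_append)

lemma push_stack_tape:
  "update_tape (a, Stay) (update_tape (top_sym xs, Move_Right) (stack_tape xs)) = stack_tape (a # xs)"
proof -
  have "(fst (stack_tape xs))(int (length xs) - 1 := top_sym xs) = fst (stack_tape xs)"
    by (rule fun_upd_idem) (use read_stack_tape[of xs] in \<open>simp add: read_tape_def stack_tape_def\<close>)
  then show ?thesis
    by (auto simp: update_tape_def stack_tape_def fun_eq_iff nth_append)
qed

lemma pop_stack_tape:
  "xs \<noteq> [] \<Longrightarrow> update_tape (0, Move_Left) (stack_tape xs) = stack_tape (tl xs)"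
  by (cases xs) (auto simp: update_tape_def stack_tape_def fun_eq_iff nth_append blank_def)

lemma stay_stack_tape: "update_tape (0, Stay) (stack_tape []) = stack_tape []"
  by (auto simp: update_tape_def stack_tape_def blank_def)

section \<open>Compiling stack programs to tape programs\<close>

definition tpush :: "nat \<Rightarrow> nat \<Rightarrow> tcom" where
  "tpush v a = Seq (Act v (\<lambda>r. (r v, Move_Right))) (Act v (\<lambda>_. (a, Stay)))"

definition tcopy :: "nat \<Rightarrow> nat \<Rightarrow> tcom" where
  "tcopy u v = Seq (Act v (\<lambda>r. (r v, Move_Right))) (Act v (\<lambda>r. (r u, Stay)))"

definition tpop :: "nat \<Rightarrow> tcom" where
  "tpop v = Act v (\<lambda>r. (0, if r v = 0 then Stay else Move_Left))"

lemma exec_tpush: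
  assumes "v < K" "\<sigma> v = stack_tape xs"
  shows "exec K (tpush v a) \<sigma> 3 (\<sigma>(v := stack_tape (a # xs)))"
proof -
  have "exec K (tpush v a) \<sigma> (1 + 1 + 1) (\<sigma>(v := stack_tape (a # xs)))"
    unfolding tpush_def
    by (rule exec_Seq, rule exec_Act, subst push_stack_tape[symmetric])
      (use exec_Act[of K v "\<lambda>_. (a, Stay)"
        "\<sigma>(v := update_tape (top_sym xs, Move_Right) (stack_tape xs))"] assms in
        \<open>simp add: reads_def read_stack_tape\<close>)
  then show ?thesis by (simp add: numeral_3_eq_3)
qed

lemma exec_tcopy:
  assumes "v < K" "u < K" "u \<noteq> v" "\<sigma> v = stack_tape xs"
  shows "exec K (tcopy u v) \<sigma> 3 (\<sigma>(v := stack_tape (read_tape (\<sigma> u) # xs)))"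
proof -
  have "exec K (tcopy u v) \<sigma> (1 + 1 + 1) (\<sigma>(v := stack_tape (read_tape (\<sigma> u) # xs)))"
    unfolding tcopy_def
    by (rule exec_Seq, rule exec_Act, subst push_stack_tape[symmetric])
      (use exec_Act[of K v "\<lambda>r. (r u, Stay)"
        "\<sigma>(v := update_tape (top_sym xs, Move_Right) (stack_tape xs))"] assms in
        \<open>simp add: reads_def read_stack_tape\<close>)
  then show ?thesis by (simp add: numeral_3_eq_3)
qed

lemma exec_tpop:
  assumes "v < K" "\<sigma> v = stack_tape xs" "0 \<notin> set xs"
  shows "exec K (tpop v) \<sigma> 1 (\<sigma>(v := stack_tape (tl xs)))"
  using exec_Act[of K v "\<lambda>r. (0, if r v = 0 then Stay else Move_Left)" \<sigma>] assms
  by (cases xs) (auto simp: tpop_def reads_def read_stack_tape pop_stack_tape stay_stack_tape)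

text \<open>A loop owns a ruler, the two tapes \<open>l\<close> and \<open>Suc l\<close>, chosen by
  its nesting depth. Each round moves one mark from \<open>Suc l\<close> to \<open>l\<close>, and a
  second pass moves all marks back, so that the loop can run again inside an outer loop. Loops of
  equal depth share a ruler.\<close>

fun compile :: "nat \<Rightarrow> com \<Rightarrow> tcom" where
  "compile V Nop = Skip"
| "compile V (Push v a) = tpush v a"
| "compile V (Pop v) = tpop v"
| "compile V (Copy u v) = Cond (\<lambda>r. r u = 0) Skip (tcopy u v)"
| "compile V (c ;; d) = Seq (compile V c) (compile V d)"
| "compile V (Test v A c d) = Cond (\<lambda>r. r v \<in> A) (compile V c) (compile V d)"
| "compile V (Loop c) = (let l = V + 2 * depth c in
     Seq (While (\<lambda>r. r (Suc l) \<noteq> 0) (Seq (tpop (Suc l)) (Seq (tpush l 1) (compile V c))))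
         (While (\<lambda>r. r l \<noteq> 0) (Seq (tpop l) (tpush (Suc l) 1))))"

lemma wf_compile: "G \<ge> 3 \<Longrightarrow> wf_com V G c \<Longrightarrow> wf_tcom G (compile V c)"
  by (induction c) (auto simp: tpush_def tpop_def tcopy_def Let_def closed_act_def)

definition overlay :: "nat \<Rightarrow> store \<Rightarrow> tapes \<Rightarrow> tapes" where
  "overlay V s \<sigma> = (\<lambda>v. if v < V then stack_tape (s v) else \<sigma> v)"

lemma overlay_upd:
  "v < V \<Longrightarrow> overlay V (s(v := xs)) \<sigma> = (overlay V s \<sigma>)(v := stack_tape xs)"
  "\<not> v < V \<Longrightarrow> overlay V s (\<sigma>(v := t)) = (overlay V s \<sigma>)(v := t)"
  by (auto simp: overlay_def)

definition rulers :: "nat \<Rightarrow> nat \<Rightarrow> nat \<Rightarrow> tapes \<Rightarrow> bool" where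
  "rulers V m d \<sigma> \<longleftrightarrow> (\<forall>l<d. \<sigma> (V + 2 * l) = stack_tape [] \<and>
      \<sigma> (Suc (V + 2 * l)) = stack_tape (replicate m 1))"

text \<open>The tapes outside the stacks return to \<open>\<sigma>\<close>. This invariant is what
  makes a body repeatable: inner loops use the rulers below \<open>depth c\<close> and restore
  them.\<close>

lemma exec_compile:
  "wf_com V G c \<Longrightarrow> no_blank s \<Longrightarrow> V + 2 * depth c \<le> K \<Longrightarrow> rulers V m (depth c) \<sigma> \<Longrightarrow>
   exec K (compile V c) (overlay V s \<sigma>) (poly (time c) m) (overlay V (run m c s) \<sigma>)"
proof (induction c arbitrary: s \<sigma>)
  case Nop
  then show ?case by (simp add: exec_Skip)
next
  case (Push v a)
  then have "exec K (tpush v a) (overlay V s \<sigma>) 3 ((overlay V s \<sigma>)(v := stack_tape (a # s v)))"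
    by (intro exec_tpush) (auto simp: overlay_def)
  from exec_mono[OF this] Push show ?case by (simp add: overlay_upd del: fun_upd_apply)
next
  case (Pop v)
  then have "exec K (tpop v) (overlay V s \<sigma>) 1 ((overlay V s \<sigma>)(v := stack_tape (tl (s v))))"
    by (intro exec_tpop) (auto simp: overlay_def no_blank_def)
  from exec_mono[OF this] Pop show ?case by (simp add: overlay_upd del: fun_upd_apply)
next
  case (Copy u v)
  have r: "reads K (overlay V s \<sigma>) u = top_sym (s u)"
    using Copy by (simp add: reads_def overlay_def read_stack_tape)
  have e: "exec K (tcopy u v) (overlay V s \<sigma>) 3
      ((overlay V s \<sigma>)(v := stack_tape (top_sym (s u) # s v)))"
    using exec_tcopy[of v K u "overlay V s \<sigma>" "s v"] Copy
    by (auto simp: overlay_def read_stack_tape)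
  have "exec K (compile V (Copy u v)) (overlay V s \<sigma>) (Suc 3) (overlay V (run m (Copy u v) s) \<sigma>)"
    unfolding compile.simps
  proof (rule exec_Cond, cases "s u")
    case Nil
    then show "exec K (if reads K (overlay V s \<sigma>) u = 0 then Skip else tcopy u v)
        (overlay V s \<sigma>) 3 (overlay V (run m (Copy u v) s) \<sigma>)"
      using r by (simp add: exec_Skip)
  next
    case (Cons a list)
    then have "a \<noteq> 0" using Copy(2) by (metis list.set_intros(1) no_blank_def)
    then show "exec K (if reads K (overlay V s \<sigma>) u = 0 then Skip else tcopy u v)
        (overlay V s \<sigma>) 3 (overlay V (run m (Copy u v) s) \<sigma>)"
      using r Cons e Copy(1) by (simp add: overlay_upd del: fun_upd_apply)
  qed
  then show ?case by (rule exec_mono) simp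
next
  case (Comp c d)
  have nb: "no_blank (run m c s)" using Comp.prems no_blank_run by auto
  have "exec K (compile V c) (overlay V s \<sigma>) (poly (time c) m) (overlay V (run m c s) \<sigma>)"
    using Comp.prems by (intro Comp.IH) (auto simp: rulers_def)
  moreover have "exec K (compile V d) (overlay V (run m c s) \<sigma>) (poly (time d) m)
      (overlay V (run m d (run m c s)) \<sigma>)"
    using Comp.prems nb by (intro Comp.IH) (auto simp: rulers_def)
  ultimately have "exec K (Seq (compile V c) (compile V d)) (overlay V s \<sigma>)
      (poly (time c) m + 1 + poly (time d) m) (overlay V (run m d (run m c s)) \<sigma>)"
    by (rule exec_Seq)
  then show ?case by (simp add: algebra_simps)
next
  case (Test v A c d)
  have r: "reads K (overlay V s \<sigma>) v = top_sym (s v)"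
    using Test.prems by (simp add: reads_def overlay_def read_stack_tape)
  have "exec K (compile V c) (overlay V s \<sigma>) (poly (time c) m) (overlay V (run m c s) \<sigma>)"
    "exec K (compile V d) (overlay V s \<sigma>) (poly (time d) m) (overlay V (run m d s) \<sigma>)"
    using Test.prems by (auto intro!: Test.IH simp: rulers_def)
  then have "exec K (if reads K (overlay V s \<sigma>) v \<in> A then compile V c else compile V d)
      (overlay V s \<sigma>) (poly (time c) m + poly (time d) m)
      (overlay V (run m (Test v A c d) s) \<sigma>)"
    by (auto simp: r intro: exec_mono)
  from exec_Cond[of K "\<lambda>r. r v \<in> A", OF this] show ?case by simp
next
  case (Loop c)
  define l where "l = V + 2 * depth c"
  have lK: "l < K" "Suc l < K" using Loop.prems by (auto simp: l_def)
  \<comment> \<open>The ruler after \<open>k\<close> rounds: \<open>k\<close> marks have moved to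
    \<open>l\<close> and \<open>m - k\<close> are left.\<close>
  define \<sigma>' where "\<sigma>' k = \<sigma>(l := stack_tape (replicate k 1), Suc l := stack_tape (replicate (m - k) 1))" for k
  have \<sigma>'0: "\<sigma>' 0 = \<sigma>"
    using Loop.prems(4) by (auto simp: \<sigma>'_def rulers_def l_def fun_eq_iff)
  have rul: "rulers V m (depth c) (\<sigma>' k)" for k
    using Loop.prems(4) by (auto simp: \<sigma>'_def rulers_def l_def)
  have nb: "no_blank ((run m c ^^ k) s)" for k
    by (induction k) (use Loop.prems no_blank_run in auto)
  define S where "S k = overlay V ((run m c ^^ k) s) (\<sigma>' k)" for k
  let ?t = "1 + 1 + (3 + 1 + poly (time c) m)"
  have A: "exec K (While (\<lambda>r. r (Suc l) \<noteq> 0) (Seq (tpop (Suc l)) (Seq (tpush l 1) (compile V c))))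
      (S 0) (m * (?t + 2) + 1) (S m)"
  proof (rule exec_While_iter)
    fix k assume k: "k < m"
    let ?s = "(run m c ^^ k) s"
    show "reads K (S k) (Suc l) \<noteq> 0"
      using k lK by (cases "m - k") (auto simp: S_def reads_def overlay_def l_def \<sigma>'_def read_stack_tape)
    have V: "\<not> l < V" "\<not> Suc l < V" by (auto simp: l_def)
    obtain j where j: "m - k = Suc j" using k by (metis Suc_diff_Suc)
    have 1: "exec K (tpop (Suc l)) (S k) 1 (overlay V ?s ((\<sigma>' k)(Suc l := stack_tape (replicate j 1))))"
      using exec_tpop[of "Suc l" K "S k" "replicate (m - k) 1"] lK V j
      by (simp add: S_def overlay_upd) (simp add: overlay_def \<sigma>'_def)
    have \<sigma>'S: "\<sigma>' (Suc k) = \<sigma>(l := stack_tape (replicate (Suc k) 1), Suc l := stack_tape (replicate j 1))"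
      using j by (auto simp: \<sigma>'_def intro!: arg_cong[of _ _ "\<lambda>n. _(_ := stack_tape (replicate n _))"])
    have mk: "m - Suc k = j" using j by simp
    have 2: "exec K (tpush l 1) (overlay V ?s ((\<sigma>' k)(Suc l := stack_tape (replicate j 1)))) 3
       (overlay V ?s (\<sigma>' (Suc k)))"
      using exec_tpush[of l K "overlay V ?s ((\<sigma>' k)(Suc l := stack_tape (replicate j 1)))" "replicate k 1" 1] lK V
      by (simp add: overlay_upd \<sigma>'S \<sigma>'_def mk fun_upd_twist[of "Suc l" l])
    have 3: "exec K (compile V c) (overlay V ?s (\<sigma>' (Suc k))) (poly (time c) m) (S (Suc k))"
      unfolding S_def using Loop.prems nb rul by (simp, intro Loop.IH) auto
    show "exec K (Seq (tpop (Suc l)) (Seq (tpush l 1) (compile V c))) (S k) ?t (S (Suc k))"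
      by (rule exec_Seq[OF 1 exec_Seq[OF 2 3]])
  next
    show "\<not> reads K (S m) (Suc l) \<noteq> 0"
      using lK by (auto simp: S_def reads_def overlay_def l_def \<sigma>'_def read_stack_tape)
  qed
  \<comment> \<open>The second pass runs through the same ruler positions backwards, with the stacks
    fixed.\<close>
  define R where "R k = overlay V ((run m c ^^ m) s) (\<sigma>' (m - k))" for k
  have B: "exec K (While (\<lambda>r. r l \<noteq> 0) (Seq (tpop l) (tpush (Suc l) 1)))
      (R 0) (m * ((1 + 1 + 3) + 2) + 1) (R m)"
  proof (rule exec_While_iter)
    fix k assume k: "k < m"
    let ?s = "(run m c ^^ m) s"
    show "reads K (R k) l \<noteq> 0"
      using k lK by (cases "m - k") (auto simp: R_def reads_def overlay_def l_def \<sigma>'_def read_stack_tape)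
    have V: "\<not> l < V" "\<not> Suc l < V" by (auto simp: l_def)
    obtain j where j: "m - k = Suc j" using k by (metis Suc_diff_Suc)
    have 1: "exec K (tpop l) (R k) 1 (overlay V ?s ((\<sigma>' (m - k))(l := stack_tape (replicate j 1))))"
      using exec_tpop[of l K "R k" "replicate (m - k) 1"] lK V j
      by (simp add: R_def overlay_upd) (simp add: overlay_def \<sigma>'_def)
    have mk: "m - (m - k) = k" "m - (m - Suc k) = Suc k" "m - Suc k = j" using k j by auto
    have \<sigma>'S: "\<sigma>' (m - Suc k) = \<sigma>(l := stack_tape (replicate j 1), Suc l := stack_tape (replicate (Suc k) 1))"
      using j k by (simp only: \<sigma>'_def mk(3)) (simp only: diff_diff_cancel Suc_leI mk(2)[unfolded mk(3)])
    define \<tau> where "\<tau> = overlay V ?s ((\<sigma>' (m - k))(l := stack_tape (replicate j 1)))"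
    have "\<tau> (Suc l) = stack_tape (replicate k 1)"
      using V by (simp add: \<tau>_def overlay_def \<sigma>'_def mk)
    moreover have "\<tau>(Suc l := stack_tape (1 # replicate k 1)) = R (Suc k)"
      using V unfolding R_def \<sigma>'S \<tau>_def by (intro ext) (simp add: overlay_def \<sigma>'_def)
    ultimately have 2: "exec K (tpush (Suc l) 1) \<tau> 3 (R (Suc k))"
      using exec_tpush[of "Suc l" K \<tau> "replicate k 1" 1] lK(2) by metis
    show "exec K (Seq (tpop l) (tpush (Suc l) 1)) (R k) (1 + 1 + 3) (R (Suc k))"
      by (rule exec_Seq[OF 1 2[unfolded \<tau>_def]])
  next
    show "\<not> reads K (R m) l \<noteq> 0"
      using lK by (auto simp: R_def reads_def overlay_def l_def \<sigma>'_def read_stack_tape)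
  qed
  have eqs: "S 0 = overlay V s \<sigma>" "R 0 = S m" "R m = overlay V (run m (Loop c) s) \<sigma>"
    by (simp_all add: S_def R_def \<sigma>'0)
  have "exec K (Seq (While (\<lambda>r. r (Suc l) \<noteq> 0) (Seq (tpop (Suc l)) (Seq (tpush l 1) (compile V c))))
         (While (\<lambda>r. r l \<noteq> 0) (Seq (tpop l) (tpush (Suc l) 1)))) (overlay V s \<sigma>)
     ((m * (?t + 2) + 1) + 1 + (m * ((1 + 1 + 3) + 2) + 1)) (overlay V (run m (Loop c) s) \<sigma>)"
    by (rule exec_Seq[OF A[unfolded eqs] B[unfolded eqs]])
  then have "exec K (compile V (Loop c)) (overlay V s \<sigma>)
     ((m * (?t + 2) + 1) + 1 + (m * ((1 + 1 + 3) + 2) + 1)) (overlay V (run m (Loop c) s) \<sigma>)"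
    by (simp only: compile.simps Let_def l_def)
  then show ?case by (rule exec_mono) (simp add: algebra_simps)
qed

lemma exec_foldr:
  assumes "\<And>v \<sigma>. v \<in> set vs \<Longrightarrow> \<sigma> v = A v \<Longrightarrow> exec K (C v) \<sigma> t (\<sigma>(v := F v))"
    and "distinct vs" "\<forall>v\<in>set vs. \<sigma> v = A v"
  shows "exec K (foldr (\<lambda>v. Seq (C v)) vs Skip) \<sigma> (length vs * (t + 1))
           (\<lambda>v. if v \<in> set vs then F v else \<sigma> v)"
  using assms
proof (induction vs arbitrary: \<sigma>)
  case Nil
  then show ?case by (simp add: exec_Skip)
next
  case (Cons v vs)
  have 1: "exec K (C v) \<sigma> t (\<sigma>(v := F v))"
    by (rule Cons.prems(1)) (use Cons.prems(3) in auto)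
  have "exec K (foldr (\<lambda>v. Seq (C v)) vs Skip) (\<sigma>(v := F v)) (length vs * (t + 1))
           (\<lambda>u. if u \<in> set vs then F u else (\<sigma>(v := F v)) u)"
    by (rule Cons.IH) (use Cons.prems in auto)
  note e = exec_Seq[OF 1 this]
  have eq: "(\<lambda>u. if u \<in> set vs then F u else (\<sigma>(v := F v)) u) =
      (\<lambda>u. if u \<in> set (v # vs) then F u else \<sigma> u)"
    by auto
  show ?case using e unfolding eq by (simp add: algebra_simps del: list.set)
qed

text \<open>Preparation turns the initial tapes into stacks: every work tape moves its head to cell
  \<open>-1\<close>, and one pass over the input pushes each letter on stack \<open>1\<close> and
  one mark on each ruler in \<open>RR\<close>. Stack \<open>1\<close> thus starts with the last
  letter on top, and every ruler has the length of the input.\<close>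

theorem polytime_com:
  assumes wf: "wf_com V G c" and V: "V \<ge> 2" and G: "G \<ge> 3"
    and out: "\<And>x. run (length x) c (\<lambda>v. if v = 1 then rev (map bit_symbol x) else []) 0
                = rev (map bit_symbol (f x))"
  shows "polytime f"
proof -
  define D where "D = depth c"
  define raw where "raw = V + 2 * D"
  define K where "K = Suc raw"
  define RR where "RR = map (\<lambda>l. Suc (V + 2 * l)) [0..<D]"
  have RR: "distinct RR" "length RR = D" "1 \<notin> set RR" "\<And>v. v < V \<Longrightarrow> v \<notin> set RR"
      "raw \<notin> set RR" "\<And>v. v \<in> set RR \<Longrightarrow> v < K"
    using V by (auto simp: RR_def distinct_map inj_on_def raw_def K_def) presburger
  have raw1: "1 \<noteq> raw" "1 < K" "raw < K" using V by (auto simp: raw_def K_def)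
  define body where "body = Seq (tcopy raw 1) (Seq (foldr (\<lambda>v. Seq (tpush v 1)) RR Skip)
     (Act raw (\<lambda>r. (r raw, Move_Right))))"
  define prog where "prog = Seq (foldr (\<lambda>v. Seq (Act v (\<lambda>r. (r v, Move_Left)))) [0..<raw] Skip)
     (Seq (While (\<lambda>r. r raw \<noteq> 0) body) (compile V c))"
  have wf_foldr: "(\<And>v. wf_tcom G (C v)) \<Longrightarrow> wf_tcom G (foldr (\<lambda>v. Seq (C v)) vs Skip)" for C and vs :: "nat list"
    by (induction vs) auto
  have "wf_tcom G prog"
    unfolding prog_def body_def wf_tcom.simps
    using wf_compile[OF G wf] G
    by (auto intro!: wf_foldr simp: closed_act_def tpush_def tcopy_def)
  moreover have "K \<ge> 1" by (simp add: K_def)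
  moreover define tb where "tb = 3 + 1 + (D * (3 + 1) + 1 + 1)"
  define p where "p = [:raw * 2 + 3, tb + 2:] + time c"
  have "\<exists>\<sigma>'. exec K prog (\<lambda>v. if v = K - 1 then word_tape x else word_tape [])
                (poly p (length x)) \<sigma>' \<and> tape_holds (\<sigma>' 0) (f x)" for x
  proof -
    define n where "n = length x"
    define P where "P k = (\<lambda>v. if v = raw then (fst (word_tape x), int k)
       else if v = 1 then stack_tape (rev (map bit_symbol (take k x)))
       else if v \<in> set RR then stack_tape (replicate k 1) else stack_tape [])" for k
    have left: "update_tape (read_tape (word_tape []), Move_Left) (word_tape []) = stack_tape []"
      by (auto simp: update_tape_def read_tape_def word_tape_def stack_tape_def)
    have 1: "exec K (foldr (\<lambda>v. Seq (Act v (\<lambda>r. (r v, Move_Left)))) [0..<raw] Skip)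
        (\<lambda>v. if v = K - 1 then word_tape x else word_tape []) (length [0..<raw] * (1 + 1))
        (\<lambda>v. if v \<in> set [0..<raw] then stack_tape [] else
           if v = K - 1 then word_tape x else word_tape [])"
    proof (rule exec_foldr[where A = "\<lambda>_. word_tape []"])
      fix v \<sigma> assume v: "v \<in> set [0..<raw]" "\<sigma> v = word_tape []"
      then show "exec K (Act v (\<lambda>r. (r v, Move_Left))) \<sigma> 1 (\<sigma>(v := stack_tape []))"
        using exec_Act[of K v "\<lambda>r. (r v, Move_Left)" \<sigma>] by (simp add: reads_def K_def left)
    qed (auto simp: K_def)
    let ?\<sigma> = "\<lambda>v. if v \<in> set [0..<raw] then stack_tape [] else
           if v = K - 1 then word_tape x else word_tape []"
    have P0: "?\<sigma> v = P 0 v" if "v < K" for v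
      using that by (auto simp: P_def K_def word_tape_def)
    define Q where "Q k = (\<lambda>v. if v < K then P k v else word_tape [])" for k
    have Q0: "?\<sigma> = Q 0"
      using P0 by (auto simp: Q_def K_def fun_eq_iff)
    have rd: "read_tape (Q k raw) = (if k < n then bit_symbol (x ! k) else 0)" for k
      by (simp add: Q_def P_def read_tape_def word_tape_def n_def raw1 blank_def)
    have 2: "exec K (While (\<lambda>r. r raw \<noteq> 0) body) (Q 0) (n * (tb + 2) + 1) (Q n)"
    proof (rule exec_While_iter)
      fix k assume k: "k < n"
      show "reads K (Q k) raw \<noteq> 0"
        using k by (simp add: reads_def raw1 rd bit_symbol_def)
      have take: "rev (map bit_symbol (take (Suc k) x)) = bit_symbol (x ! k) # rev (map bit_symbol (take k x))"
        using k by (simp add: take_Suc_conv_app_nth n_def)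
      have Q1: "Q k 1 = stack_tape (rev (map bit_symbol (take k x)))"
        using raw1 by (simp add: Q_def P_def)
      define \<sigma>1 where "\<sigma>1 = (Q k)(1 := stack_tape (rev (map bit_symbol (take (Suc k) x))))"
      have a: "exec K (tcopy raw 1) (Q k) 3 \<sigma>1"
        using exec_tcopy[of 1 K raw "Q k", OF raw1(2,3) raw1(1)[symmetric] Q1] k by (simp add: rd take \<sigma>1_def)
      have b: "exec K (foldr (\<lambda>v. Seq (tpush v 1)) RR Skip) \<sigma>1 (length RR * (3 + 1))
           (\<lambda>v. if v \<in> set RR then stack_tape (replicate (Suc k) 1) else \<sigma>1 v)"
      proof (rule exec_foldr[where A = "\<lambda>_. stack_tape (replicate k 1)"])
        fix v \<sigma> assume "v \<in> set RR" "\<sigma> v = stack_tape (replicate k 1)"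
        then show "exec K (tpush v 1) \<sigma> 3 (\<sigma>(v := stack_tape (replicate (Suc k) 1)))"
          using exec_tpush[of v K \<sigma> "replicate k 1" 1] RR(6) by simp
      next
        show "\<forall>v\<in>set RR. \<sigma>1 v = stack_tape (replicate k 1)"
          using RR by (auto simp: \<sigma>1_def Q_def P_def)
      qed (rule RR)
      let ?\<sigma>2 = "\<lambda>v. if v \<in> set RR then stack_tape (replicate (Suc k) 1) else \<sigma>1 v"
      have raw2: "?\<sigma>2 raw = (fst (word_tape x), int k)"
        using RR raw1 by (simp add: \<sigma>1_def Q_def P_def)
      have "?\<sigma>2(raw := update_tape (reads K ?\<sigma>2 raw, Move_Right) (?\<sigma>2 raw)) = Q (Suc k)"
        unfolding raw2 reads_def using raw1 RR
        by (auto simp: fun_eq_iff raw2 \<sigma>1_def Q_def P_def update_tape_def read_tape_def)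
      then have c: "exec K (Act raw (\<lambda>r. (r raw, Move_Right))) ?\<sigma>2 1 (Q (Suc k))"
        using exec_Act[of K raw "\<lambda>r. (r raw, Move_Right)" ?\<sigma>2] by simp
      show "exec K body (Q k) tb (Q (Suc k))"
        unfolding body_def tb_def using exec_Seq[OF a exec_Seq[OF b c]] RR(2) by simp
    next
      show "\<not> reads K (Q n) raw \<noteq> 0"
        by (simp add: reads_def raw1 rd)
    qed
    let ?s = "\<lambda>v. if v = 1 then rev (map bit_symbol x) else []"
    have ov: "overlay V ?s (Q n) = Q n"
      using RR by (auto simp: overlay_def Q_def P_def fun_eq_iff n_def K_def raw_def)
    have nb: "no_blank ?s"
      by (auto simp: no_blank_def bit_symbol_def split: if_splits)
    have "\<And>l. l < D \<Longrightarrow> V + 2 * l \<notin> set RR"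
      by (auto simp: RR_def) presburger
    then have "rulers V n (depth c) (Q n)"
      unfolding rulers_def D_def[symmetric]
      using V by (auto simp: Q_def P_def K_def raw_def RR_def) 
    then have 3: "exec K (compile V c) (Q n) (poly (time c) n) (overlay V (run n c ?s) (Q n))"
      using exec_compile[OF wf nb, of K n "Q n"] ov by (simp add: K_def raw_def D_def)
    have "exec K prog (\<lambda>v. if v = K - 1 then word_tape x else word_tape [])
       (length [0..<raw] * (1 + 1) + 1 + (n * (tb + 2) + 1 + 1 + poly (time c) n))
       (overlay V (run n c ?s) (Q n))"
      unfolding prog_def by (rule exec_Seq[OF 1]) (subst Q0, rule exec_Seq[OF 2 3])
    moreover have "length [0..<raw] * (1 + 1) + 1 + (n * (tb + 2) + 1 + 1 + poly (time c) n)
        = poly p (length x)"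
      by (simp add: p_def n_def algebra_simps)
    moreover have "tape_holds (overlay V (run n c ?s) (Q n) 0) (f x)"
    proof -
      have "overlay V (run n c ?s) (Q n) 0 = stack_tape (rev (map bit_symbol (f x)))"
        using V out[of x] by (simp add: overlay_def n_def)
      then show ?thesis by (simp add: tape_holds_def stack_tape_def)
    qed
    ultimately show ?thesis by metis
  qed
  ultimately show ?thesis using polytime_tcom[of G prog K p f] G by blast
qed

section \<open>Programming with stacks\<close>

fun times :: "nat \<Rightarrow> com \<Rightarrow> com" where
  "times 0 c = Nop"
| "times (Suc n) c = c ;; times n c"

text \<open>Horner's scheme: \<open>Loop\<close> multiplies the number of executions by the input
  length, and \<open>times a\<close> adds a coefficient.\<close>

fun rep_coeffs :: "nat list \<Rightarrow> com \<Rightarrow> com" where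
  "rep_coeffs [] c = Nop"
| "rep_coeffs (a # as) c = times a c ;; Loop (rep_coeffs as c)"

definition repeat :: "nat poly \<Rightarrow> com \<Rightarrow> com" where
  "repeat P c = rep_coeffs (coeffs P) c"

lemma run_times: "run m (times n c) = run m c ^^ n"
  by (induction n) (auto simp: fun_eq_iff funpow_swap1)

lemma run_repeat: "run m (repeat P c) = run m c ^^ poly P m"
proof -
  have "run m (rep_coeffs as c) = run m c ^^ poly (Poly as) m" for as
  proof (induction as)
    case (Cons a as)
    have "run m (Loop (rep_coeffs as c)) = (run m c ^^ poly (Poly as) m) ^^ m"
      by (simp add: fun_eq_iff Cons.IH)
    then show ?case
      by (simp add: fun_eq_iff run_times funpow_mult funpow_add o_def)
        (metis add.commute comp_apply funpow_add mult.commute)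
  qed (auto simp: fun_eq_iff)
  then show ?thesis by (simp add: repeat_def)
qed

lemma wf_times [simp]: "wf_com V G (times n c) \<longleftrightarrow> n = 0 \<or> wf_com V G c"
  by (induction n) auto

lemma wf_repeat: "wf_com V G c \<Longrightarrow> wf_com V G (repeat P c)"
proof -
  assume "wf_com V G c"
  then have "wf_com V G (rep_coeffs as c)" for as by (induction as) auto
  then show ?thesis by (simp add: repeat_def)
qed

definition Move :: "nat \<Rightarrow> nat \<Rightarrow> com" where
  "Move u v = Copy u v ;; Pop u"

lemma wf_Move [simp]: "wf_com V G (Move u v) \<longleftrightarrow> u < V \<and> v < V \<and> u \<noteq> v"
  by (auto simp: Move_def)

lemma run_Move_Cons: "s u = x # xs \<Longrightarrow> u \<noteq> v \<Longrightarrow> run m (Move u v) s = s(v := x # s v, u := xs)"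
  by (simp add: Move_def)

lemma run_Move_Nil: "s u = [] \<Longrightarrow> u \<noteq> v \<Longrightarrow> run m (Move u v) s = s"
  by (auto simp: Move_def fun_eq_iff)

lemma run_Move_all:
  "u \<noteq> v \<Longrightarrow> length (s u) \<le> n \<Longrightarrow> (run m (Move u v) ^^ n) s = s(v := rev (s u) @ s v, u := [])"
proof (induction n arbitrary: s)
  case 0
  then show ?case by auto
next
  case (Suc n)
  show ?case
  proof (cases "s u")
    case Nil
    then show ?thesis using Suc.IH[of s] Suc.prems
      by (simp add: funpow_swap1 run_Move_Nil)
  next
    case (Cons x xs)
    then have "(run m (Move u v) ^^ Suc n) s = (run m (Move u v) ^^ n) (s(v := x # s v, u := xs))"
      using Suc.prems by (simp add: funpow_swap1 run_Move_Cons)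
    also have "\<dots> = s(v := rev (s u) @ s v, u := [])"
      using Suc Cons by (subst Suc.IH) (auto simp: fun_eq_iff)
    finally show ?thesis .
  qed
qed

lemma funpow_states:
  assumes "\<And>k. k < n \<Longrightarrow> g (S k) = S (Suc k)"
  shows "(g ^^ n) (S 0) = S n"
  using assms by (induction n) auto

text \<open>Since every loop has a fixed number of rounds, a while loop becomes a bounded loop whose
  body does nothing once the test fails. Any number \<open>M\<close> of rounds that is large enough
  gives the same result.\<close>

lemma funpow_while_states:
  assumes "\<And>k. k < n \<Longrightarrow> B (S k) \<and> g (S k) = S (Suc k)" "\<not> B (S n)" "n \<le> M"
  shows "((\<lambda>s. if B s then g s else s) ^^ M) (S 0) = S n"
proof -
  obtain j where M: "M = j + n" using assms(3) by (metis le_add_diff_inverse2)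
  have "((\<lambda>s. if B s then g s else s) ^^ n) (S 0) = S n"
    by (rule funpow_states) (use assms(1) in auto)
  moreover have "((\<lambda>s. if B s then g s else s) ^^ j) (S n) = S n"
    by (induction j) (use assms(2) in auto)
  ultimately show ?thesis by (simp add: M funpow_add)
qed

lemma funpow_while_fold:
  assumes "\<And>x xs a. Q (x # xs) a \<Longrightarrow> B (st (x # xs) a) \<and> g (st (x # xs) a) = st xs (h x a) \<and> Q xs (h x a)"
    "\<And>a. \<not> B (st [] a)" "length xs \<le> M" "Q xs a"
  shows "((\<lambda>s. if B s then g s else s) ^^ M) (st xs a) = st [] (fold h xs a)"
  using assms(3,4)
proof (induction xs arbitrary: M a)
  case Nil
  show ?case by (induction M) (use assms(2) in auto)
next
  case (Cons x xs)
  then obtain k where "M = Suc k" by (cases M) auto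
  with Cons show ?case using assms(1)[of x xs a] by (simp add: funpow_Suc_right del: funpow.simps)
qed

lemma bit_symbol_simps [simp]: "bit_symbol True = 2" "bit_symbol False = 1" "bit_symbol b \<noteq> 0"
  by (simp_all add: bit_symbol_def)

lemma length_delimit: "length (delimit x) = 2 * length x + 1"
  by (induction x) (auto simp: delimit_def)

section \<open>First-order formulas over a word\<close>

datatype fm = Less nat nat | Sym nat "nat set" | Neg fm | And fm fm | Exi nat fm | Const bool

fun eval :: "nat list \<Rightarrow> (nat \<Rightarrow> nat) \<Rightarrow> fm \<Rightarrow> bool" where
  "eval w e (Less u v) = (e u < e v)"
| "eval w e (Sym v A) = (w ! e v \<in> A)"
| "eval w e (Neg \<phi>) = (\<not> eval w e \<phi>)"
| "eval w e (And \<phi> \<psi>) = (eval w e \<phi> \<and> eval w e \<psi>)"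
| "eval w e (Exi v \<phi>) = (\<exists>i<length w. eval w (e(v := i)) \<phi>)"
| "eval w e (Const b) = b"

fun bound_vars :: "fm \<Rightarrow> nat set" where
  "bound_vars (Neg \<phi>) = bound_vars \<phi>"
| "bound_vars (And \<phi> \<psi>) = bound_vars \<phi> \<union> bound_vars \<psi>"
| "bound_vars (Exi v \<phi>) = insert v (bound_vars \<phi>)"
| "bound_vars _ = {}"

text \<open>A loop over \<open>v\<close> starts with the zipper of \<open>v\<close> at position
  \<open>0\<close> and returns it there, so a quantifier must not occur inside the scope of another
  one for the same variable; side by side they may share it. \<open>Less\<close> needs distinct
  variables because it moves both zippers.\<close>

fun wf_fm :: "nat \<Rightarrow> fm \<Rightarrow> bool" where
  "wf_fm C (Less u v) = (u < C \<and> v < C \<and> u \<noteq> v)"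
| "wf_fm C (Sym v A) = (v < C)"
| "wf_fm C (Neg \<phi>) = wf_fm C \<phi>"
| "wf_fm C (And \<phi> \<psi>) = (wf_fm C \<phi> \<and> wf_fm C \<psi>)"
| "wf_fm C (Exi v \<phi>) = (v < C \<and> v \<notin> bound_vars \<phi> \<and> wf_fm C \<phi>)"
| "wf_fm C (Const b) = True"

text \<open>
  The value of the variable \<open>v\<close> is a position in the word, kept as a zipper: stack \<open>4 + 2 * v\<close>
  holds the reversed prefix before the position and stack \<open>5 + 2 * v\<close> the rest. Stack \<open>2\<close> holds
  truth values and stack \<open>3\<close> is scratch space.
\<close>

definition left :: "nat \<Rightarrow> nat" where "left v = 4 + 2 * v"
definition right :: "nat \<Rightarrow> nat" where "right v = 5 + 2 * v"

definition st :: "nat \<Rightarrow> nat list \<Rightarrow> (nat \<Rightarrow> nat) \<Rightarrow> nat \<Rightarrow> nat list \<Rightarrow> nat list \<Rightarrow> store" where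
  "st C w e k F out = (\<lambda>i. if i = 0 then out else if i = 2 then F else if i = 3 then replicate k 1
     else if i < 4 \<or> 4 + 2 * C \<le> i then []
     else if even i then rev (take (e ((i - 4) div 2)) w) else drop (e ((i - 4) div 2)) w)"

lemma st_simps [simp]:
  "st C w e k F out 0 = out" "st C w e k F out 2 = F" "st C w e k F out 3 = replicate k 1"
  "v < C \<Longrightarrow> st C w e k F out (left v) = rev (take (e v) w)"
  "v < C \<Longrightarrow> st C w e k F out (right v) = drop (e v) w"
  by (simp_all add: st_def left_def right_def)

lemma st_upd_simps [simp]:
  "(st C w e k F out)(0 := out') = st C w e k F out'"
  "(st C w e k F out)(2 := F') = st C w e k F' out"
  "(st C w e k F out)(3 := replicate k' 1) = st C w e k' F out"
  by (auto simp: st_def fun_eq_iff)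

lemma var_neq [simp]:
  "left v \<noteq> right u" "right u \<noteq> left v" "left v \<noteq> 0" "left v \<noteq> 2" "left v \<noteq> 3"
  "right v \<noteq> 0" "right v \<noteq> 2" "right v \<noteq> 3"
  by (simp_all add: left_def right_def) presburger+

lemma st_zipper_upd:
  assumes "v < C"
  shows "(st C w e k F out)(left v := rev (take i w), right v := drop i w) = st C w (e(v := i)) k F out"
proof
  fix j
  consider "j = left v" | "j = right v" | "j \<noteq> left v" "j \<noteq> right v" by blast
  then show "((st C w e k F out)(left v := rev (take i w), right v := drop i w)) j
      = st C w (e(v := i)) k F out j"
  proof cases
    case 3
    then have "\<not> j < 4 \<longrightarrow> (j - 4) div 2 \<noteq> v" unfolding left_def right_def by presburger
    with 3 show ?thesis by (auto simp: st_def)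
  qed (use assms in simp_all)
qed

lemma move_right:
  assumes "v < C" "e v < length w"
  shows "run m (Move (right v) (left v)) (st C w e k F out) = st C w (e(v := Suc (e v))) k F out"
proof -
  have "drop (e v) w = w ! e v # drop (Suc (e v)) w"
    using assms by (simp add: Cons_nth_drop_Suc)
  then have "run m (Move (right v) (left v)) (st C w e k F out) =
      (st C w e k F out)(left v := w ! e v # rev (take (e v) w), right v := drop (Suc (e v)) w)"
    using assms by (subst run_Move_Cons) auto
  also have "w ! e v # rev (take (e v) w) = rev (take (Suc (e v)) w)"
    using assms by (simp add: take_Suc_conv_app_nth)
  finally show ?thesis unfolding st_zipper_upd[OF assms(1)] .
qed

lemma move_left:
  assumes "v < C" "e v = Suc i" "i < length w"
  shows "run m (Move (left v) (right v)) (st C w e k F out) = st C w (e(v := i)) k F out"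
proof -
  have "rev (take (e v) w) = w ! i # rev (take i w)"
    using assms by (simp add: take_Suc_conv_app_nth)
  then have "run m (Move (left v) (right v)) (st C w e k F out) =
      (st C w e k F out)(right v := w ! i # drop (Suc i) w, left v := rev (take i w))"
    using assms by (subst run_Move_Cons) auto
  also have "w ! i # drop (Suc i) w = drop i w"
    using assms by (simp add: Cons_nth_drop_Suc)
  also have "(st C w e k F out)(right v := drop i w, left v := rev (take i w)) =
      (st C w e k F out)(left v := rev (take i w), right v := drop i w)"
    by (rule fun_upd_twist) simp
  finally show ?thesis using st_zipper_upd[OF assms(1)] by simp
qed

text \<open>\<open>P\<close> has to evaluate to the length of the word. The second
  \<open>repeat\<close> brings the zipper back to position \<open>0\<close>.\<close>

definition For :: "nat poly \<Rightarrow> nat \<Rightarrow> com \<Rightarrow> com" where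
  "For P v c = repeat P (c ;; Move (right v) (left v)) ;; repeat P (Move (left v) (right v))"

lemma run_For:
  assumes "poly P m = length w" "v < C" "e v = 0"
    and "\<And>i. i < length w \<Longrightarrow> run m c (st C w (e(v := i)) 0 (F i) (out i))
           = st C w (e(v := i)) 0 (F (Suc i)) (out (Suc i))"
  shows "run m (For P v c) (st C w e 0 (F 0) (out 0)) = st C w e 0 (F (length w)) (out (length w))"
proof -
  let ?N = "length w"
  have "(run m (c ;; Move (right v) (left v)) ^^ ?N) (st C w (e(v := 0)) 0 (F 0) (out 0))
      = st C w (e(v := ?N)) 0 (F ?N) (out ?N)"
    by (rule funpow_states[where S = "\<lambda>i. st C w (e(v := i)) 0 (F i) (out i)"])
      (simp add: assms move_right)
  moreover have "(run m (Move (left v) (right v)) ^^ ?N) (st C w (e(v := ?N - 0)) 0 (F ?N) (out ?N))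
      = st C w (e(v := ?N - ?N)) 0 (F ?N) (out ?N)"
  proof (rule funpow_states[where S = "\<lambda>i. st C w (e(v := ?N - i)) 0 (F ?N) (out ?N)"])
    fix k assume "k < ?N"
    then show "run m (Move (left v) (right v)) (st C w (e(v := ?N - k)) 0 (F ?N) (out ?N))
      = st C w (e(v := ?N - Suc k)) 0 (F ?N) (out ?N)"
      using move_left[of v C "e(v := ?N - k)" "?N - Suc k" w m 0 "F ?N" "out ?N"] assms(2)
      by (simp add: Suc_diff_Suc)
  qed
  moreover have "e(v := 0) = e" using assms(3) by auto
  ultimately show ?thesis by (simp add: For_def run_repeat assms(1))
qed

text \<open>For \<open>Less\<close>, both zippers move left in lockstep, counted on stack
  \<open>3\<close>, until one of them reaches position \<open>0\<close>; the comparison is then read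
  off the empty left stacks, and the count undoes the moves. Truth values are bit symbols on stack
  \<open>2\<close>.\<close>

fun comp :: "nat poly \<Rightarrow> fm \<Rightarrow> com" where
  "comp P (Const b) = Push 2 (bit_symbol b)"
| "comp P (Less u v) =
     repeat P (Test (left u) {0} Nop (Test (left v) {0} Nop
       (Move (left u) (right u) ;; Move (left v) (right v) ;; Push 3 1))) ;;
     Test (left u) {0} (Test (left v) {0} (Push 2 1) (Push 2 2)) (Push 2 1) ;;
     repeat P (Test 3 {0} Nop
       (Move (right u) (left u) ;; Move (right v) (left v) ;; Pop 3))"
| "comp P (Sym v A) = Test (right v) A (Push 2 2) (Push 2 1)"
| "comp P (Neg \<phi>) = comp P \<phi> ;; Test 2 {2} (Pop 2 ;; Push 2 1) (Pop 2 ;; Push 2 2)"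
| "comp P (And \<phi> \<psi>) =
     comp P \<phi> ;; comp P \<psi> ;; Test 2 {2} (Pop 2) (Pop 2 ;; Pop 2 ;; Push 2 1)"
| "comp P (Exi v \<phi>) =
     Push 2 1 ;; For P v (comp P \<phi> ;; Test 2 {2} (Pop 2 ;; Pop 2 ;; Push 2 2) (Pop 2))"

lemma run_Less:
  assumes P: "poly P m = length w" and w: "0 \<notin> set w" and uv: "u < C" "v < C" "u \<noteq> v"
    and e: "e u < length w" "e v < length w"
  shows "run m (comp P (Less u v)) (st C w e 0 F out)
    = st C w e 0 (bit_symbol (e u < e v) # F) out"
proof -
  define d where "d = min (e u) (e v)"
  define e' where "e' k = e(u := e u - k, v := e v - k)" for k
  have topl: "top_sym (rev (take i w)) = 0 \<longleftrightarrow> i = 0" if "i < length w" for i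
  proof (cases i)
    case (Suc j)
    then show ?thesis using that w by (auto simp: take_Suc_conv_app_nth in_set_conv_nth)
  qed simp
  let ?b1 = "Move (left u) (right u) ;; Move (left v) (right v) ;; Push 3 1"
  let ?B1 = "\<lambda>s. top_sym (s (left u)) \<noteq> 0 \<and> top_sym (s (left v)) \<noteq> 0"
  have "((\<lambda>s. if ?B1 s then run m ?b1 s else s) ^^ length w) (st C w (e' 0) 0 F out)
      = st C w (e' d) d F out"
  proof (rule funpow_while_states[where S = "\<lambda>k. st C w (e' k) k F out"])
    fix k assume k: "k < d"
    then have 1: "e' k u = Suc (e u - Suc k)" "e' k v = Suc (e v - Suc k)"
      using uv by (auto simp: e'_def d_def)
    have "?B1 (st C w (e' k) k F out)"
      using uv e 1 topl[of "e' k u"] topl[of "e' k v"] by (auto simp: e'_def)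
    moreover have "(e' k)(u := e u - Suc k, v := e v - Suc k) = e' (Suc k)"
      by (auto simp: e'_def)
    ultimately show "?B1 (st C w (e' k) k F out) \<and> run m ?b1 (st C w (e' k) k F out)
        = st C w (e' (Suc k)) (Suc k) F out"
      using move_left[of u C "e' k" "e u - Suc k" w m k F out]
        move_left[of v C "(e' k)(u := e u - Suc k)" "e v - Suc k" w m k F out]
        st_upd_simps(3)[of C w "e' (Suc k)" k F out "Suc k"] 1 uv e
      by simp
  next
    show "\<not> ?B1 (st C w (e' d) d F out)"
      using uv e topl[of "e' d u"] topl[of "e' d v"] by (auto simp: e'_def d_def)
  qed (use e in \<open>simp add: d_def\<close>)
  moreover have "run m (Test (left u) {0} Nop (Test (left v) {0} Nop ?b1)) =
      (\<lambda>s. if ?B1 s then run m ?b1 s else s)"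
    by (auto simp: fun_eq_iff)
  moreover have "e' 0 = e" by (simp add: e'_def)
  ultimately have 1: "run m (repeat P (Test (left u) {0} Nop (Test (left v) {0} Nop ?b1))) (st C w e 0 F out)
      = st C w (e' d) d F out"
    by (simp add: run_repeat P)
  have b: "e u < e v \<longleftrightarrow> e' d u = 0 \<and> e' d v \<noteq> 0"
    using uv by (auto simp: e'_def d_def)
  have "e' d u < length w" "e' d v < length w" using e uv by (auto simp: e'_def)
  then have 2: "run m (Test (left u) {0} (Test (left v) {0} (Push 2 1) (Push 2 2)) (Push 2 1))
      (st C w (e' d) d F out) = st C w (e' d) d (bit_symbol (e u < e v) # F) out" for F
    using uv topl unfolding b by (auto simp: bit_symbol_def)
  let ?b3 = "Move (right u) (left u) ;; Move (right v) (left v) ;; Pop 3"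
  let ?B3 = "\<lambda>s. top_sym (s 3) \<noteq> 0"
  have "((\<lambda>s. if ?B3 s then run m ?b3 s else s) ^^ length w) (st C w (e' (d - 0)) (d - 0) F out)
      = st C w (e' (d - d)) (d - d) F out" for F
  proof (rule funpow_while_states[where S = "\<lambda>k. st C w (e' (d - k)) (d - k) F out"])
    fix k assume k: "k < d"
    define l where "l = d - Suc k"
    have l: "d - k = Suc l" "Suc l \<le> e u" "Suc l \<le> e v" using k by (auto simp: l_def d_def)
    have "(e' (Suc l))(u := Suc (e u - Suc l), v := Suc (e v - Suc l)) = e' l"
      using uv l by (auto simp: e'_def Suc_diff_Suc fun_eq_iff)
    then have "run m ?b3 (st C w (e' (Suc l)) (Suc l) F out) = st C w (e' l) l F out"
      using move_right[of u C "e' (Suc l)" w m "Suc l" F out]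
        move_right[of v C "(e' (Suc l))(u := Suc (e u - Suc l))" w m "Suc l" F out]
        st_upd_simps(3)[of C w "e' l" "Suc l" F out l] uv e l
      by (simp add: e'_def)
    then show "?B3 (st C w (e' (d - k)) (d - k) F out) \<and> run m ?b3 (st C w (e' (d - k)) (d - k) F out)
        = st C w (e' (d - Suc k)) (d - Suc k) F out"
      by (simp only: l(1) l_def[symmetric]) simp
  qed (use e in \<open>auto simp: d_def\<close>)
  moreover have "run m (Test 3 {0} Nop ?b3) = (\<lambda>s. if ?B3 s then run m ?b3 s else s)"
    by (auto simp: fun_eq_iff)
  ultimately have 3: "run m (repeat P (Test 3 {0} Nop ?b3)) (st C w (e' d) d F out)
      = st C w e 0 F out" for F
    by (simp add: run_repeat P \<open>e' 0 = e\<close>)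
  show ?thesis unfolding comp.simps run.simps(5) 1 2 3 ..
qed

lemma run_comp:
  "wf_fm C \<phi> \<Longrightarrow> (\<And>v. v < C \<Longrightarrow> e v < length w) \<Longrightarrow> (\<And>v. v \<in> bound_vars \<phi> \<Longrightarrow> e v = 0) \<Longrightarrow>
   poly P m = length w \<Longrightarrow> 0 \<notin> set w \<Longrightarrow>
   run m (comp P \<phi>) (st C w e 0 F out) = st C w e 0 (bit_symbol (eval w e \<phi>) # F) out"
proof (induction \<phi> arbitrary: e F)
  case (Less u v)
  then show ?case using run_Less by simp
next
  case (Sym v A)
  then have "drop (e v) w = w ! e v # drop (Suc (e v)) w"
    by (simp add: Cons_nth_drop_Suc)
  with Sym show ?case by (simp add: bit_symbol_def)
next
  case (Neg \<phi>)
  then show ?case by (simp add: bit_symbol_def)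
next
  case (And \<phi> \<psi>)
  then show ?case by (simp add: bit_symbol_def)
next
  case (Exi v \<phi>)
  let ?c = "comp P \<phi> ;; Test 2 {2} (Pop 2 ;; Pop 2 ;; Push 2 2) (Pop 2)"
  \<comment> \<open>The entry below the current truth value accumulates the disjunction over the
    positions visited so far.\<close>
  define Fs where "Fs i = bit_symbol (\<exists>j<i. eval w (e(v := j)) \<phi>) # F" for i
  have "run m (For P v ?c) (st C w e 0 (Fs 0) out) = st C w e 0 (Fs (length w)) out"
  proof (rule run_For[where out = "\<lambda>_. out"])
    fix i assume i: "i < length w"
    have "run m (comp P \<phi>) (st C w (e(v := i)) 0 (Fs i) out)
        = st C w (e(v := i)) 0 (bit_symbol (eval w (e(v := i)) \<phi>) # Fs i) out"
      by (rule Exi.IH) (use Exi.prems i in auto)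
    then show "run m ?c (st C w (e(v := i)) 0 (Fs i) out) = st C w (e(v := i)) 0 (Fs (Suc i)) out"
      by (auto simp: Fs_def bit_symbol_def less_Suc_eq)
  qed (use Exi.prems in auto)
  then show ?case by (simp add: Fs_def bit_symbol_def)
next
  case (Const b)
  then show ?case by simp
qed

lemma wf_comp: "wf_fm C \<phi> \<Longrightarrow> G \<ge> 3 \<Longrightarrow> wf_com (4 + 2 * C) G (comp P \<phi>)"
  by (induction \<phi>) (auto simp: For_def left_def right_def bit_symbol_def intro!: wf_repeat)

text \<open>\<open>Z\<close> collects the variables over which \<open>c\<close> itself loops, whose
  zippers have to be at position \<open>0\<close>. Output is pushed, hence reversed.\<close>

definition emits :: "nat poly \<Rightarrow> nat \<Rightarrow> nat \<Rightarrow> nat list \<Rightarrow> nat set \<Rightarrow> com \<Rightarrow> ((nat \<Rightarrow> nat) \<Rightarrow> bool list) \<Rightarrow> bool" where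
  "emits P m C w Z c g \<longleftrightarrow> (\<forall>e out. (\<forall>v<C. e v < length w) \<longrightarrow> (\<forall>v\<in>Z. e v = 0) \<longrightarrow>
     run m c (st C w e 0 [] out) = st C w e 0 [] (rev (map bit_symbol (g e)) @ out))"

fun emit :: "bool list \<Rightarrow> com" where
  "emit [] = Nop"
| "emit (b # bs) = Push 0 (bit_symbol b) ;; emit bs"

definition test_fm :: "nat poly \<Rightarrow> fm \<Rightarrow> com \<Rightarrow> com \<Rightarrow> com" where
  "test_fm P \<phi> c d = comp P \<phi> ;; Test 2 {2} (Pop 2 ;; c) (Pop 2 ;; d)"

definition seqs :: "com list \<Rightarrow> com" where
  "seqs cs = foldr Comp cs Nop"

lemma emits_emit: "emits P m C w Z (emit bs) (\<lambda>_. bs)"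
proof -
  have "run m (emit bs) (st C w e 0 [] out) = st C w e 0 [] (rev (map bit_symbol bs) @ out)" for e out
    by (induction bs arbitrary: out) auto
  then show ?thesis by (simp add: emits_def)
qed

lemma emits_Comp:
  "emits P m C w Z c f \<Longrightarrow> emits P m C w Z d g \<Longrightarrow> emits P m C w Z (c ;; d) (\<lambda>e. f e @ g e)"
  by (simp add: emits_def)

lemma emits_seqs:
  "(\<And>x. x \<in> set xs \<Longrightarrow> emits P m C w Z (c x) (g x)) \<Longrightarrow>
   emits P m C w Z (seqs (map c xs)) (\<lambda>e. concat (map (\<lambda>x. g x e) xs))"
  by (induction xs) (auto simp: emits_def seqs_def)

lemma emits_test:
  assumes "emits P m C w Z c f" "emits P m C w Z d g" "wf_fm C \<phi>" "bound_vars \<phi> \<subseteq> Z"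
    "poly P m = length w" "0 \<notin> set w"
  shows "emits P m C w Z (test_fm P \<phi> c d) (\<lambda>e. if eval w e \<phi> then f e else g e)"
  unfolding emits_def
proof (intro allI impI)
  fix e out
  assume e: "\<forall>v<C. e v < length w" "\<forall>v\<in>Z. e v = 0"
  have "run m (comp P \<phi>) (st C w e 0 [] out) = st C w e 0 [bit_symbol (eval w e \<phi>)] out"
    by (rule run_comp) (use assms e in auto)
  then show "run m (test_fm P \<phi> c d) (st C w e 0 [] out) =
      st C w e 0 [] (rev (map bit_symbol (if eval w e \<phi> then f e else g e)) @ out)"
    using assms(1,2) e by (auto simp: test_fm_def emits_def bit_symbol_def)
qed

lemma emits_For:
  assumes "emits P m C w Z c g" "v \<notin> Z" "v < C" "poly P m = length w"
  shows "emits P m C w (insert v Z) (For P v c)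
           (\<lambda>e. concat (map (\<lambda>i. g (e(v := i))) [0..<length w]))"
  unfolding emits_def
proof (intro allI impI)
  fix e out
  assume e: "\<forall>v<C. e v < length w" "\<forall>v\<in>insert v Z. e v = 0"
  define outs where "outs n = rev (map bit_symbol (concat (map (\<lambda>i. g (e(v := i))) [0..<n]))) @ out" for n
  have "run m (For P v c) (st C w e 0 [] (outs 0)) = st C w e 0 [] (outs (length w))"
  proof (rule run_For[where F = "\<lambda>_. []"])
    fix i assume i: "i < length w"
    have "\<forall>u<C. (e(v := i)) u < length w" "\<forall>u\<in>Z. (e(v := i)) u = 0"
      using e i assms(2) by auto
    then show "run m c (st C w (e(v := i)) 0 [] (outs i)) = st C w (e(v := i)) 0 [] (outs (Suc i))"
      using assms(1) by (simp add: emits_def outs_def)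
  qed (use assms e in auto)
  then show "run m (For P v c) (st C w e 0 [] out) =
     st C w e 0 [] (rev (map bit_symbol (concat (map (\<lambda>i. g (e(v := i))) [0..<length w]))) @ out)"
    by (simp add: outs_def)
qed

lemma wf_emission:
  "G \<ge> 3 \<Longrightarrow> wf_com (4 + 2 * C) G (emit bs)"
  "wf_com (4 + 2 * C) G c \<Longrightarrow> wf_com (4 + 2 * C) G d \<Longrightarrow> wf_fm C \<phi> \<Longrightarrow> G \<ge> 3 \<Longrightarrow>
     wf_com (4 + 2 * C) G (test_fm P \<phi> c d)"
  "(\<And>c. c \<in> set cs \<Longrightarrow> wf_com (4 + 2 * C) G c) \<Longrightarrow> wf_com (4 + 2 * C) G (seqs cs)"
  "wf_com (4 + 2 * C) G c \<Longrightarrow> v < C \<Longrightarrow> wf_com (4 + 2 * C) G (For P v c)"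
proof -
  show "G \<ge> 3 \<Longrightarrow> wf_com (4 + 2 * C) G (emit bs)"
    by (induction bs) (auto simp: bit_symbol_def)
  show "wf_com (4 + 2 * C) G c \<Longrightarrow> wf_com (4 + 2 * C) G d \<Longrightarrow> wf_fm C \<phi> \<Longrightarrow> G \<ge> 3 \<Longrightarrow>
     wf_com (4 + 2 * C) G (test_fm P \<phi> c d)"
    by (simp add: test_fm_def wf_comp)
  show "(\<And>c. c \<in> set cs \<Longrightarrow> wf_com (4 + 2 * C) G c) \<Longrightarrow> wf_com (4 + 2 * C) G (seqs cs)"
    unfolding seqs_def by (induction cs) auto
  show "wf_com (4 + 2 * C) G c \<Longrightarrow> v < C \<Longrightarrow> wf_com (4 + 2 * C) G (For P v c)"
    by (auto simp: For_def left_def right_def intro!: wf_repeat)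
qed

section \<open>Independent sets as solutions of binary constraint systems\<close>

text \<open>
  The vertex \<open>s * m + a\<close> with \<open>0 < a\<close> stands for giving the \<open>s\<close>-th variable its \<open>a\<close>-th value, and the
  vertices \<open>s * m\<close> form the reference set. Values that violate a constraint on a single variable get
  weight zero instead of being deleted, which keeps the numbering of the vertices uniform.
\<close>

lemma unique_independent_set_iff:
  fixes edge :: "nat \<Rightarrow> nat \<Rightarrow> bool" and ok :: "nat \<Rightarrow> bool" and K m :: nat
  defines "n \<equiv> K * m"
  defines "I \<equiv> {i. i < n \<and> i mod m = 0}"
  defines "E \<equiv> {{i, j} | i j. j < i \<and> i < n \<and> edge j i}"
  defines "wt \<equiv> \<lambda>i. if i mod m = 0 \<or> ok i then 1 else (0::nat)"
  assumes K: "K > 0" and m: "m > 0"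
    and mixed: "\<And>i j. (i mod m = 0) \<noteq> (j mod m = 0) \<Longrightarrow> edge j i"
    and base: "\<And>i j. i mod m = 0 \<Longrightarrow> j mod m = 0 \<Longrightarrow> \<not> edge j i"
    and clique: "\<And>i j. i mod m \<noteq> 0 \<Longrightarrow> j mod m \<noteq> 0 \<Longrightarrow> i div m = j div m \<Longrightarrow> edge j i"
  shows "unique_max_weight_independent_set {..<n} E wt I \<longleftrightarrow>
     \<not> (\<exists>D. (\<forall>s<K. 0 < D s \<and> D s < m \<and> ok (s * m + D s)) \<and>
          (\<forall>s<K. \<forall>s'<s. \<not> edge (s' * m + D s') (s * m + D s)))"
proof -
  have E_iff: "{i, j} \<in> E \<longleftrightarrow> edge j i" if "j < i" "i < n" for i j
    using that unfolding E_def by (auto simp: doubleton_eq_iff)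
  have edge_E: "{i, j} \<in> E" if "i \<noteq> j" "i < n" "j < n" "edge i j" "edge j i" for i j
    using that E_iff[of i j] E_iff[of j i] by (cases "i < j") (auto simp: insert_commute)
  have I_eq: "I = (\<lambda>s. s * m) ` {..<K}"
  proof -
    have "i \<in> (\<lambda>s. s * m) ` {..<K}" if "i < n" "i mod m = 0" for i
    proof -
      have "i = (i div m) * m" using that(2) by (simp add: mod_0_imp_dvd)
      moreover have "i div m < K" using that(1) by (simp add: n_def less_mult_imp_div_less)
      ultimately show ?thesis by blast
    qed
    then show ?thesis using m by (auto simp: I_def n_def)
  qed
  have wI: "set_weight wt I = K"
  proof -
    have "set_weight wt I = card I" unfolding set_weight_def by (simp add: wt_def I_def)
    also have "\<dots> = K" unfolding I_eq using m by (subst card_image) (auto simp: inj_on_def)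
    finally show ?thesis .
  qed
  have indI: "independent_set {..<n} E I"
  proof -
    have "{u, v} \<notin> E" if "u \<in> I" "v \<in> I" "u \<noteq> v" for u v
      using that base E_iff[of u v] E_iff[of v u]
      by (cases "u < v") (auto simp: I_def insert_commute)
    then show ?thesis by (auto simp: independent_set_def I_def)
  qed
  show ?thesis
  proof
    assume U: "unique_max_weight_independent_set {..<n} E wt I"
    show "\<not> (\<exists>D. (\<forall>s<K. 0 < D s \<and> D s < m \<and> ok (s * m + D s)) \<and>
          (\<forall>s<K. \<forall>s'<s. \<not> edge (s' * m + D s') (s * m + D s)))"
    proof
      assume "\<exists>D. (\<forall>s<K. 0 < D s \<and> D s < m \<and> ok (s * m + D s)) \<and>
          (\<forall>s<K. \<forall>s'<s. \<not> edge (s' * m + D s') (s * m + D s))"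
      then obtain D where D: "\<And>s. s < K \<Longrightarrow> 0 < D s \<and> D s < m \<and> ok (s * m + D s)"
        and no: "\<And>s s'. s < K \<Longrightarrow> s' < s \<Longrightarrow> \<not> edge (s' * m + D s') (s * m + D s)" by blast
      define g where "g s = s * m + D s" for s
      have gdiv: "g s div m = s" "g s mod m = D s" if "s < K" for s
        using D[OF that] m by (simp_all add: g_def)
      have inj: "inj_on g {..<K}" using gdiv by (metis inj_onI lessThan_iff)
      have gn: "g s < n" if "s < K" for s
      proof -
        have "g s < Suc s * m" using D[OF that] by (simp add: g_def)
        also have "\<dots> \<le> K * m" using that by (intro mult_le_mono1) simp
        finally show ?thesis by (simp add: n_def)
      qed
      have lt: "g s < g s'" if "s < s'" "s' < K" for s s'
      proof -
        have "g s < Suc s * m" using D[of s] that by (simp add: g_def)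
        also have "\<dots> \<le> s' * m" using that by (intro mult_le_mono1) simp
        finally show ?thesis by (simp add: g_def)
      qed
      define S where "S = g ` {..<K}"
      have ne: "{g s', g s} \<notin> E" if "s < K" "s' < s" for s s'
        using E_iff[OF lt[OF that(2,1)] gn[OF that(1)]] no[OF that]
        by (simp add: g_def insert_commute)
      have "{g s, g s'} \<notin> E" if "s < K" "s' < K" "s \<noteq> s'" for s s'
        using ne[of s s'] ne[of s' s] that by (cases "s < s'") (auto simp: insert_commute)
      then have "independent_set {..<n} E S"
        using gn by (auto simp: independent_set_def S_def)
      moreover have "S \<noteq> I"
      proof
        assume "S = I"
        then have "g 0 \<in> I" using K by (auto simp: S_def)
        then show False using gdiv[of 0] D[of 0] K by (simp add: I_def)
      qed
      moreover have "set_weight wt S = K"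
      proof -
        have "set_weight wt S = (\<Sum>s<K. wt (g s))"
          unfolding set_weight_def S_def by (rule sum.reindex[OF inj, unfolded o_def])
        also have "\<dots> = K" using D by (simp add: wt_def g_def)
        finally show ?thesis .
      qed
      ultimately show False using U wI unfolding unique_max_weight_independent_set_def by fastforce
    qed
  next
    assume no: "\<not> (\<exists>D. (\<forall>s<K. 0 < D s \<and> D s < m \<and> ok (s * m + D s)) \<and>
          (\<forall>s<K. \<forall>s'<s. \<not> edge (s' * m + D s') (s * m + D s)))"
    have "set_weight wt S < K" if S: "independent_set {..<n} E S" and SI: "S \<noteq> I" for S
    proof -
      have Sn: "\<And>i. i \<in> S \<Longrightarrow> i < n" and indep: "\<And>i j. i \<in> S \<Longrightarrow> j \<in> S \<Longrightarrow> i \<noteq> j \<Longrightarrow> {i, j} \<notin> E"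
        using S by (auto simp: independent_set_def)
      have fin: "finite S" by (rule finite_subset[of _ "{..<n}"]) (use Sn in auto)
      show ?thesis
      \<comment> \<open>One vertex of \<open>I\<close> excludes all vertices outside
        \<open>I\<close>, so \<open>S\<close> is then a proper subset of \<open>I\<close>, where
        every weight is \<open>1\<close>.\<close>
      proof (cases "\<exists>i\<in>S. i mod m = 0")
        case True
        then obtain i where i: "i \<in> S" "i mod m = 0" by (rule bexE)
        have "S \<subseteq> I"
        proof
          fix j assume j: "j \<in> S"
          show "j \<in> I"
          proof (rule ccontr)
            assume "j \<notin> I"
            then have "j mod m \<noteq> 0" using Sn[OF j] by (simp add: I_def)
            moreover from this have ij: "i \<noteq> j" using i(2) by auto
            ultimately have "{i, j} \<in> E"
              using i mixed[of i j] mixed[of j i] edge_E[OF ij] Sn[OF j] Sn[OF i(1)] by auto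
            then show False using indep[OF i(1) j ij] by blast
          qed
        qed
        then have "S \<subset> I" using SI by blast
        then have "card S < card I" using I_eq by (intro psubset_card_mono) simp_all
        moreover have "set_weight wt S = card S" "set_weight wt I = card I"
          using \<open>S \<subseteq> I\<close> by (auto simp: set_weight_def wt_def I_def subset_iff)
        ultimately show ?thesis using wI by simp
      next
        case False
        \<comment> \<open>Vertices of weight zero contribute nothing. The others lie in different
          blocks, because every block is a clique; so there are at most \<open>K\<close> of
          them.\<close>
        define S' where "S' = {i \<in> S. ok i}"
        have "set_weight wt S = (\<Sum>i\<in>S. if ok i then 1 else 0)"
          unfolding set_weight_def using False by (intro sum.cong) (auto simp: wt_def)
        also have "\<dots> = card S'" using fin by (simp add: S'_def sum.If_cases Int_def)
        finally have wS: "set_weight wt S = card S'" .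
        have inj: "inj_on (\<lambda>i. i div m) S'"
        proof (rule inj_onI, rule ccontr)
          fix i j assume ij: "i \<in> S'" "j \<in> S'" "i div m = j div m" "i \<noteq> j"
          then have "edge i j" "edge j i" using clique[of i j] clique[of j i] False by (auto simp: S'_def)
          then show False using edge_E[of i j] ij Sn indep[of i j] by (auto simp: S'_def)
        qed
        have sub: "(\<lambda>i. i div m) ` S' \<subseteq> {..<K}"
          using Sn by (auto simp: S'_def n_def less_mult_imp_div_less)
        \<comment> \<open>Weight \<open>K\<close> would require one admissible vertex in every
          block, and these vertices would form a solution.\<close>
        have "card S' \<noteq> K"
        proof
          assume c: "card S' = K"
          then have img: "(\<lambda>i. i div m) ` S' = {..<K}"
            using card_image[OF inj] sub by (intro card_subset_eq) auto
          define h where "h s = (SOME i. i \<in> S' \<and> i div m = s)" for s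
          have h: "h s \<in> S' \<and> h s div m = s" if "s < K" for s
          proof -
            have "\<exists>i. i \<in> S' \<and> i div m = s" using img that by (metis imageE lessThan_iff)
            then show ?thesis unfolding h_def by (rule someI_ex)
          qed
          have hD: "s * m + h s mod m = h s" if "s < K" for s
            using h[OF that] by (metis div_mult_mod_eq)
          have "\<not> edge (s' * m + h s' mod m) (s * m + h s mod m)" if "s < K" "s' < s" for s s'
          proof -
            have s': "s' < K" using that by simp
            have "h s' < h s"
              using h[OF that(1)] h[OF s'] that(2) by (metis div_le_mono leD leI)
            then show ?thesis
              using h[OF that(1)] h[OF s'] E_iff[of "h s'" "h s"] indep[of "h s" "h s'"] Sn
              by (auto simp: hD that s' S'_def)
          qed
          moreover have "0 < h s mod m \<and> h s mod m < m \<and> ok (s * m + h s mod m)" if "s < K" for s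
            using h[OF that] hD[OF that] False m by (auto simp: S'_def)
          ultimately have "\<exists>D. (\<forall>s<K. 0 < D s \<and> D s < m \<and> ok (s * m + D s)) \<and>
            (\<forall>s<K. \<forall>s'<s. \<not> edge (s' * m + D s') (s * m + D s))"
            by (intro exI[of _ "\<lambda>s. h s mod m"]) blast
          with no show False by blast
        qed
        moreover have "card S' \<le> K"
          using card_mono[OF _ sub] card_image[OF inj] by simp
        ultimately show ?thesis using wS by simp
      qed
    qed
    then show "unique_max_weight_independent_set {..<n} E wt I"
      using indI wI by (simp add: unique_max_weight_independent_set_def)
  qed
qed

section \<open>The tableau of a computation\<close>

datatype cell = Cell (cstate: nat) (cread: "nat list") (csyms: "nat list") (cheads: "bool list")

text \<open>A halted machine gets an idle action that rewrites what it reads, so that one transition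
  rule covers all rows of the tableau.\<close>

definition next_move :: "machine \<Rightarrow> nat \<Rightarrow> nat list \<Rightarrow> nat \<times> (nat \<times> head_move) list" where
  "next_move M q ss = (if q = halt_state M then (q, map (\<lambda>s. (s, Stay)) ss) else delta M q ss)"

text \<open>Index \<open>p\<close> stands for the tape cell \<open>p - A\<close>; in particular
  \<open>A\<close> stands for cell \<open>0\<close>.\<close>

definition view :: "nat \<Rightarrow> config \<Rightarrow> nat \<Rightarrow> cell" where
  "view A = (\<lambda>(q, ts) p. Cell q (map read_tape ts) (map (\<lambda>(c, h). c (int p - int A)) ts)
     (map (\<lambda>(c, h). h = int p - int A) ts))"

text \<open>Symbols are compared at equal positions only, head flags between all positions: a cell
  with the head of a tape fixes the flag of that tape at every position of the next row. No other
  source for the flags is needed, since the head lies somewhere in the window.\<close>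

definition trans_ok :: "machine \<Rightarrow> nat \<Rightarrow> cell \<Rightarrow> nat \<Rightarrow> cell \<Rightarrow> bool" where
  "trans_ok M p' c' p c \<longleftrightarrow> (case next_move M (cstate c') (cread c') of (q, as) \<Rightarrow>
     cstate c = q \<and>
     (p = p' \<longrightarrow> (\<forall>j<num_tapes M.
        csyms c ! j = (if cheads c' ! j then fst (as ! j) else csyms c' ! j))) \<and>
     (\<forall>j<num_tapes M. cheads c' ! j \<longrightarrow>
        (cheads c ! j \<longleftrightarrow> int p = int p' + move_offset (snd (as ! j)))))"

text \<open>
  In the word describing the start of a computation the symbols \<open>1\<close>, \<open>2\<close> stand for given bits,
  \<open>3\<close> for a cell of the certificate, and \<open>4\<close>, \<open>5\<close> for the blanks to the left and to the right.
\<close>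

definition compat :: "nat \<Rightarrow> nat set" where
  "compat y = (if y = 0 then {3, 4, 5} else if y = 1 then {1, 3} else if y = 2 then {2, 3} else {})"

text \<open>The first condition checks the guessed read symbols where the heads stand. In the last
  row, symbol \<open>2\<close> in cell \<open>0\<close> of the last tape is the answer
  \<open>True\<close>.\<close>

definition cell_ok :: "machine \<Rightarrow> nat \<Rightarrow> nat list \<Rightarrow> nat \<Rightarrow> nat \<Rightarrow> cell \<Rightarrow> bool" where
  "cell_ok M A w t p c \<longleftrightarrow>
     (\<forall>j<num_tapes M. cheads c ! j \<longrightarrow> csyms c ! j = cread c ! j) \<and>
     (t = 0 \<longrightarrow> cstate c = start_state M \<and> (\<forall>j<num_tapes M. cheads c ! j \<longleftrightarrow> p = A) \<and>
        (\<forall>j<num_tapes M. 0 < j \<longrightarrow> csyms c ! j = 0) \<and> w ! p \<in> compat (csyms c ! 0)) \<and>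
     (Suc t = length w \<longrightarrow> p = A \<longrightarrow> csyms c ! (num_tapes M - 1) = 2)"

text \<open>The disjunct \<open>p = p'\<close> provides the cliques. The last line is meant for
  \<open>p' < p\<close>: in the guessed region no letter may follow a blank, so what is guessed is a
  word padded with blanks.\<close>

definition conflict :: "machine \<Rightarrow> nat list \<Rightarrow> nat \<Rightarrow> nat \<Rightarrow> cell \<Rightarrow> nat \<Rightarrow> nat \<Rightarrow> cell \<Rightarrow> bool" where
  "conflict M w t' p' c' t p c \<longleftrightarrow>
     (t = t' \<and> (cstate c \<noteq> cstate c' \<or> cread c \<noteq> cread c' \<or> p = p')) \<or>
     (t = Suc t' \<and> \<not> trans_ok M p' c' p c) \<or>
     (t = 0 \<and> t' = 0 \<and> csyms c' ! 0 = 0 \<and> csyms c ! 0 \<noteq> 0 \<and> w ! p' = 3 \<and> w ! p = 3)"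

definition cells :: "machine \<Rightarrow> cell set" where
  "cells M = {Cell q ss ys hs | q ss ys hs. q < num_states M \<and>
     length ss = num_tapes M \<and> (\<forall>s\<in>set ss. s < num_symbols M) \<and>
     length ys = num_tapes M \<and> (\<forall>s\<in>set ys. s < num_symbols M) \<and> length hs = num_tapes M}"

lemma finite_cells: "finite (cells M)"
proof -
  let ?L = "{ss. set ss \<subseteq> {..<num_symbols M} \<and> length ss = num_tapes M}"
  let ?H = "{hs. set hs \<subseteq> (UNIV::bool set) \<and> length hs = num_tapes M}"
  have "finite ?L" "finite ?H" by (intro finite_lists_length_eq; simp)+
  then have "finite ((\<lambda>(q, ss, ys, hs). Cell q ss ys hs) ` ({..<num_states M} \<times> ?L \<times> ?L \<times> ?H))"
    by (intro finite_imageI finite_cartesian_product) simp_all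
  then show ?thesis
    by (rule finite_subset[rotated]) (auto simp: cells_def image_iff subset_iff)
qed

section \<open>Views of an actual computation\<close>

definition valid_config :: "machine \<Rightarrow> config \<Rightarrow> bool" where
  "valid_config M = (\<lambda>(q, ts). q < num_states M \<and> length ts = num_tapes M \<and>
     (\<forall>(c, h)\<in>set ts. \<forall>z. c z < num_symbols M))"

lemma step_next_move:
  "step M (q, ts) = (case next_move M q (map read_tape ts) of (q', as) \<Rightarrow> (q', map2 update_tape as ts))"
proof -
  have "map2 update_tape (map (\<lambda>s. (s, Stay)) (map read_tape ts)) ts = ts"
    by (rule nth_equalityI) (auto simp: update_tape_def read_tape_def split: prod.splits)
  then show ?thesis by (simp add: step_def next_move_def)
qed

lemma next_move_valid:
  assumes "turing_machine M" "q < num_states M" "length ss = num_tapes M" "\<forall>s\<in>set ss. s < num_symbols M"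
    "next_move M q ss = (q', as)"
  shows "q' < num_states M" "length as = num_tapes M" "\<forall>(s, d)\<in>set as. s < num_symbols M"
proof -
  have "case next_move M q ss of (q', as) \<Rightarrow>
    q' < num_states M \<and> length as = num_tapes M \<and> (\<forall>(s, d)\<in>set as. s < num_symbols M)"
  proof (cases "q = halt_state M")
    case False
    then show ?thesis using assms(1-4) unfolding next_move_def turing_machine_def by simp
  qed (use assms(2-4) in \<open>auto simp: next_move_def\<close>)
  then show "q' < num_states M" "length as = num_tapes M" "\<forall>(s, d)\<in>set as. s < num_symbols M"
    using assms(5) by simp_all
qed

lemma read_valid: "valid_config M (q, ts) \<Longrightarrow> \<forall>s\<in>set (map read_tape ts). s < num_symbols M"
  by (fastforce simp: valid_config_def read_tape_def)

lemma valid_step: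
  assumes "turing_machine M" "valid_config M (q, ts)"
  shows "valid_config M (step M (q, ts))"
proof -
  obtain q' as where n: "next_move M q (map read_tape ts) = (q', as)" by fastforce
  have q: "q < num_states M" "length (map read_tape ts) = num_tapes M"
    using assms(2) by (auto simp: valid_config_def)
  note v = next_move_valid[OF assms(1) q read_valid[OF assms(2)] n]
  have "c z < num_symbols M" if "(c, h) \<in> set (map2 update_tape as ts)" for c h z
  proof -
    from that have mem: "(c, h) \<in> set (map2 update_tape as ts)" .
    obtain s d c0 h0 where "(s, d) \<in> set as" "(c0, h0) \<in> set ts" "(c, h) = update_tape (s, d) (c0, h0)"
    proof -
      from mem obtain a b where ab: "(a, b) \<in> set (zip as ts)" "(c, h) = update_tape a b" by auto
      then show ?thesis
        using that[of "fst a" "snd a" "fst b" "snd b"] set_zip_leftD[OF ab(1)] set_zip_rightD[OF ab(1)]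
        by simp
    qed
    then show ?thesis using v(3) assms(2) by (fastforce simp: update_tape_def valid_config_def)
  qed
  then have "\<forall>(c, h)\<in>set (map2 update_tape as ts). \<forall>z. c z < num_symbols M" by blast
  then show ?thesis using v q by (simp add: step_next_move n valid_config_def)
qed

lemma view_in_cells:
  assumes "valid_config M (q, ts)"
  shows "view A (q, ts) p \<in> cells M"
  using assms read_valid[OF assms] by (fastforce simp: view_def cells_def valid_config_def)

lemma trans_ok_view:
  assumes "turing_machine M" "valid_config M (q, ts)"
  shows "trans_ok M p' (view A (q, ts) p') p (view A (step M (q, ts)) p)"
proof -
  obtain q' as where n: "next_move M q (map read_tape ts) = (q', as)" by fastforce
  have q: "q < num_states M" "length (map read_tape ts) = num_tapes M"
    using assms(2) by (auto simp: valid_config_def)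
  note v = next_move_valid[OF assms(1) q read_valid[OF assms(2)] n]
  show ?thesis
    unfolding trans_ok_def step_next_move n
    using v q by (auto simp: view_def n update_tape_def split: prod.splits)
qed

lemma view_simps:
  "cstate (view A (q, ts) p) = q"
  "cread (view A (q, ts) p) = map read_tape ts"
  "j < length ts \<Longrightarrow> csyms (view A (q, ts) p) ! j = fst (ts ! j) (int p - int A)"
  "j < length ts \<Longrightarrow> cheads (view A (q, ts) p) ! j \<longleftrightarrow> snd (ts ! j) = int p - int A"
  "length (csyms (view A (q, ts) p)) = length ts" "length (cheads (view A (q, ts) p)) = length ts"
  by (simp_all add: view_def split_beta)

text \<open>\<open>P\<close> bounds the length of certificates, and \<open>A\<close> bounds the
  running time on all pairs with such a certificate.\<close>

locale certificate_tableau =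
  fixes M :: machine and R :: language and q :: "nat poly" and x :: "bool list" and P A :: nat
  assumes tm: "turing_machine M"
    and comp: "computes_in_time M (\<lambda>y. [y \<in> R]) (poly q)"
    and bound: "\<And>u. length u \<le> P \<Longrightarrow> poly q (length (pair x u)) \<le> A"
begin

definition l :: nat where "l = length (delimit x)"

text \<open>\<open>A\<close> cells to the left of cell \<open>0\<close> and at least
  \<open>A\<close> to its right contain every position that a head reaches in \<open>A\<close>
  steps. The guessed region directly follows \<open>delimit x\<close>, as the certificate does in
  \<open>pair\<close>.\<close>

definition w :: "nat list" where
  "w = replicate A 4 @ map bit_symbol (delimit x) @ replicate P 3 @ replicate (Suc A) 5"

abbreviation N :: nat where "N \<equiv> length w"

lemma N: "N = A + l + P + Suc A"
  by (simp add: w_def l_def)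

lemma w_nth: "p < N \<Longrightarrow> w ! p = (if p < A then 4 else if p < A + l then bit_symbol (delimit x ! (p - A))
    else if p < A + l + P then 3 else 5)"
  unfolding N by (auto simp: w_def l_def nth_append simp del: replicate_Suc)

section \<open>The computation for a fixed certificate\<close>

definition cf :: "bool list \<Rightarrow> nat \<Rightarrow> config" where
  "cf u \<tau> = (step M ^^ \<tau>) (init_config M (pair x u))"

lemma init_tapes:
  "fst (cf u 0) = start_state M" "length (snd (cf u 0)) = num_tapes M"
  "j < num_tapes M \<Longrightarrow> snd (cf u 0) ! j = (if j = 0 then word_tape (pair x u) else word_tape [])"
  using tm by (auto simp: cf_def init_config_def turing_machine_def nth_Cons split: nat.splits)

lemma valid_cf: "valid_config M (fst (cf u \<tau>), snd (cf u \<tau>))"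
proof (induction \<tau>)
  case 0
  have "bit_symbol b < num_symbols M" for b using tm by (auto simp: turing_machine_def bit_symbol_def)
  moreover have "blank < num_symbols M" using tm by (auto simp: turing_machine_def blank_def)
  ultimately have "\<forall>z. fst (word_tape y) z < num_symbols M" for y by (auto simp: word_tape_def)
  then have "\<forall>z. c z < num_symbols M" if "(c, h) \<in> set (snd (cf u 0))" for c h
    using that by (auto simp: cf_def init_config_def) (metis fst_conv)+
  then show ?case using init_tapes(1,2)[of u] tm by (auto simp: valid_config_def turing_machine_def)
next
  case (Suc \<tau>)
  then have "valid_config M (step M (fst (cf u \<tau>), snd (cf u \<tau>)))" by (rule valid_step[OF tm])
  then show ?case by (simp add: cf_def)
qed

lemma length_cf: "length (snd (cf u \<tau>)) = num_tapes M"
  using valid_cf[of u \<tau>] by (simp add: valid_config_def split_beta)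

lemma cf_Suc: "cf u (Suc \<tau>) = step M (cf u \<tau>)"
  by (simp add: cf_def)

lemma cf_halted:
  assumes "length u \<le> P" "A \<le> \<tau>"
  shows "cf u \<tau> = cf u A" "tape_holds (last (snd (cf u \<tau>))) [pair x u \<in> R]"
proof -
  define T where "T = poly q (length (pair x u))"
  have T: "fst (cf u T) = halt_state M" "tape_holds (last (snd (cf u T))) [pair x u \<in> R]"
    using comp unfolding computes_in_time_def cf_def T_def by (auto simp: case_prod_beta)
  have halted: "step M (cf u T) = cf u T"
    using T(1) by (cases "cf u T") (simp add: step_def)
  have stay: "cf u (T + d) = cf u T" for d
    by (induction d) (simp_all add: cf_Suc halted)
  have *: "cf u \<tau> = cf u T" if "T \<le> \<tau>" for \<tau>
    using stay[of "\<tau> - T"] that by simp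
  have "T \<le> A" using bound[OF assms(1)] by (simp add: T_def)
  then show "cf u \<tau> = cf u A" "tape_holds (last (snd (cf u \<tau>))) [pair x u \<in> R]"
    using *[of \<tau>] *[of A] T assms(2) by simp_all
qed

lemma head_step:
  assumes "j < num_tapes M"
  shows "\<bar>snd (snd (cf u (Suc \<tau>)) ! j)\<bar> \<le> \<bar>snd (snd (cf u \<tau>) ! j)\<bar> + 1"
proof -
  obtain q' as where n: "next_move M (fst (cf u \<tau>)) (map read_tape (snd (cf u \<tau>))) = (q', as)" by fastforce
  have qv: "fst (cf u \<tau>) < num_states M" using valid_cf[of u \<tau>] by (simp add: valid_config_def split_beta)
  have "length as = num_tapes M"
    using next_move_valid(2)[OF tm qv _ read_valid[OF valid_cf] n] length_cf by simp
  moreover have "cf u (Suc \<tau>) = (q', map2 update_tape as (snd (cf u \<tau>)))"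
    using step_next_move[of M "fst (cf u \<tau>)" "snd (cf u \<tau>)"] n by (simp add: cf_Suc)
  ultimately have "snd (cf u (Suc \<tau>)) ! j = update_tape (as ! j) (snd (cf u \<tau>) ! j)"
    using assms length_cf[of u \<tau>] by simp
  moreover have *: "\<bar>snd (update_tape (s, d) (c, h))\<bar> \<le> \<bar>h\<bar> + 1" for s d c h
    by (cases d) (auto simp: update_tape_def)
  ultimately show ?thesis
    using *[of "fst (as ! j)" "snd (as ! j)" "fst (snd (cf u \<tau>) ! j)" "snd (snd (cf u \<tau>) ! j)"]
    by simp
qed

text \<open>A head moves by at most one cell per step, and after time \<open>A\<close> the
  configuration is frozen. So the bound also holds in the rows beyond \<open>A\<close>.\<close>

lemma head_bound:
  assumes "length u \<le> P" "j < num_tapes M"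
  shows "\<bar>snd (snd (cf u \<tau>) ! j)\<bar> \<le> int A"
proof -
  have *: "\<bar>snd (snd (cf u \<tau>) ! j)\<bar> \<le> int \<tau>" for \<tau>
  proof (induction \<tau>)
    case 0
    then show ?case using init_tapes(3)[OF assms(2)] by (simp add: word_tape_def)
  next
    case (Suc \<tau>)
    then show ?case using head_step[OF assms(2), of u \<tau>] by simp
  qed
  show ?thesis
  proof (cases "\<tau> \<le> A")
    case True
    then show ?thesis using *[of \<tau>] by simp
  next
    case False
    then show ?thesis using cf_halted(1)[OF assms(1), of \<tau>] *[of A] by simp
  qed
qed

lemma k_pos: "0 < num_tapes M"
  using tm by (simp add: turing_machine_def)

lemma last_cf: "last (snd (cf u \<tau>)) = snd (cf u \<tau>) ! (num_tapes M - 1)"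
  using length_cf[of u \<tau>] k_pos by (metis last_conv_nth length_greater_0_conv)

abbreviation vw :: "bool list \<Rightarrow> nat \<Rightarrow> nat \<Rightarrow> cell" where
  "vw u t p \<equiv> view A (cf u t) p"

lemma vw_simps:
  "cstate (vw u t p) = fst (cf u t)"
  "cread (vw u t p) = map read_tape (snd (cf u t))"
  "j < num_tapes M \<Longrightarrow> csyms (vw u t p) ! j = fst (snd (cf u t) ! j) (int p - int A)"
  "j < num_tapes M \<Longrightarrow> cheads (vw u t p) ! j \<longleftrightarrow> snd (snd (cf u t) ! j) = int p - int A"
  using view_simps[where A = A and q = "fst (cf u t)" and ts = "snd (cf u t)" and p = p] length_cf[of u t] by simp_all

lemma vw_cells: "vw u t p \<in> cells M"
  using view_in_cells[OF valid_cf[of u t], of A p] by simp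

lemma vw_trans: "trans_ok M p' (vw u t p') p (vw u (Suc t) p)"
  using trans_ok_view[OF tm valid_cf[of u t], of p' A p] by (simp add: cf_Suc)

lemma input_cell:
  assumes "p < N"
  shows "fst (word_tape (pair x u)) (int p - int A) =
    (if p < A then 0 else if p < A + l then bit_symbol (delimit x ! (p - A))
     else if p < A + l + length u then bit_symbol (u ! (p - A - l)) else 0)"
  using assms by (auto simp: word_tape_def pair_def l_def nth_append blank_def nat_diff_distrib' of_nat_diff)

lemma run_imp_tableau:
  assumes u: "length u \<le> P" "pair x u \<in> R"
  shows "\<And>t p. t < N \<Longrightarrow> p < N \<Longrightarrow> cell_ok M A w t p (vw u t p)"
    and "\<And>t p t' p'. t < N \<Longrightarrow> p < N \<Longrightarrow> p' < N \<Longrightarrow> t' < t \<or> t' = t \<and> p' < p \<Longrightarrow>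
      \<not> conflict M w t' p' (vw u t' p') t p (vw u t p)"
proof -
  show "cell_ok M A w t p (vw u t p)" if tp: "t < N" "p < N" for t p
    unfolding cell_ok_def
  proof (intro conjI impI)
    show "\<forall>j<num_tapes M. cheads (vw u t p) ! j \<longrightarrow> csyms (vw u t p) ! j = cread (vw u t p) ! j"
      using length_cf[of u t] by (auto simp: vw_simps read_tape_def split_beta)
    assume t: "t = 0"
    show "cstate (vw u t p) = start_state M" by (simp add: vw_simps t init_tapes)
    show "\<forall>j<num_tapes M. cheads (vw u t p) ! j \<longleftrightarrow> p = A"
      by (auto simp: vw_simps t init_tapes word_tape_def)
    show "\<forall>j<num_tapes M. 0 < j \<longrightarrow> csyms (vw u t p) ! j = 0"
      by (auto simp: vw_simps t init_tapes word_tape_def blank_def)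
    show "w ! p \<in> compat (csyms (vw u t p) ! 0)"
      using k_pos u(1) by (auto simp: vw_simps t init_tapes input_cell[OF tp(2)] w_nth[OF tp(2)] compat_def bit_symbol_def)
  next
    assume "Suc t = N" "p = A"
    moreover from this have "A \<le> t" using N by simp
    then have "tape_holds (last (snd (cf u t))) [True]" using cf_halted(2)[OF u(1), of t] u(2) by simp
    then have "fst (last (snd (cf u t))) 0 = 2"
      by (simp add: tape_holds_def split_beta)
    ultimately show "csyms (vw u t p) ! (num_tapes M - 1) = 2"
      using k_pos by (simp add: vw_simps last_cf)
  qed
  show "\<not> conflict M w t' p' (vw u t' p') t p (vw u t p)"
    if "t < N" "p < N" "p' < N" "t' < t \<or> t' = t \<and> p' < p" for t p t' p'
  proof -
    \<comment> \<open>A blank in the guessed region lies behind the end of \<open>u\<close>, and so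
      does every later position of that region.\<close>
    have "csyms (vw u 0 p) ! 0 = 0" if "csyms (vw u 0 p') ! 0 = 0" "w ! p' = 3" "w ! p = 3" "p' < p"
      using that k_pos w_nth[OF \<open>p < N\<close>] w_nth[OF \<open>p' < N\<close>]
      by (auto simp: vw_simps init_tapes input_cell[OF \<open>p < N\<close>] input_cell[OF \<open>p' < N\<close>] bit_symbol_def split: if_splits)
    then show ?thesis using that(4) vw_trans[of p' u t' p]
      by (auto simp: conflict_def vw_simps(1,2))
  qed
qed

text \<open>The certificate is read off row \<open>0\<close>, up to the first blank in the guessed
  region. By induction on time, every row then consists of the views of the computation with this
  certificate, so the acceptance test in the last row speaks about the real output.\<close>

lemma tableau_imp_run:
  assumes cells: "\<And>t p. t < N \<Longrightarrow> p < N \<Longrightarrow> c t p \<in> cells M \<and> cell_ok M A w t p (c t p)"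
    and noc: "\<And>t p t' p'. t < N \<Longrightarrow> p < N \<Longrightarrow> p' < N \<Longrightarrow> t' < t \<or> t' = t \<and> p' < p \<Longrightarrow>
       \<not> conflict M w t' p' (c t' p') t p (c t p)"
  shows "\<exists>u. length u \<le> P \<and> pair x u \<in> R"
proof -
  have N0: "0 < N" "A < N" using N by auto
  define y where "y i = csyms (c 0 (A + l + i)) ! 0" for i
  \<comment> \<open>The first blank of the guessed region; \<open>P\<close> is the default if there
    is none.\<close>
  define i0 where "i0 = (LEAST i. i = P \<or> (i < P \<and> y i = 0))"
  have i0: "i0 = P \<or> (i0 < P \<and> y i0 = 0)" unfolding i0_def by (rule LeastI[of _ P]) simp
  have i0P: "i0 \<le> P" using i0 by auto
  have before: "y i \<noteq> 0" if "i < i0" for i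
    using not_less_Least[of i "\<lambda>i. i = P \<or> (i < P \<and> y i = 0)"] that i0P by (auto simp: i0_def[symmetric])
  define u where "u = map (\<lambda>i. y i = 2) [0..<i0]"
  have u: "length u \<le> P" "length u = i0" using i0P by (simp_all add: u_def)
  have ok0: "w ! p \<in> compat (csyms (c 0 p) ! 0)" if "p < N" for p
    using cells[OF N0(1) that] by (simp add: cell_ok_def)
  have y_cell: "y i \<in> {1, 2} \<and> bit_symbol (u ! i) = y i" if "i < i0" for i
  proof -
    have "A + l + i < N" using that i0P by (simp add: N)
    from ok0[OF this] w_nth[OF this] before[OF that] that i0P show ?thesis
      by (auto simp: compat_def y_def u_def split: if_splits)
  qed
  have after: "y i = 0" if "i0 \<le> i" "i < P" for i
  proof (cases "i = i0")
    case False
    have lt: "A + l + i < N" "A + l + i0 < N" using that i0P by (simp_all add: N)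
    have "\<not> conflict M w 0 (A + l + i0) (c 0 (A + l + i0)) 0 (A + l + i) (c 0 (A + l + i))"
      using noc[OF N0(1) lt] that False by simp
    then show ?thesis using i0 that w_nth[OF lt(1)] w_nth[OF lt(2)] by (auto simp: conflict_def y_def)
  qed (use i0 that in auto)
  have sym0: "csyms (c 0 p) ! 0 = fst (word_tape (pair x u)) (int p - int A)" if p: "p < N" for p
  proof -
    consider "p < A" | "A \<le> p" "p < A + l" | i where "p = A + l + i" "i < P" | "A + l + P \<le> p"
      by (metis add_less_cancel_left le_add_diff_inverse not_less)
    then show ?thesis
    proof cases
      case 3
      then have "csyms (c 0 p) ! 0 = y i" by (simp add: y_def)
      then show ?thesis using 3 y_cell[of i] after[of i] u(2)
        unfolding input_cell[OF p] by (cases "i < i0") auto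
    qed (use ok0[OF p] w_nth[OF p] u in \<open>auto simp: input_cell[OF p] compat_def bit_symbol_def split: if_splits\<close>)
  qed
  have len: "length (cread (c t p)) = num_tapes M" "length (csyms (c t p)) = num_tapes M"
    "length (cheads (c t p)) = num_tapes M" if "t < N" "p < N" for t p
    using cells[OF that] by (auto simp: cells_def)
  have same: "cstate (c t p) = cstate (c t p') \<and> cread (c t p) = cread (c t p')"
    if "t < N" "p < N" "p' < N" for t p p'
    using noc[of t p p' t] noc[of t p' p t] that
    by (cases p p' rule: linorder_cases) (auto simp: conflict_def)
  \<comment> \<open>Once states, symbols and head flags of a row are right, so are the read symbols:
    head \<open>j\<close> stands at some \<open>p1\<close> inside the window, \<open>cell_ok\<close>
    compares there, and \<open>same\<close> carries the result to all positions of the row.\<close>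
  have cell_eq: "c t p = vw u t p"
    if tp: "t < N" "p < N"
      and st: "\<And>p. p < N \<Longrightarrow> cstate (c t p) = cstate (vw u t p)"
      and sy: "\<And>p j. p < N \<Longrightarrow> j < num_tapes M \<Longrightarrow> csyms (c t p) ! j = csyms (vw u t p) ! j"
      and hd: "\<And>p j. p < N \<Longrightarrow> j < num_tapes M \<Longrightarrow> cheads (c t p) ! j = cheads (vw u t p) ! j"
    for t p
  proof (rule cell.expand, intro conjI)
    show "cread (c t p) = cread (vw u t p)"
    proof (rule nth_equalityI)
      fix j assume "j < length (cread (c t p))"
      then have j: "j < num_tapes M" using len[OF tp] by simp
      define p1 where "p1 = nat (snd (snd (cf u t) ! j) + int A)"
      have p1: "int p1 - int A = snd (snd (cf u t) ! j)" "p1 < N"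
        using head_bound[OF u(1) j, of t] by (auto simp: p1_def N)
      then have "cheads (c t p1) ! j" using hd[OF p1(2) j] j by (simp add: vw_simps)
      then have "csyms (c t p1) ! j = cread (c t p1) ! j"
        using cells[OF tp(1) p1(2)] j by (simp add: cell_ok_def)
      then have "cread (c t p) ! j = csyms (vw u t p1) ! j"
        using same[OF tp(1) tp(2) p1(2)] sy[OF p1(2) j] by simp
      also have "\<dots> = cread (vw u t p) ! j"
        using j length_cf[of u t] p1(1) by (simp add: vw_simps read_tape_def split_beta)
      finally show "cread (c t p) ! j = cread (vw u t p) ! j" .
    qed (use len[OF tp] length_cf in \<open>simp add: vw_simps\<close>)
    show "csyms (c t p) = csyms (vw u t p)"
      by (rule nth_equalityI) (use len[OF tp] sy[OF tp(2)] view_simps(5)[where A = A and q = "fst (cf u t)" and ts = "snd (cf u t)" and p = p] length_cf in auto)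
    show "cheads (c t p) = cheads (vw u t p)"
      by (rule nth_equalityI) (use len[OF tp] hd[OF tp(2)] view_simps(6)[where A = A and q = "fst (cf u t)" and ts = "snd (cf u t)" and p = p] length_cf in auto)
  qed (use st tp in auto)
  have eq: "\<forall>p<N. c t p = vw u t p" if "t < N" for t
    using that
  proof (induction t)
    case 0
    show ?case
    proof (intro allI impI cell_eq)
      fix p assume p: "p < N"
      note ok = cells[OF N0(1) p, unfolded cell_ok_def]
      show "cstate (c 0 p) = cstate (vw u 0 p)" using ok by (simp add: vw_simps init_tapes)
      fix j assume j: "j < num_tapes M"
      show "csyms (c 0 p) ! j = csyms (vw u 0 p) ! j"
        using ok j sym0[OF p] by (auto simp: vw_simps init_tapes word_tape_def blank_def)
      show "cheads (c 0 p) ! j = cheads (vw u 0 p) ! j"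
        using ok j by (auto simp: vw_simps init_tapes word_tape_def)
    qed (use N0 in auto)
  next
    case (Suc t)
    then have IH: "\<And>p. p < N \<Longrightarrow> c t p = vw u t p" and tN: "Suc t < N" "t < N" by auto
    have tr: "trans_ok M p' (vw u t p') p (c (Suc t) p)" if "p < N" "p' < N" for p p'
      using noc[OF tN(1) that, of t] IH[OF that(2)] by (auto simp: conflict_def)
    show ?case
    proof (intro allI impI cell_eq)
      fix p assume p: "p < N"
      obtain q' as where n: "next_move M (cstate (vw u t 0)) (cread (vw u t 0)) = (q', as)" by fastforce
      have n': "next_move M (cstate (vw u t p')) (cread (vw u t p')) = (q', as)" for p'
        using n by (simp add: vw_simps)
      note tr' = tr[OF p, unfolded trans_ok_def n' prod.case]
      note vt = vw_trans[of _ u t p, unfolded trans_ok_def n' prod.case]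
      show "cstate (c (Suc t) p) = cstate (vw u (Suc t) p)"
        using tr'[OF p] vt[of p] by simp
      fix j assume j: "j < num_tapes M"
      show "csyms (c (Suc t) p) ! j = csyms (vw u (Suc t) p) ! j"
        using tr'[OF p] vt[of p] j by simp
      \<comment> \<open>The position of head \<open>j\<close> in row \<open>t\<close>; its cell
        alone determines flag \<open>j\<close> at position \<open>p\<close> of the next row.\<close>
      define p1 where "p1 = nat (snd (snd (cf u t) ! j) + int A)"
      have p1: "int p1 - int A = snd (snd (cf u t) ! j)" "p1 < N"
        using head_bound[OF u(1) j, of t] by (auto simp: p1_def N)
      then have "cheads (vw u t p1) ! j" using j by (simp add: vw_simps)
      then show "cheads (c (Suc t) p) ! j = cheads (vw u (Suc t) p) ! j"
        using tr'[OF p1(2)] vt[of p1] j by auto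
    qed (use tN in auto)
  qed
  have "Suc (N - 1) = N" "A \<le> N - 1" "N - 1 < N" using N by auto
  then have "csyms (vw u (N - 1) A) ! (num_tapes M - 1) = 2"
    using cells[of "N - 1" A] N0 eq[of "N - 1"] by (simp add: cell_ok_def)
  then have "fst (last (snd (cf u (N - 1)))) 0 = 2"
    using k_pos by (simp add: vw_simps last_cf)
  moreover have "tape_holds (last (snd (cf u (N - 1)))) [pair x u \<in> R]"
    using cf_halted(2)[OF u(1) \<open>A \<le> N - 1\<close>] .
  ultimately have "pair x u \<in> R"
    by (cases "pair x u \<in> R") (auto simp: tape_holds_def split_beta)
  then show ?thesis using u(1) by blast
qed

end

section \<open>The reduction\<close>

definition Disj :: "fm \<Rightarrow> fm \<Rightarrow> fm" where "Disj \<phi> \<psi> = Neg (And (Neg \<phi>) (Neg \<psi>))"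
definition eq_fm :: "nat \<Rightarrow> nat \<Rightarrow> fm" where "eq_fm u v = And (Neg (Less u v)) (Neg (Less v u))"
definition zero_fm :: "nat \<Rightarrow> fm" where "zero_fm v = Neg (Exi 4 (Less 4 v))"
definition last_fm :: "nat \<Rightarrow> fm" where "last_fm v = Neg (Exi 4 (Less v 4))"
definition succ_fm :: "nat \<Rightarrow> nat \<Rightarrow> fm" where
  "succ_fm u v = And (Less u v) (Neg (Exi 4 (And (Less u 4) (Less 4 v))))"
text \<open>Describes the first position that does not carry the symbol \<open>4\<close>. This is
  how the formulas refer to \<open>A\<close>, a number that varies with the input.\<close>

definition start_fm :: "nat \<Rightarrow> fm" where
  "start_fm v = And (Neg (Sym v {4})) (Neg (Exi 4 (And (Less 4 v) (Neg (Sym 4 {4})))))"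
definition Conj_list :: "fm list \<Rightarrow> fm" where "Conj_list \<phi>s = foldr And \<phi>s (Const True)"

text \<open>
  In the formulas below the variables \<open>0\<close> and \<open>1\<close> are time and position of the later cell,
  \<open>2\<close> and \<open>3\<close> those of the earlier cell.
\<close>

definition moved_fm :: "head_move \<Rightarrow> fm" where
  "moved_fm d = (case d of Move_Left \<Rightarrow> succ_fm 1 3 | Stay \<Rightarrow> eq_fm 1 3 | Move_Right \<Rightarrow> succ_fm 3 1)"

text \<open>Everything that depends on the two values only is a \<open>Const\<close>, settled when
  the program text is formed. What is left to the machine is the comparison of positions.\<close>

definition trans_fm :: "machine \<Rightarrow> cell \<Rightarrow> cell \<Rightarrow> fm" where
  "trans_fm M c' c = (case next_move M (cstate c') (cread c') of (q, as) \<Rightarrow>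
     And (Const (cstate c = q))
     (And (Disj (Neg (eq_fm 1 3)) (Const (\<forall>j<num_tapes M.
        csyms c ! j = (if cheads c' ! j then fst (as ! j) else csyms c' ! j))))
     (Conj_list (map (\<lambda>j. if cheads c' ! j
          then (if cheads c ! j then moved_fm (snd (as ! j)) else Neg (moved_fm (snd (as ! j))))
          else Const True) [0..<num_tapes M]))))"

definition conflict_fm :: "machine \<Rightarrow> cell \<Rightarrow> cell \<Rightarrow> fm" where
  "conflict_fm M c' c =
     Disj (And (eq_fm 0 2) (Disj (Const (cstate c \<noteq> cstate c' \<or> cread c \<noteq> cread c')) (eq_fm 1 3)))
    (Disj (And (succ_fm 2 0) (Neg (trans_fm M c' c)))
          (And (zero_fm 0) (And (zero_fm 2) (And (Const (csyms c' ! 0 = 0 \<and> csyms c ! 0 \<noteq> 0))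
            (And (Sym 3 {3}) (Sym 1 {3}))))))"

definition cell_ok_fm :: "machine \<Rightarrow> cell \<Rightarrow> fm" where
  "cell_ok_fm M c =
     And (Const (\<forall>j<num_tapes M. cheads c ! j \<longrightarrow> csyms c ! j = cread c ! j))
    (And (Disj (Neg (zero_fm 0))
       (And (Const (cstate c = start_state M \<and> (\<forall>j<num_tapes M. 0 < j \<longrightarrow> csyms c ! j = 0)))
       (And (Disj (And (start_fm 1) (Const (\<forall>j<num_tapes M. cheads c ! j)))
                  (And (Neg (start_fm 1)) (Const (\<forall>j<num_tapes M. \<not> cheads c ! j))))
            (Sym 1 (compat (csyms c ! 0))))))
     (Disj (Neg (last_fm 0)) (Disj (Neg (start_fm 1)) (Const (csyms c ! (num_tapes M - 1) = 2)))))"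

definition edge_fm :: "machine \<Rightarrow> cell list \<Rightarrow> nat \<Rightarrow> nat \<Rightarrow> fm" where
  "edge_fm M Cs a' a = (if (a = 0) \<noteq> (a' = 0) then Const True else if a = 0 then Const False
     else conflict_fm M (Cs ! (a' - 1)) (Cs ! (a - 1)))"

text \<open>The lexicographic order of time, position and value, which is the order of the vertex
  numbers. It cuts the lower triangle out of the loops over all pairs.\<close>

definition before_fm :: "nat \<Rightarrow> nat \<Rightarrow> fm" where
  "before_fm a' a =
     Disj (Less 2 0) (And (eq_fm 0 2) (Disj (Less 3 1) (And (eq_fm 1 3) (Const (a' < a)))))"

lemmas fm_defs = Disj_def eq_fm_def zero_fm_def last_fm_def succ_fm_def start_fm_def

lemma wf_Conj_list: "wf_fm C (Conj_list \<phi>s) \<longleftrightarrow> (\<forall>\<phi>\<in>set \<phi>s. wf_fm C \<phi>)"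
  "bound_vars (Conj_list \<phi>s) = (\<Union>\<phi>\<in>set \<phi>s. bound_vars \<phi>)"
  by (induction \<phi>s) (auto simp: Conj_list_def)

lemma eval_Conj_map: "eval w e (Conj_list (map f xs)) \<longleftrightarrow> (\<forall>x\<in>set xs. eval w e (f x))"
  by (induction xs) (auto simp: Conj_list_def)

lemma wf_moved_fm: "wf_fm 6 (moved_fm d)" "bound_vars (moved_fm d) \<subseteq> {4}"
  by (cases d; simp add: moved_fm_def fm_defs)+

lemma wf_trans_fm: "wf_fm 6 (trans_fm M c' c)" "bound_vars (trans_fm M c' c) \<subseteq> {4}"
  using wf_moved_fm
  by (auto simp: trans_fm_def fm_defs wf_Conj_list split: prod.splits if_splits)

lemma wf_fms:
  "wf_fm 6 (conflict_fm M c' c)" "bound_vars (conflict_fm M c' c) \<subseteq> {4}"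
  "wf_fm 6 (cell_ok_fm M c)" "bound_vars (cell_ok_fm M c) \<subseteq> {4}"
  "wf_fm 6 (edge_fm M Cs a' a)" "bound_vars (edge_fm M Cs a' a) \<subseteq> {4}"
  "wf_fm 6 (before_fm a' a)" "bound_vars (before_fm a' a) \<subseteq> {4}"
proof -
  show c: "wf_fm 6 (conflict_fm M c' c)" "bound_vars (conflict_fm M c' c) \<subseteq> {4}" for c' c
    using wf_trans_fm[of M c' c] by (auto simp: conflict_fm_def fm_defs)
  show "wf_fm 6 (cell_ok_fm M c)" "bound_vars (cell_ok_fm M c) \<subseteq> {4}"
    by (auto simp: cell_ok_fm_def fm_defs)
  show "wf_fm 6 (edge_fm M Cs a' a)" "bound_vars (edge_fm M Cs a' a) \<subseteq> {4}"
    using c by (auto simp: edge_fm_def split: if_splits)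
  show "wf_fm 6 (before_fm a' a)" "bound_vars (before_fm a' a) \<subseteq> {4}"
    by (auto simp: before_fm_def fm_defs)
qed

text \<open>Quantifiers range over positions of the word only. The bounds on \<open>e v\<close> make
  sure that the witnesses, such as \<open>0\<close> or \<open>Suc (e u)\<close>, are positions;
  \<open>4\<close> is excluded because it is the bound variable.\<close>

lemma eval_basic:
  "eval w e (Disj \<phi> \<psi>) \<longleftrightarrow> eval w e \<phi> \<or> eval w e \<psi>"
  "eval w e (eq_fm u v) \<longleftrightarrow> e u = e v"
  "v \<noteq> 4 \<Longrightarrow> e v < length w \<Longrightarrow> eval w e (zero_fm v) \<longleftrightarrow> e v = 0"
  "v \<noteq> 4 \<Longrightarrow> e v < length w \<Longrightarrow> eval w e (last_fm v) \<longleftrightarrow> Suc (e v) = length w"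
  "u \<noteq> 4 \<Longrightarrow> v \<noteq> 4 \<Longrightarrow> e v < length w \<Longrightarrow> eval w e (succ_fm u v) \<longleftrightarrow> e v = Suc (e u)"
proof -
  show "eval w e (Disj \<phi> \<psi>) \<longleftrightarrow> eval w e \<phi> \<or> eval w e \<psi>" "eval w e (eq_fm u v) \<longleftrightarrow> e u = e v"
    by (auto simp: fm_defs)
  show "v \<noteq> 4 \<Longrightarrow> e v < length w \<Longrightarrow> eval w e (zero_fm v) \<longleftrightarrow> e v = 0"
    by (simp add: zero_fm_def) (metis bot_nat_0.not_eq_extremum order.strict_trans)
  show "eval w e (last_fm v) \<longleftrightarrow> Suc (e v) = length w" if "v \<noteq> 4" "e v < length w"
    using that spec[of "\<lambda>i. i < length w \<longrightarrow> \<not> e v < i" "Suc (e v)"] by (auto simp: last_fm_def)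
  show "eval w e (succ_fm u v) \<longleftrightarrow> e v = Suc (e u)" if "u \<noteq> 4" "v \<noteq> 4" "e v < length w"
    using that spec[of "\<lambda>i. i < length w \<longrightarrow> e u < i \<longrightarrow> \<not> i < e v" "Suc (e u)"]
    by (auto simp: succ_fm_def)
qed

lemma eval_moved_fm:
  "e 1 < length w \<Longrightarrow> e 3 < length w \<Longrightarrow>
   eval w e (moved_fm d) \<longleftrightarrow> int (e 1) = int (e 3) + move_offset d"
  by (cases d) (auto simp: moved_fm_def eval_basic)

lemma eval_trans_fm:
  assumes "e 1 < length w" "e 3 < length w"
  shows "eval w e (trans_fm M c' c) \<longleftrightarrow> trans_ok M (e 3) c' (e 1) c"
proof -
  obtain q as where n: "next_move M (cstate c') (cread c') = (q, as)" by fastforce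
  have "eval w e (if cheads c' ! j
          then (if cheads c ! j then moved_fm (snd (as ! j)) else Neg (moved_fm (snd (as ! j))))
          else Const True) \<longleftrightarrow>
     (cheads c' ! j \<longrightarrow> (cheads c ! j \<longleftrightarrow> int (e 1) = int (e 3) + move_offset (snd (as ! j))))" for j
    using eval_moved_fm[of e w, OF assms] by auto
  then show ?thesis
    by (auto simp: trans_fm_def trans_ok_def n eval_basic eval_Conj_map)
qed

lemma eval_conflict_fm:
  assumes "e 0 < length w" "e 1 < length w" "e 2 < length w" "e 3 < length w"
  shows "eval w e (conflict_fm M c' c) \<longleftrightarrow> conflict M w (e 2) (e 3) c' (e 0) (e 1) c"
  using assms by (simp add: conflict_fm_def conflict_def eval_basic eval_trans_fm) metis

lemma (in certificate_tableau) eval_start_fm: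
  assumes "v \<noteq> 4" "e v < N"
  shows "eval w e (start_fm v) \<longleftrightarrow> e v = A"
proof -
  have "w ! i = 4 \<longleftrightarrow> i < A" if "i < N" for i
    using w_nth[OF that] by (auto simp: bit_symbol_def)
  then show ?thesis
    using assms N spec[of "\<lambda>i. i < N \<longrightarrow> i < e v \<longrightarrow> w ! i = 4" A] by (auto simp: start_fm_def)
qed

lemma (in certificate_tableau) eval_cell_ok_fm:
  assumes "e 0 < N" "e 1 < N"
  shows "eval w e (cell_ok_fm M c) \<longleftrightarrow> cell_ok M A w (e 0) (e 1) c"
  using assms by (simp add: cell_ok_fm_def cell_ok_def eval_basic eval_start_fm)
    (cases "e 1 = A"; auto)

lemma eval_before_fm:
  "eval w e (before_fm a' a) \<longleftrightarrow>
     e 2 < e 0 \<or> e 2 = e 0 \<and> (e 3 < e 1 \<or> e 3 = e 1 \<and> a' < a)"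
  by (auto simp: before_fm_def eval_basic)

subsection \<open>Building the word\<close>

text \<open>Every variable needs a word of its own, since its two stacks are the word split at its
  value. The \<open>C\<close> copies grow simultaneously, and empty left stacks mean that all
  variables are \<open>0\<close>.\<close>

definition initial :: "nat \<Rightarrow> nat list \<Rightarrow> nat list \<Rightarrow> store" where
  "initial C inp u = (\<lambda>i. if i = 1 then inp else if \<exists>v<C. i = right v then u else [])"

lemma right_inj [simp]: "right u = right v \<longleftrightarrow> u = v" "right v \<noteq> 1" "right v \<noteq> Suc 0" "Suc 0 \<noteq> right v"
  by (auto simp: right_def)

lemma initial_simps [simp]:
  "initial C inp u (Suc 0) = inp" "(initial C inp u)(Suc 0 := inp') = initial C inp' u"
  by (auto simp: initial_def)

lemma st_initial: "st C w (\<lambda>_. 0) 0 [] [] = initial C [] w"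
proof
  fix i
  have "(\<exists>v<C. i = right v) \<longleftrightarrow> 4 \<le> i \<and> i < 4 + 2 * C \<and> odd i"
  proof
    assume "4 \<le> i \<and> i < 4 + 2 * C \<and> odd i"
    then have "i = right ((i - 5) div 2) \<and> (i - 5) div 2 < C" unfolding right_def by presburger
    then show "\<exists>v<C. i = right v" by blast
  qed (auto simp: right_def)
  then show "st C w (\<lambda>_. 0) 0 [] [] i = initial C [] w i"
    by (auto simp: st_def initial_def)
qed

lemma run_seqs_append: "run m (seqs (cs @ ds)) s = run m (seqs ds) (run m (seqs cs) s)"
  by (induction cs arbitrary: s) (auto simp: seqs_def)

definition push_all :: "nat \<Rightarrow> nat \<Rightarrow> com" where
  "push_all C a = seqs (map (\<lambda>v. Push (right v) a) [0..<C])"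

definition copy_all :: "nat \<Rightarrow> com" where
  "copy_all C = seqs (map (\<lambda>v. Copy 1 (right v)) [0..<C])"

lemma run_all:
  assumes c: "\<And>v s. v < C \<Longrightarrow> s 1 = inp \<Longrightarrow> s (right v) = u \<Longrightarrow> run m (c v) s = s(right v := a # u)"
  shows "run m (seqs (map c [0..<C])) (initial C inp u) = initial C inp (a # u)"
proof -
  have "run m (seqs (map c [0..<k])) (initial C inp u)
      = (\<lambda>i. if \<exists>v<k. i = right v then a # u else initial C inp u i)" if "k \<le> C" for k
    using that
  proof (induction k)
    case 0
    then show ?case by (simp add: seqs_def)
  next
    case (Suc k)
    let ?s = "\<lambda>i. if \<exists>v<k. i = right v then a # u else initial C inp u i"
    have "run m (seqs [c k]) ?s = ?s(right k := a # u)"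
      using Suc.prems by (simp add: seqs_def) (subst c, auto simp: initial_def)
    moreover have "run m (seqs (map c [0..<Suc k])) (initial C inp u) = run m (seqs [c k]) ?s"
      using Suc by (simp add: run_seqs_append)
    moreover have "?s(right k := a # u) = (\<lambda>i. if \<exists>v<Suc k. i = right v then a # u else initial C inp u i)"
      by (auto simp: fun_eq_iff less_Suc_eq)
    ultimately show ?case by simp
  qed
  from this[of C] show ?thesis by (auto simp: initial_def fun_eq_iff)
qed

lemma run_push_all: "run m (push_all C a) (initial C inp u) = initial C inp (a # u)"
  unfolding push_all_def by (rule run_all) auto

lemma run_copy_all: "run m (copy_all C) (initial C (a # inp) u) = initial C (a # inp) (a # u)"
  unfolding copy_all_def by (rule run_all) auto

lemma run_push_all_pow: "(run m (push_all C a) ^^ k) (initial C inp u) = initial C inp (replicate k a @ u)"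
  by (induction k) (auto simp: run_push_all)

text \<open>The word is built from its right end, as pushing requires. Stack \<open>1\<close> has
  the last input letter on top, so each round adds one bit of \<open>delimit x\<close> and then the
  marker \<open>True\<close>, written \<open>2\<close>, in front of it.\<close>

definition build :: "nat poly \<Rightarrow> nat poly \<Rightarrow> nat \<Rightarrow> com" where
  "build P A C = push_all C 5 ;; repeat A (push_all C 5) ;; repeat P (push_all C 3) ;;
     push_all C 1 ;; Loop (copy_all C ;; Pop 1 ;; push_all C 2) ;; repeat A (push_all C 4)"

lemma run_build:
  "run (length x) (build P A C) (initial C (rev (map bit_symbol x)) []) =
   initial C [] (replicate (poly A (length x)) 4 @ map bit_symbol (delimit x) @
     replicate (poly P (length x)) 3 @ replicate (Suc (poly A (length x))) 5)"
proof -
  have loop: "(run m (copy_all C ;; Pop 1 ;; push_all C 2) ^^ length y) (initial C (rev (map bit_symbol y)) u)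
      = initial C [] (map bit_symbol (concat (map (\<lambda>b. [True, b]) y)) @ u)" for m y u
  proof (induction y arbitrary: u rule: rev_induct)
    case (snoc b y)
    have "run m (copy_all C ;; Pop 1 ;; push_all C 2) (initial C (rev (map bit_symbol (y @ [b]))) u)
        = initial C (rev (map bit_symbol y)) (2 # bit_symbol b # u)"
      by (simp add: run_push_all run_copy_all)
    then show ?case using snoc[of "2 # bit_symbol b # u"]
      by (simp add: funpow_Suc_right del: funpow.simps)
  qed simp
  have "replicate k (5::nat) @ [5] = replicate (Suc k) 5" for k
    by (simp add: replicate_append_same)
  then show ?thesis
    by (simp add: build_def run_repeat run_push_all run_push_all_pow loop delimit_def del: replicate_Suc One_nat_def)
qed

lemma wf_all: "a < 6 \<Longrightarrow> 0 < a \<Longrightarrow> wf_com 16 6 (push_all 6 a)" "wf_com 16 6 (copy_all 6)"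
  by (auto simp: push_all_def copy_all_def seqs_def upt_rec right_def)

lemma wf_build: "wf_com 16 6 (build P A 6)"
  by (auto simp: build_def wf_all intro!: wf_repeat)

subsection \<open>Printing the instance\<close>

definition print_count :: "nat poly \<Rightarrow> nat \<Rightarrow> com" where
  "print_count NP m = For NP 0 (For NP 1 (emit (replicate m True))) ;; emit [False]"

definition print_edges :: "nat poly \<Rightarrow> machine \<Rightarrow> cell list \<Rightarrow> nat \<Rightarrow> com" where
  "print_edges NP M Cs m = For NP 0 (For NP 1 (seqs (map (\<lambda>a.
     For NP 2 (For NP 3 (seqs (map (\<lambda>a'. test_fm NP (before_fm a' a)
       (test_fm NP (edge_fm M Cs a' a) (emit [True]) (emit [False])) (emit [])) [0..<m])))) [0..<m])))"

definition print_set :: "nat poly \<Rightarrow> nat \<Rightarrow> com" where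
  "print_set NP m = For NP 0 (For NP 1 (emit (map (\<lambda>a. a = 0) [0..<m])))"

text \<open>\<open>[True, True, False]\<close> and \<open>[False]\<close> are
  \<open>delimit (binary 1)\<close> and \<open>delimit (binary 0)\<close>.\<close>

definition print_weights :: "nat poly \<Rightarrow> machine \<Rightarrow> cell list \<Rightarrow> nat \<Rightarrow> com" where
  "print_weights NP M Cs m = For NP 0 (For NP 1 (seqs (map (\<lambda>a.
     test_fm NP (if a = 0 then Const True else cell_ok_fm M (Cs ! (a - 1)))
       (emit [True, True, False]) (emit [False])) [0..<m])))"

definition printer :: "nat poly \<Rightarrow> machine \<Rightarrow> cell list \<Rightarrow> nat \<Rightarrow> com" where
  "printer NP M Cs m =
     print_count NP m ;; print_edges NP M Cs m ;; print_set NP m ;; print_weights NP M Cs m"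

lemma wf_seqs_map: "(\<And>x. x \<in> set xs \<Longrightarrow> wf_com V G (c x)) \<Longrightarrow> wf_com V G (seqs (map c xs))"
  by (induction xs) (auto simp: seqs_def)

lemma wf_printer: "wf_com 16 6 (printer NP M Cs m)"
proof -
  have "wf_com (4 + 2 * 6) 6 (printer NP M Cs m)"
    unfolding printer_def print_count_def print_edges_def print_set_def print_weights_def wf_com.simps
    by (intro conjI wf_emission(1,2,4) wf_seqs_map) (simp_all add: wf_fms)
  then show ?thesis by simp
qed

section \<open>Vertex numbers in mixed radix\<close>

lemma concat_map_mult:
  "concat (map f [0..<n * m]) = concat (map (\<lambda>i. concat (map (\<lambda>j. f (i * m + j)) [0..<m])) [0..<n])"
proof (induction n)
  case (Suc n)
  have "[0..<Suc n * m] = [0..<n * m] @ map (\<lambda>j. n * m + j) [0..<m]"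
    using upt_add_eq_append[of 0 "n * m" m] by (simp add: add.commute map_add_upt)
  then show ?case using Suc by (simp add: o_def)
qed simp

lemma concat_map_cong:
  "(\<And>i. i < n \<Longrightarrow> f i = g i) \<Longrightarrow> concat (map f [0..<n]) = concat (map g [0..<n])"
  by (metis atLeastLessThan_iff atLeastLessThan_upt map_cong)

lemma concat_map_cube:
  "concat (map f [0..<n * n * m]) = concat (map (\<lambda>t. concat (map (\<lambda>p.
     concat (map (\<lambda>a. f ((t * n + p) * m + a)) [0..<m])) [0..<n])) [0..<n])"
  by (simp add: concat_map_mult)

text \<open>A row of the triangle has a length that varies with the vertex, whereas the printer
  always loops over all vertices and skips those that are not smaller.\<close>

lemma map_as_concat: "i \<le> n \<Longrightarrow> map f [0..<i] = concat (map (\<lambda>j. if j < i then [f j] else []) [0..<n])"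
proof (induction n)
  case (Suc n)
  have eq: "map f [0..<k] = concat (map (\<lambda>j. [f j]) [0..<k])" for k by (induction k) auto
  show ?case
  proof (cases "i = Suc n")
    case True
    have "concat (map (\<lambda>j. if j < i then [f j] else []) [0..<i]) = concat (map (\<lambda>j. [f j]) [0..<i])"
      by (rule concat_map_cong) simp
    then show ?thesis using eq[of i] True by simp
  qed (use Suc in auto)
qed simp

lemma mixed_radix_less:
  fixes a a' m s s' :: nat
  assumes "a < m" "a' < m"
  shows "s' * m + a' < s * m + a \<longleftrightarrow> s' < s \<or> s' = s \<and> a' < a"
proof (cases s s' rule: linorder_cases)
  case less
  then have "Suc s * m \<le> s' * m" by (intro mult_le_mono1) simp
  then show ?thesis using less assms by auto
next
  case greater
  then have "Suc s' * m \<le> s * m" by (intro mult_le_mono1) simp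
  then show ?thesis using greater assms by auto
qed auto

lemma mixed_radix_div:
  fixes a m s :: nat
  assumes "a < m"
  shows "(s * m + a) div m = s" "(s * m + a) mod m = a"
  using assms by simp_all

lemma mixed_radix_eq:
  fixes a a' m s s' :: nat
  assumes "a < m" "a' < m"
  shows "s' * m + a' = s * m + a \<longleftrightarrow> s' = s \<and> a' = a"
  by (metis assms mixed_radix_div)

lemma mixed_radix_bound:
  fixes a m s K :: nat
  assumes "a < m" "s < K"
  shows "s * m + a < K * m"
proof -
  have "s * m + a < Suc s * m" using assms by simp
  also have "\<dots> \<le> K * m" using assms by (intro mult_le_mono1) simp
  finally show ?thesis .
qed

locale reduction = certificate_tableau +
  fixes Cs :: "cell list" and NP :: "nat poly"
  assumes Cs: "set Cs = cells M" and NP: "poly NP (length x) = N"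
begin

text \<open>Residue \<open>0\<close> belongs to the reference vertex of a block, so residue
  \<open>a > 0\<close> stands for the cell \<open>Cs ! (a - 1)\<close>.\<close>

definition m :: nat where "m = Suc (length Cs)"
definition n :: nat where "n = N * N * m"
definition tm_of :: "nat \<Rightarrow> nat" where "tm_of i = i div m div N"
definition ps_of :: "nat \<Rightarrow> nat" where "ps_of i = i div m mod N"
definition cl_of :: "nat \<Rightarrow> cell" where "cl_of i = Cs ! (i mod m - 1)"
definition ok :: "nat \<Rightarrow> bool" where "ok i = cell_ok M A w (tm_of i) (ps_of i) (cl_of i)"
definition edge :: "nat \<Rightarrow> nat \<Rightarrow> bool" where
  "edge j i \<longleftrightarrow> (if (i mod m = 0) \<noteq> (j mod m = 0) then True else if i mod m = 0 then False
     else conflict M w (tm_of j) (ps_of j) (cl_of j) (tm_of i) (ps_of i) (cl_of i))"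
definition E :: "nat set set" where "E = {{i, j} | i j. j < i \<and> i < n \<and> edge j i}"
definition wt :: "nat \<Rightarrow> nat" where "wt i = (if i mod m = 0 \<or> ok i then 1 else 0)"
definition I :: "nat set" where "I = {i. i < n \<and> i mod m = 0}"

definition idx :: "nat \<Rightarrow> nat \<Rightarrow> nat \<Rightarrow> nat" where "idx t p a = (t * N + p) * m + a"

lemma m_pos: "0 < m" by (simp add: m_def)

lemma idx:
  assumes "p < N" "a < m"
  shows "tm_of (idx t p a) = t" "ps_of (idx t p a) = p" "cl_of (idx t p a) = Cs ! (a - 1)"
    "idx t p a mod m = a"
  by (simp_all add: idx_def tm_of_def ps_of_def cl_of_def assms mixed_radix_div)

lemma idx_less:
  "p < N \<Longrightarrow> p' < N \<Longrightarrow> a < m \<Longrightarrow> a' < m \<Longrightarrow>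
   idx t' p' a' < idx t p a \<longleftrightarrow> t' < t \<or> t' = t \<and> (p' < p \<or> p' = p \<and> a' < a)"
  unfolding idx_def by (auto simp: mixed_radix_less mixed_radix_eq)

lemma idx_n: "t < N \<Longrightarrow> p < N \<Longrightarrow> a < m \<Longrightarrow> idx t p a < n"
  unfolding idx_def n_def by (intro mixed_radix_bound)

text \<open>Variable \<open>s\<close> of the constraint system is time \<open>s div N\<close> and
  position \<open>s mod N\<close>. The order of these numbers is the order of earlier and later
  cells in the two tableau lemmas.\<close>

lemma unique_iff:
  "unique_max_weight_independent_set {..<n} E wt I \<longleftrightarrow> \<not> (\<exists>u. length u \<le> P \<and> pair x u \<in> R)"
proof -
  have N0: "0 < N" using N by simp
  have "unique_max_weight_independent_set {..<n} E wt I \<longleftrightarrow>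
     \<not> (\<exists>D. (\<forall>s<N * N. 0 < D s \<and> D s < m \<and> ok (s * m + D s)) \<and>
          (\<forall>s<N * N. \<forall>s'<s. \<not> edge (s' * m + D s') (s * m + D s)))"
    unfolding E_def wt_def[abs_def] I_def n_def
    by (rule unique_independent_set_iff)
      (use m_pos N0 in \<open>auto simp: edge_def conflict_def tm_of_def ps_of_def\<close>)
  also have "(\<exists>D. (\<forall>s<N * N. 0 < D s \<and> D s < m \<and> ok (s * m + D s)) \<and>
          (\<forall>s<N * N. \<forall>s'<s. \<not> edge (s' * m + D s') (s * m + D s))) \<longleftrightarrow>
     (\<exists>u. length u \<le> P \<and> pair x u \<in> R)"
  proof
    assume "\<exists>D. (\<forall>s<N * N. 0 < D s \<and> D s < m \<and> ok (s * m + D s)) \<and>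
          (\<forall>s<N * N. \<forall>s'<s. \<not> edge (s' * m + D s') (s * m + D s))"
    then obtain D where D: "\<And>s. s < N * N \<Longrightarrow> 0 < D s \<and> D s < m \<and> ok (s * m + D s)"
      and no: "\<And>s s'. s < N * N \<Longrightarrow> s' < s \<Longrightarrow> \<not> edge (s' * m + D s') (s * m + D s)" by blast
    define c where "c t p = Cs ! (D (t * N + p) - 1)" for t p
    have s: "t * N + p < N * N" if "t < N" "p < N" for t p
      using that by (intro mixed_radix_bound)
    show "\<exists>u. length u \<le> P \<and> pair x u \<in> R"
    proof (rule tableau_imp_run)
      fix t p assume tp: "t < N" "p < N"
      note d = D[OF s[OF tp]]
      then have "D (t * N + p) - 1 < length Cs" by (auto simp: m_def)
      then have "c t p \<in> cells M" unfolding c_def Cs[symmetric] by (rule nth_mem)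
      moreover have "cell_ok M A w t p (c t p)"
        using d idx[of p "D (t * N + p)" t] tp by (simp add: ok_def idx_def c_def)
      ultimately show "c t p \<in> cells M \<and> cell_ok M A w t p (c t p)" ..
    next
      fix t p t' p' assume a: "t < N" "p < N" "p' < N" "t' < t \<or> t' = t \<and> p' < p"
      then have "t' < N" by auto
      have "t' * N + p' < t * N + p" using a mixed_radix_less[of p N p' t' t] by simp
      then show "\<not> conflict M w t' p' (c t' p') t p (c t p)"
        using no[OF s[OF a(1,2)], of "t' * N + p'"] D[OF s[OF a(1,2)]] D[OF s[OF \<open>t' < N\<close> a(3)]]
          idx[of p "D (t * N + p)" t] idx[of p' "D (t' * N + p')" t'] a(2,3)
        by (simp add: edge_def idx_def c_def)
    qed
  next
    assume "\<exists>u. length u \<le> P \<and> pair x u \<in> R"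
    then obtain u where u: "length u \<le> P" "pair x u \<in> R" by blast
    note t = run_imp_tableau[OF u]
    have "\<exists>a. a < length Cs \<and> Cs ! a = vw u (s div N) (s mod N)" for s
      using vw_cells[of u "s div N" "s mod N"] unfolding Cs[symmetric] in_set_conv_nth .
    then obtain d where d: "\<And>s. d s < length Cs \<and> Cs ! d s = vw u (s div N) (s mod N)" by metis
    define D where "D s = Suc (d s)" for s
    have D: "0 < D s" "D s < m" "Cs ! (D s - 1) = vw u (s div N) (s mod N)" for s
      using d[of s] by (auto simp: D_def m_def)
    have dec: "tm_of (s * m + D s) = s div N" "ps_of (s * m + D s) = s mod N"
      "cl_of (s * m + D s) = vw u (s div N) (s mod N)" "(s * m + D s) mod m = D s" for s
      using D[of s] by (auto simp: tm_of_def ps_of_def cl_of_def)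
    have sN: "s div N < N" "s mod N < N" if "s < N * N" for s
      using that N0 by (auto simp: less_mult_imp_div_less)
    show "\<exists>D. (\<forall>s<N * N. 0 < D s \<and> D s < m \<and> ok (s * m + D s)) \<and>
          (\<forall>s<N * N. \<forall>s'<s. \<not> edge (s' * m + D s') (s * m + D s))"
    proof (intro exI[of _ D] conjI allI impI)
      fix s assume s: "s < N * N"
      show "0 < D s" "D s < m" using D by auto
      show "ok (s * m + D s)" using t(1)[OF sN[OF s]] by (simp add: ok_def dec)
      fix s' assume s': "s' < s"
      have "s' div N < s div N \<or> s' div N = s div N \<and> s' mod N < s mod N"
        using s' mixed_radix_less[of "s mod N" N "s' mod N" "s' div N" "s div N"] N0 by simp
      moreover have "s' mod N < N" using N0 by simp
      ultimately have "\<not> conflict M w (s' div N) (s' mod N) (vw u (s' div N) (s' mod N))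
          (s div N) (s mod N) (vw u (s div N) (s mod N))"
        using t(2)[OF sN[OF s]] by blast
      then show "\<not> edge (s' * m + D s') (s * m + D s)"
        using D(1,2)[of s] D(1,2)[of s'] by (simp add: edge_def dec)
    qed
  qed
  finally show ?thesis .
qed

lemma simple_graph_E: "simple_graph {..<n} E"
  by (auto simp: simple_graph_def E_def card_2_iff)

lemma binary_small: "binary 0 = []" "binary 1 = [True]"
  by (simp_all add: binary.simps)

text \<open>\<open>c1\<close> to \<open>c4\<close> match the nested loops over time, position and
  value with the unary count, the characteristic vector, the weights and the triangle of the
  encoding.\<close>

lemma run_printer:
  "run (length x) (printer NP M Cs m) (st 6 w (\<lambda>_. 0) 0 [] []) 0 = rev (map bit_symbol (encode_instance n E wt I))"
proof -
  let ?em = "emits NP (length x) 6 w"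
  have w0: "0 \<notin> set w" by (auto simp: w_def)
  note For = emits_For[OF _ _ _ NP]
  have em0: "?em {2, 3, 4} (emit bs) (\<lambda>_. bs)" for bs by (rule emits_emit)
  have For01: "?em {0, 1, 2, 3, 4} (For NP 0 (For NP 1 c))
      (\<lambda>e. concat (map (\<lambda>t. concat (map (\<lambda>p. g (e(0 := t, 1 := p))) [0..<N])) [0..<N]))"
    if "?em {2, 3, 4} c g" for c g
    using For[OF For[OF that, of 1], of 0] by simp
  have For23: "?em {2, 3, 4} (For NP 2 (For NP 3 c))
      (\<lambda>e. concat (map (\<lambda>t. concat (map (\<lambda>p. g (e(2 := t, 3 := p))) [0..<N])) [0..<N]))"
    if "?em {4} c g" for c g
    using For[OF For[OF that, of 3], of 2] by simp
  have count: "?em {0, 1, 2, 3, 4} (print_count NP m)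
      (\<lambda>_. concat (map (\<lambda>t. concat (map (\<lambda>p. replicate m True) [0..<N])) [0..<N]) @ [False])"
    unfolding print_count_def by (rule emits_Comp[OF For01[OF em0] emits_emit])
  have iset: "?em {0, 1, 2, 3, 4} (print_set NP m)
      (\<lambda>_. concat (map (\<lambda>t. concat (map (\<lambda>p. map (\<lambda>a. a = 0) [0..<m]) [0..<N])) [0..<N]))"
    unfolding print_set_def by (rule For01[OF em0])
  define wfm where "wfm a = (if a = 0 then Const True else cell_ok_fm M (Cs ! (a - 1)))" for a
  have wfm: "wf_fm 6 (wfm a)" "bound_vars (wfm a) \<subseteq> {2, 3, 4}" for a
    using wf_fms(3,4)[of M "Cs ! (a - 1)"] by (auto simp: wfm_def)
  have "?em {2, 3, 4} (seqs (map (\<lambda>a. test_fm NP (wfm a) (emit [True, True, False]) (emit [False])) [0..<m]))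
      (\<lambda>e. concat (map (\<lambda>a. if eval w e (wfm a) then [True, True, False] else [False]) [0..<m]))"
    by (rule emits_seqs, rule emits_test[OF em0 em0 wfm NP w0])
  note weights = For01[OF this, folded print_weights_def[of NP M Cs m, folded wfm_def]]
  have "?em {4} (test_fm NP (before_fm a' a)
       (test_fm NP (edge_fm M Cs a' a) (emit [True]) (emit [False])) (emit []))
      (\<lambda>e. if eval w e (before_fm a' a) then if eval w e (edge_fm M Cs a' a) then [True] else [False] else [])" for a a'
    by (intro emits_test emits_emit wf_fms NP w0)
  then have "?em {4} (seqs (map (\<lambda>a'. test_fm NP (before_fm a' a)
       (test_fm NP (edge_fm M Cs a' a) (emit [True]) (emit [False])) (emit [])) [0..<m]))
      (\<lambda>e. concat (map (\<lambda>a'. if eval w e (before_fm a' a) then if eval w e (edge_fm M Cs a' a) then [True] else [False] else []) [0..<m]))" for a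
    by (intro emits_seqs)
  note inner = For23[OF this]
  have "?em {2, 3, 4} (seqs (map (\<lambda>a. For NP 2 (For NP 3 (seqs (map (\<lambda>a'. test_fm NP (before_fm a' a)
       (test_fm NP (edge_fm M Cs a' a) (emit [True]) (emit [False])) (emit [])) [0..<m])))) [0..<m]))
     (\<lambda>e. concat (map (\<lambda>a. concat (map (\<lambda>t'. concat (map (\<lambda>p'. concat (map (\<lambda>a'.
        if eval w (e(2 := t', 3 := p')) (before_fm a' a)
        then if eval w (e(2 := t', 3 := p')) (edge_fm M Cs a' a) then [True] else [False] else [])
        [0..<m])) [0..<N])) [0..<N])) [0..<m]))"
    by (rule emits_seqs, rule inner)
  note edges = For01[OF this, folded print_edges_def]
  define e0 :: "nat \<Rightarrow> nat" where "e0 = (\<lambda>_. 0)"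
  have all: "\<forall>v<6. e0 v < N" "\<forall>v\<in>{0, 1, 2, 3, 4}. e0 v = 0" using N by (auto simp: e0_def)
  note run_em = emits_Comp[OF count emits_Comp[OF edges emits_Comp[OF iset weights]],
      folded printer_def, unfolded emits_def, THEN spec[of _ e0], THEN spec[of _ "[]"], THEN mp[OF _ all(1)],
      THEN mp[OF _ all(2)]]
  have c1: "concat (map (\<lambda>t. concat (map (\<lambda>p. replicate m True) [0..<N])) [0..<N]) = replicate n True"
  proof -
    have eq: "replicate k True = concat (map (\<lambda>a. [True]) [0..<k])" for k by (simp add: map_replicate_const)
    show ?thesis unfolding n_def eq concat_map_cube ..
  qed
  have c2: "concat (map (\<lambda>t. concat (map (\<lambda>p. map (\<lambda>a. a = 0) [0..<m]) [0..<N])) [0..<N])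
      = map (\<lambda>i. i \<in> I) [0..<n]"
  proof -
    have "map (\<lambda>i. i \<in> I) [0..<n] = concat (map (\<lambda>i. [i \<in> I]) [0..<n])" by simp
    also have "\<dots> = concat (map (\<lambda>t. concat (map (\<lambda>p. concat (map (\<lambda>a. [a = 0]) [0..<m])) [0..<N])) [0..<N])"
      unfolding n_def concat_map_cube
      by (intro concat_map_cong) (use idx idx_n in \<open>simp add: I_def idx_def[symmetric]\<close>)
    finally show ?thesis by simp
  qed
  have c3: "concat (map (\<lambda>t. concat (map (\<lambda>p. concat (map (\<lambda>a.
        if eval w (e0(0 := t, 1 := p)) (wfm a) then [True, True, False] else [False]) [0..<m])) [0..<N])) [0..<N])
      = concat (map (\<lambda>i. delimit (binary (wt i))) [0..<n])"
    unfolding n_def concat_map_cube idx_def[symmetric]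
  proof (intro concat_map_cong)
    fix t p a assume "t < N" "p < N" "a < m"
    then show "(if eval w (e0(0 := t, 1 := p)) (wfm a) then [True, True, False] else [False])
        = delimit (binary (wt (idx t p a)))"
      by (auto simp: wfm_def wt_def ok_def idx eval_cell_ok_fm binary_small[simplified] delimit_def)
  qed
  have c4: "concat (map (\<lambda>t. concat (map (\<lambda>p. concat (map (\<lambda>a.
      concat (map (\<lambda>t'. concat (map (\<lambda>p'. concat (map (\<lambda>a'.
        if eval w (e0(0 := t, 1 := p, 2 := t', 3 := p')) (before_fm a' a)
        then if eval w (e0(0 := t, 1 := p, 2 := t', 3 := p')) (edge_fm M Cs a' a) then [True] else [False] else [])
        [0..<m])) [0..<N])) [0..<N])) [0..<m])) [0..<N])) [0..<N])
      = concat (map (\<lambda>i. map (\<lambda>j. {i, j} \<in> E) [0..<i]) [0..<n])"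
    unfolding n_def concat_map_cube idx_def[symmetric]
  proof (intro concat_map_cong)
    fix t p a assume tpa: "t < N" "p < N" "a < m"
    define i where "i = idx t p a"
    have i: "i < n" using idx_n tpa by (simp add: i_def)
    have "map (\<lambda>j. {i, j} \<in> E) [0..<i] = concat (map (\<lambda>j. if j < i then [{i, j} \<in> E] else []) [0..<n])"
      using map_as_concat[of i n] i by simp
    also have "\<dots> = concat (map (\<lambda>t'. concat (map (\<lambda>p'. concat (map (\<lambda>a'.
        if eval w (e0(0 := t, 1 := p, 2 := t', 3 := p')) (before_fm a' a)
        then if eval w (e0(0 := t, 1 := p, 2 := t', 3 := p')) (edge_fm M Cs a' a) then [True] else [False] else [])
        [0..<m])) [0..<N])) [0..<N])"
      unfolding n_def concat_map_cube idx_def[symmetric]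
    proof (intro concat_map_cong)
      fix t' p' a' assume tpa': "t' < N" "p' < N" "a' < m"
      define j where "j = idx t' p' a'"
      let ?e = "e0(0 := t, 1 := p, 2 := t', 3 := p')"
      have ji: "j < i \<longleftrightarrow> eval w ?e (before_fm a' a)"
        unfolding i_def j_def using idx_less tpa tpa' by (auto simp: eval_before_fm)
      have "{i, j} \<in> E \<longleftrightarrow> edge j i" if "j < i"
        using that i unfolding E_def by (auto simp: doubleton_eq_iff)
      moreover have "edge j i \<longleftrightarrow> eval w ?e (edge_fm M Cs a' a)"
        unfolding i_def j_def using tpa tpa'
        by (simp add: edge_def edge_fm_def idx eval_conflict_fm)
      ultimately show "(if j < i then [{i, j} \<in> E] else [])
          = (if eval w ?e (before_fm a' a) then if eval w ?e (edge_fm M Cs a' a) then [True] else [False] else [])"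
        unfolding ji by simp
    qed
    finally show "concat (map (\<lambda>t'. concat (map (\<lambda>p'. concat (map (\<lambda>a'.
        if eval w (e0(0 := t, 1 := p, 2 := t', 3 := p')) (before_fm a' a)
        then if eval w (e0(0 := t, 1 := p, 2 := t', 3 := p')) (edge_fm M Cs a' a) then [True] else [False] else [])
        [0..<m])) [0..<N])) [0..<N]) = map (\<lambda>j. {idx t p a, j} \<in> E) [0..<idx t p a]"
      by (simp add: i_def)
  qed
  have "run (length x) (printer NP M Cs m) (st 6 w e0 0 [] []) =
      st 6 w e0 0 [] (rev (map bit_symbol (encode_instance n E wt I)))"
    unfolding encode_instance_def c1[symmetric] c2[symmetric] c3[symmetric] c4[symmetric]
    using run_em by simp
  then show ?thesis by (simp add: e0_def)
qed

end

section \<open>Hardness\<close>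

lemma poly_nat_mono: "a \<le> b \<Longrightarrow> poly (P :: nat poly) a \<le> poly P b"
  by (induction P) (auto intro!: mult_mono)

text \<open>Needed because equal encodings give equal weights on the vertices only.\<close>

lemma unique_max_weight_cong:
  assumes "\<And>v. v \<in> V \<Longrightarrow> w v = w' v"
  shows "unique_max_weight_independent_set V E w I \<longleftrightarrow> unique_max_weight_independent_set V E w' I"
proof -
  have eq: "set_weight w S = set_weight w' S" if "independent_set V E S" for S
    unfolding set_weight_def using that assms by (intro sum.cong) (auto simp: independent_set_def)
  show ?thesis
    unfolding unique_max_weight_independent_set_def using eq by metis
qed

lemma encode_in_UI1:
  assumes G: "simple_graph {..<n} E" "I \<subseteq> {..<n}"
  shows "encode_instance n E w I \<in> UI\<^sub>1 \<longleftrightarrow> unique_max_weight_independent_set {..<n} E w I"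
proof
  assume "encode_instance n E w I \<in> UI\<^sub>1"
  then obtain n' E' w' I' where eq: "encode_instance n E w I = encode_instance n' E' w' I'"
    and g: "simple_graph {..<n'} E'" "I' \<subseteq> {..<n'}"
    and u: "unique_max_weight_independent_set {..<n'} E' w' I'"
    unfolding UI\<^sub>1_def by auto
  from encode_instance_inject[OF eq G g]
  have e: "n = n'" "E = E'" "I = I'" "\<forall>i<n. w i = w' i" by auto
  show "unique_max_weight_independent_set {..<n} E w I"
    using u e(1-3) unique_max_weight_cong[of "{..<n}" w w' E I] e(4) by simp
next
  assume "unique_max_weight_independent_set {..<n} E w I"
  then show "encode_instance n E w I \<in> UI\<^sub>1" unfolding UI\<^sub>1_def using G by blast
qed

theorem coNP_hard:
  assumes "L \<in> class_coNP"
  shows "polytime_reducible L UI\<^sub>1"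
proof -
  obtain R P where R: "R \<in> class_P"
    and L: "\<And>x. x \<notin> L \<longleftrightarrow> (\<exists>u. length u \<le> poly P (length x) \<and> pair x u \<in> R)"
    using assms unfolding class_coNP_def class_NP_def by auto
  obtain M q where M: "turing_machine M" "computes_in_time M (\<lambda>y. [y \<in> R]) (poly q)"
    using R unfolding class_P_def polytime_def by auto
  obtain Cs where Cs: "set Cs = cells M" using finite_list[OF finite_cells] by blast
  \<comment> \<open>\<open>pair x u\<close> has length \<open>2 * length x + 1 + length u\<close>.
    With a further \<open>2 * length x + 1\<close> for \<open>delimit x\<close>, one more blank and
    the padding, \<open>NP\<close> is the length of the word.\<close>
  define A where "A = pcompose q ([:1, 2:] + P)"
  define NP where "NP = 2 * A + P + [:2, 2:]"
  define f where "f x = encode_instance (reduction.n x (poly P (length x)) (poly A (length x)) Cs)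
     (reduction.E M x (poly P (length x)) (poly A (length x)) Cs)
     (reduction.wt M x (poly P (length x)) (poly A (length x)) Cs)
     (reduction.I x (poly P (length x)) (poly A (length x)) Cs)" for x
  have ct: "certificate_tableau M R q x (poly P (length x)) (poly A (length x))" for x
  proof
    fix u :: "bool list" assume "length u \<le> poly P (length x)"
    then show "poly q (length (pair x u)) \<le> poly A (length x)"
      unfolding A_def by (simp add: poly_pcompose pair_def length_delimit poly_nat_mono)
  qed (rule M)+
  have red: "reduction M R q x (poly P (length x)) (poly A (length x)) Cs NP" for x
  proof -
    interpret certificate_tableau M R q x "poly P (length x)" "poly A (length x)" by (rule ct)
    show ?thesis by unfold_locales (simp_all add: Cs N l_def NP_def length_delimit)
  qed
  have out: "run (length x) (build P A 6 ;; printer NP M Cs (Suc (length Cs)))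
      (\<lambda>v. if v = 1 then rev (map bit_symbol x) else []) 0 = rev (map bit_symbol (f x))" for x
  proof -
    interpret reduction M R q x "poly P (length x)" "poly A (length x)" Cs NP by (rule red)
    have "(\<lambda>v. if v = 1 then rev (map bit_symbol x) else []) = initial 6 (rev (map bit_symbol x)) []"
      by (auto simp: initial_def)
    then show ?thesis
      using run_printer run_build[of x P A 6] by (simp add: f_def m_def st_initial w_def)
  qed
  have "polytime f"
    \<comment> \<open>\<open>16 = 4 + 2 * 6\<close> counts the stacks for six variables;
      \<open>6\<close> symbols are the blank and \<open>1\<close> to \<open>5\<close>.\<close>
    by (rule polytime_com[OF _ _ _ out, where V = 16 and G = 6]) (simp_all add: wf_build wf_printer)
  moreover have "x \<in> L \<longleftrightarrow> f x \<in> UI\<^sub>1" for x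
  proof -
    interpret reduction M R q x "poly P (length x)" "poly A (length x)" Cs NP by (rule red)
    have I: "I \<subseteq> {..<n}" by (auto simp: I_def)
    have f: "f x = encode_instance n E wt I" by (simp add: f_def)
    have "f x \<in> UI\<^sub>1 \<longleftrightarrow> unique_max_weight_independent_set {..<n} E wt I"
      unfolding f by (rule encode_in_UI1[OF simple_graph_E I])
    then show ?thesis using unique_iff L by blast
  qed
  ultimately show ?thesis unfolding polytime_reducible_def by blast
qed

section \<open>The verifier\<close>

text \<open>\<open>vTodo\<close> and \<open>vDone\<close> hold the marks of the vertices ahead and
  behind. The suffix \<open>2\<close> of \<open>vDep2\<close> refers to the competing set and
  \<open>1\<close> of \<open>vDep1\<close> to the guess of the given set; for \<open>vAdd\<close>
  and \<open>vAcc\<close> it is the other way round. \<open>vWrong\<close> reports a wrong guess,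
  \<open>vDiff\<close> that the competing set differs from the given one.\<close>

abbreviation (input) vOut :: nat where "vOut \<equiv> 0"
abbreviation (input) vInp :: nat where "vInp \<equiv> 1"
abbreviation (input) vCert :: nat where "vCert \<equiv> 2"
abbreviation (input) vTmp :: nat where "vTmp \<equiv> 3"
abbreviation (input) vWord :: nat where "vWord \<equiv> 4"
abbreviation (input) vDone :: nat where "vDone \<equiv> 5"
abbreviation (input) vTodo :: nat where "vTodo \<equiv> 6"
abbreviation (input) vCur :: nat where "vCur \<equiv> 7"
abbreviation (input) vRow :: nat where "vRow \<equiv> 8"
abbreviation (input) vNum :: nat where "vNum \<equiv> 9"
abbreviation (input) vAdd1 :: nat where "vAdd1 \<equiv> 10"
abbreviation (input) vAdd2 :: nat where "vAdd2 \<equiv> 11"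
abbreviation (input) vAcc1 :: nat where "vAcc1 \<equiv> 12"
abbreviation (input) vAcc2 :: nat where "vAcc2 \<equiv> 13"
abbreviation (input) vSum :: nat where "vSum \<equiv> 14"
abbreviation (input) vCarry :: nat where "vCarry \<equiv> 15"
abbreviation (input) vBad :: nat where "vBad \<equiv> 16"
abbreviation (input) vWrong :: nat where "vWrong \<equiv> 17"
abbreviation (input) vDep1 :: nat where "vDep1 \<equiv> 18"
abbreviation (input) vDep2 :: nat where "vDep2 \<equiv> 19"
abbreviation (input) vDiff :: nat where "vDiff \<equiv> 20"
abbreviation (input) vGe :: nat where "vGe \<equiv> 21"

text \<open>
  Ordered rewriting sorts the updates of a store, which gives stores a normal form.
\<close>

definition upd :: "nat \<Rightarrow> nat list \<Rightarrow> store \<Rightarrow> store" where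
  "upd v xs s = s(v := xs)"

lemma upd_simps [simp]:
  "(upd v xs s) v = xs"
  "u \<noteq> v \<Longrightarrow> (upd u xs s) v = s v"
  "upd v xs (upd v ys s) = upd v xs s"
  "u \<noteq> v \<Longrightarrow> upd u xs (upd v ys s) = upd v ys (upd u xs s)"
  "upd v (s v) s = s"
  by (auto simp: upd_def intro: fun_upd_twist)

lemma fun_upd_eq_upd: "(s :: store)(v := xs) = upd v xs s"
  by (simp add: upd_def)

declare fun_upd_eq_upd [simp]

definition whl :: "nat \<Rightarrow> com \<Rightarrow> com" where
  "whl v c = Loop (Test v {0} Nop c)"

definition flag :: "nat \<Rightarrow> com" where
  "flag v = Test v {0} (Push v 1) Nop"

definition fl :: "bool \<Rightarrow> nat list" where
  "fl b = (if b then [1] else [])"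

lemma fl_simps [simp]: "fl False = []" "fl True = [1]" "top_sym (fl b) = of_bool b" "fl b = [] \<longleftrightarrow> \<not> b"
  by (simp_all add: fl_def)

lemma run_flag: "s v = fl b \<Longrightarrow> run m (flag v) s = s(v := fl True)"
  using upd_simps(5)[of v s] by (cases b) (simp_all add: flag_def)

lemma run_flag_tests:
  assumes "s v = fl b"
  shows "run m (Test x A (flag v) Nop) s = upd v (fl (b \<or> top_sym (s x) \<in> A)) s"
    "run m (Test x A (Test y B (Test z C (flag v) Nop) Nop) Nop) s =
       upd v (fl (b \<or> (top_sym (s x) \<in> A \<and> top_sym (s y) \<in> B \<and> top_sym (s z) \<in> C))) s"
    "run m (Test x A (Test y B Nop (flag v)) (Test y B (flag v) Nop)) s =
       upd v (fl (b \<or> (top_sym (s x) \<in> A) \<noteq> (top_sym (s y) \<in> B))) s"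
proof -
  have "upd v (fl b) s = s" using assms upd_simps(5)[of v s] by simp
  moreover have "run m (flag v) s = upd v (fl True) s" using run_flag[of s v b m] assms by simp
  ultimately show "run m (Test x A (flag v) Nop) s = upd v (fl (b \<or> top_sym (s x) \<in> A)) s"
    "run m (Test x A (Test y B (Test z C (flag v) Nop) Nop) Nop) s =
       upd v (fl (b \<or> (top_sym (s x) \<in> A \<and> top_sym (s y) \<in> B \<and> top_sym (s z) \<in> C))) s"
    "run m (Test x A (Test y B Nop (flag v)) (Test y B (flag v) Nop)) s =
       upd v (fl (b \<or> (top_sym (s x) \<in> A) \<noteq> (top_sym (s y) \<in> B))) s"
    by (simp_all del: fl_simps(2))
qed

lemma run_whl: "run m (whl v c) = (\<lambda>s. if top_sym (s v) \<noteq> 0 then run m c s else s) ^^ m"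
proof -
  have eq: "run m (Test v {0} Nop c) = (\<lambda>s. if top_sym (s v) \<noteq> 0 then run m c s else s)"
    by (auto simp: fun_eq_iff)
  show ?thesis unfolding eq[symmetric] by (rule ext) (simp only: whl_def run.simps(7))
qed

lemma run_Loop_Move:
  "u \<noteq> v \<Longrightarrow> length (s u) \<le> m \<Longrightarrow> run m (Loop (Move u v)) s = s(v := rev (s u) @ s v, u := [])"
  by (simp add: run_Move_all)

text \<open>
  A certificate marks each vertex with two bits: membership in a competing set, and a guess of
  membership in the given set, which the word reveals only after the adjacency matrix.
\<close>

definition mark :: "bool \<Rightarrow> bool \<Rightarrow> nat" where
  "mark a b = (if a then if b then 4 else 2 else if b then 3 else 1)"

definition mark1 :: "nat \<Rightarrow> bool" where "mark1 c \<longleftrightarrow> c \<in> {2, 4}"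
definition mark2 :: "nat \<Rightarrow> bool" where "mark2 c \<longleftrightarrow> c \<in> {3, 4}"

definition hd0 :: "bool list \<Rightarrow> bool" where "hd0 xs = (case xs of [] \<Rightarrow> False | b # _ \<Rightarrow> b)"

lemma hd0_simps [simp]: "hd0 [] = False" "hd0 (b # xs) = b"
  by (simp_all add: hd0_def)

abbreviation bits :: "bool list \<Rightarrow> nat list" where "bits \<equiv> map bit_symbol"

lemma top_bits: "top_sym (bits xs) = 2 \<longleftrightarrow> hd0 xs" "top_sym (bits xs) = 0 \<longleftrightarrow> xs = []"
    "top_sym (bits xs) = 1 \<longleftrightarrow> xs \<noteq> [] \<and> \<not> hd0 xs" "tl (bits xs) = bits (tl xs)"
    "top_sym (bits xs) = Suc 0 \<longleftrightarrow> xs \<noteq> [] \<and> \<not> hd0 xs"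
  by (cases xs; simp add: bit_symbol_def)+

text \<open>Missing bits count as \<open>False\<close>, so every word is a certificate for any
  number of vertices and its length needs no check.\<close>

fun certs :: "nat \<Rightarrow> bool list \<Rightarrow> nat list" where
  "certs 0 u = []"
| "certs (Suc n) u = mark (hd0 u) (hd0 (tl u)) # certs n (tl (tl u))"

text \<open>The first loop turns the pair into reading order. Stripping the markers leaves
  \<open>u\<close> on \<open>vCert\<close>, and the word goes through \<open>vTmp\<close> to regain
  its order.\<close>

definition decode_pair :: com where
  "decode_pair = Loop (Move vInp vCert) ;; Loop (Test vCert {2} (Pop vCert ;; Move vCert vTmp) Nop) ;; Pop vCert ;; Loop (Move vTmp vWord)"

definition read_mark :: com where
  "read_mark = Test vCert {2} (Pop vCert ;; Test vCert {2} (Pop vCert ;; Push vDone 4) (Pop vCert ;; Push vDone 2))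
     (Pop vCert ;; Test vCert {2} (Pop vCert ;; Push vDone 3) (Pop vCert ;; Push vDone 1))"

definition read_size :: com where
  "read_size = Loop (Test vWord {2} (Pop vWord ;; read_mark) Nop) ;; Test vWord {0} (flag vBad) (Pop vWord) ;; Loop (Move vDone vTodo)"

definition read_edge :: com where
  "read_edge = Test vWord {0} (flag vBad) Nop ;;
     Test vWord {2} (Test vCur {3, 4} (Test vRow {3, 4} (flag vDep1) Nop) Nop) Nop ;;
     Test vWord {2} (Test vCur {2, 4} (Test vRow {2, 4} (flag vDep2) Nop) Nop) Nop ;;
     Pop vWord ;; Move vRow vDone"

text \<open>When a row begins, \<open>vDone\<close> holds the marks of the vertices before the
  current one, which are exactly the columns of that row.\<close>

definition read_edges :: com where
  "read_edges = whl vTodo (Move vTodo vCur ;; Loop (Move vDone vRow) ;; whl vRow read_edge ;; Move vCur vDone) ;; Loop (Move vDone vTodo)"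

definition read_member :: com where
  "read_member = Test vWord {0} (flag vBad) Nop ;;
     Test vWord {2} (Test vTodo {3, 4} Nop (flag vWrong)) (Test vTodo {3, 4} (flag vWrong) Nop) ;;
     Test vWord {2} (Test vTodo {2, 4} Nop (flag vDiff)) (Test vTodo {2, 4} (flag vDiff) Nop) ;;
     Pop vWord ;; Move vTodo vDone"

definition read_members :: com where
  "read_members = whl vTodo read_member ;; Loop (Move vDone vTodo)"

definition read_number :: com where
  "read_number = Loop (Test vWord {2} (Pop vWord ;; Test vWord {0} (flag vBad) Nop ;; Move vWord vNum) Nop) ;;
     Test vWord {0} (flag vBad) (Pop vWord) ;; Test vNum {1} (flag vBad) Nop"

definition spread :: com where
  "spread = whl vNum (Test vTodo {2, 4} (Copy vNum vAdd1) Nop ;; Test vTodo {3, 4} (Copy vNum vAdd2) Nop ;; Pop vNum)"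

definition add_step :: "nat \<Rightarrow> nat \<Rightarrow> com" where
  "add_step y a =
     Test y {2} (Test a {2} (Test vCarry {0} (Push vSum 1 ;; Push vCarry 1) (Push vSum 2))
                            (Test vCarry {0} (Push vSum 2) (Push vSum 1)))
                (Test a {2} (Test vCarry {0} (Push vSum 2) (Push vSum 1))
                            (Test vCarry {0} (Push vSum 1) (Push vSum 2 ;; Pop vCarry))) ;;
     Pop y ;; Pop a"

definition add :: "nat \<Rightarrow> nat \<Rightarrow> com" where
  "add y a = Loop (add_step y a) ;; Pop vCarry ;; Loop (Move 14 a)"

definition read_weights :: com where
  "read_weights = whl vTodo (read_number ;; spread ;; add vAdd1 vAcc1 ;; add vAdd2 vAcc2 ;; Pop vTodo)"

text \<open>The digits come least significant first, so the last difference decides;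
  \<open>vGe\<close> starts as true, the verdict for equal numbers.\<close>

definition compare_weights :: com where
  "compare_weights = Test vWord {0} Nop (flag vBad) ;; Push vGe 1 ;;
     Loop (Test vAcc1 {2} (Test vAcc2 {2} Nop (flag vGe)) (Test vAcc2 {2} (Pop vGe) Nop) ;; Pop vAcc1 ;; Pop vAcc2)"

text \<open>The order of the tests matters: malformed words are accepted, then wrong guesses
  rejected, then a dependent given set accepted; only after that is the competing set
  judged.\<close>

definition decide :: com where
  "decide = Test vBad {0} (Test vWrong {0} (Test vDep1 {0} (Test vDep2 {0} (Test vDiff {0} (Push vOut 1)
      (Test vGe {0} (Push vOut 1) (Push vOut 2))) (Push vOut 1)) (Push vOut 2)) (Push vOut 1)) (Push vOut 2)"

section \<open>What the phases of the verifier compute\<close>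

lemmas move_simps = run_Move_Cons run_Move_Nil

lemma run_decode_pair:
  assumes "y = pair x u"
  shows "run (length y) decode_pair (r(vInp := rev (bits y), vCert := [], vTmp := [], vWord := []))
    = r(vInp := [], vCert := bits u, vTmp := [], vWord := bits x)"
proof -
  let ?m = "length y"
  have y: "y = delimit x @ u" and len: "length x \<le> ?m" 
    using assms by (simp_all add: pair_def length_delimit)
  define S where "S k = r(vInp := [], vCert := bits (delimit (drop k x) @ u),
     vTmp := rev (bits (take k x)), vWord := [])" for k
  have 1: "run ?m (Loop (Move 1 2)) (r(vInp := rev (bits y), vCert := [], vTmp := [], vWord := [])) = S 0"
    by (subst run_Loop_Move) (simp_all add: S_def y[symmetric])
  have "((\<lambda>s. if top_sym (s 2) = 2 then run ?m (Pop 2 ;; Move 2 3) s else s) ^^ ?m) (S 0) = S (length x)"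
  proof (rule funpow_while_states)
    fix k assume k: "k < length x"
    then have "drop k x = x ! k # drop (Suc k) x" by (simp add: Cons_nth_drop_Suc)
    then have d: "delimit (drop k x) = True # x ! k # delimit (drop (Suc k) x)"
      by (simp add: delimit_def)
    show "top_sym (S k 2) = 2 \<and> run ?m (Pop 2 ;; Move 2 3) (S k) = S (Suc k)"
      using k by (simp add: S_def d move_simps take_Suc_conv_app_nth bit_symbol_def)
  qed (use len in \<open>simp_all add: S_def delimit_def bit_symbol_def\<close>)
  moreover have "run ?m (Test 2 {2} (Pop 2 ;; Move 2 3) Nop) =
      (\<lambda>s. if top_sym (s 2) = 2 then run ?m (Pop 2 ;; Move 2 3) s else s)"
    by (auto simp: fun_eq_iff)
  ultimately have 2: "run ?m (Loop (Test 2 {2} (Pop 2 ;; Move 2 3) Nop)) (S 0) = S (length x)"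
    by simp
  have 3: "run ?m (Loop (Move 3 4)) (run ?m (Pop 2) (S (length x)))
     = r(vInp := [], vCert := bits u, vTmp := [], vWord := bits x)"
    using len by (subst run_Loop_Move) (simp_all add: S_def delimit_def rev_map)
  show ?thesis unfolding decode_pair_def run.simps(5) 1 2 3 ..
qed

lemma run_read_mark:
  "run m read_mark (r(vCert := bits u)) =
   r(vCert := bits (tl (tl u)), vDone := mark (hd0 u) (hd0 (tl u)) # r vDone)"
  by (simp add: read_mark_def top_bits mark_def)

lemma length_certs: "length (certs n u) = n"
  by (induction n arbitrary: u) auto

lemma set_certs: "c \<in> set (certs n u) \<Longrightarrow> c \<noteq> 0"
  by (induction n arbitrary: u) (auto simp: mark_def)

lemma run_read_size:
  assumes "length x \<le> m"
  defines "n \<equiv> length (takeWhile id x)" and "z \<equiv> dropWhile id x"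
  shows "\<exists>v. run m read_size (r(vCert := bits u, vWord := bits x, vDone := [], vTodo := [], vBad := []))
    = r(vCert := v, vWord := bits (tl z), vDone := [],
        vTodo := certs n u, vBad := fl (z = []))"
proof -
  have nm: "n \<le> m" using assms(1) length_takeWhile_le[of id x] by (simp add: n_def)
  have tl_pow: "tl ((tl ^^ k) u) = (tl ^^ Suc k) u" for k by simp
  \<comment> \<open>\<open>certs\<close> recurses from the front, while the loop produces one more
    mark at the end in each round.\<close>
  have certs_take: "certs (Suc k) u = certs k u @ [mark (hd0 ((tl ^^ (2 * k)) u)) (hd0 ((tl ^^ (2 * k + 1)) u))]" for k u
    by (induction k arbitrary: u) (auto simp: funpow_swap1)
  define S where "S k = r(vCert := bits ((tl ^^ (2 * k)) u), vWord := bits (drop k x),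
      vDone := rev (certs k u), vTodo := [], vBad := [])" for k
  have x: "x = replicate n True @ z"
  proof -
    have "takeWhile id x = replicate n True"
      unfolding n_def by (rule replicate_length_same[symmetric]) (auto dest: set_takeWhileD)
    then show ?thesis unfolding z_def by (metis takeWhile_dropWhile_id)
  qed
  have z0: "\<not> hd0 z" unfolding z_def by (induction x) auto
  have "((\<lambda>s. if top_sym (s 4) = 2 then run m (Pop 4 ;; read_mark) s else s) ^^ m) (S 0) = S n"
  proof (rule funpow_while_states)
    fix k assume k: "k < n"
    then have "drop k x = True # drop (Suc k) x"
      by (simp add: x Suc_diff_Suc[symmetric] flip: replicate_Suc)
    then show "top_sym (S k 4) = 2 \<and> run m (Pop 4 ;; read_mark) (S k) = S (Suc k)"
      using run_read_mark[of m "r(vWord := bits (drop (Suc k) x), vDone := rev (certs k u), vTodo := [], vBad := [])"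
        "(tl ^^ (2 * k)) u"]
      by (simp add: S_def certs_take bit_symbol_def del: certs.simps)
  next
    have "drop n x = z" by (simp add: x)
    then show "\<not> top_sym (S n 4) = 2" using z0 by (simp add: S_def top_bits)
  qed (rule nm)
  moreover have "run m (Test 4 {2} (Pop 4 ;; read_mark) Nop) =
      (\<lambda>s. if top_sym (s 4) = 2 then run m (Pop 4 ;; read_mark) s else s)"
    by (auto simp: fun_eq_iff)
  ultimately have 1: "run m (Loop (Test 4 {2} (Pop 4 ;; read_mark) Nop)) (S 0) = S n"
    by simp
  have "drop n x = z" by (simp add: x)
  then have 2: "run m (Test 4 {0} (flag 16) (Pop 4)) (S n) =
     r(vCert := bits ((tl ^^ (2 * n)) u), vWord := bits (tl z),
      vDone := rev (certs n u), vTodo := [], vBad := fl (z = []))"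
    by (simp add: S_def top_bits flag_def)
  show ?thesis
    unfolding read_size_def run.simps(5)
    using 1 2 by (intro exI) (simp add: S_def del: run.simps, subst run_Loop_Move, simp_all add: length_certs nm)
qed

text \<open>Positions past the end read as \<open>False\<close>, just as an exhausted stack fails
  the test for \<open>2\<close>. The equations for the phases therefore hold for malformed words
  too.\<close>

definition bit_at :: "bool list \<Rightarrow> nat \<Rightarrow> bool" where "bit_at X j = hd0 (drop j X)"

lemma bit_at_simps: "bit_at X 0 = hd0 X" "bit_at X (Suc j) = bit_at (tl X) j" "bit_at (drop k X) j = bit_at X (k + j)"
  by (simp_all add: bit_at_def drop_Suc add.commute)

lemma bit_at_nth: "j < length X \<Longrightarrow> bit_at X j = X ! j"
  by (simp add: bit_at_def Cons_nth_drop_Suc[symmetric])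

lemma top_mark [simp]: "top_sym (c # cs) \<in> {2, 4} \<longleftrightarrow> mark1 c" "top_sym (c # cs) \<in> {3, 4} \<longleftrightarrow> mark2 c"
  by (simp_all add: mark1_def mark2_def)

lemma run_read_edge:
  assumes "e \<noteq> 0"
  shows "run m read_edge (r(vWord := bits X, vDone := D, vCur := [c], vRow := e # es, vBad := fl bad,
      vDep1 := fl d1, vDep2 := fl d2)) =
    r(vWord := bits (tl X), vDone := e # D, vCur := [c], vRow := es, vBad := fl (bad \<or> X = []),
      vDep1 := fl (d1 \<or> (hd0 X \<and> mark2 c \<and> mark2 e)), vDep2 := fl (d2 \<or> (hd0 X \<and> mark1 c \<and> mark1 e)))"
  using assms by (simp add: read_edge_def run_flag_tests move_simps top_bits mark1_def mark2_def del: run.simps(6))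

fun edge_step :: "nat \<Rightarrow> nat \<Rightarrow> bool list \<times> bool \<times> bool \<times> bool \<times> nat list \<Rightarrow> bool list \<times> bool \<times> bool \<times> bool \<times> nat list" where
  "edge_step c e (X, bad, d1, d2, D) = (tl X, bad \<or> X = [], d1 \<or> (hd0 X \<and> mark2 c \<and> mark2 e),
     d2 \<or> (hd0 X \<and> mark1 c \<and> mark1 e), e # D)"

lemma fold_edge_step: "fold (edge_step c) es (X, bad, d1, d2, D) = (drop (length es) X, bad \<or> length X < length es,
    d1 \<or> (\<exists>j<length es. bit_at X j \<and> mark2 c \<and> mark2 (es ! j)),
    d2 \<or> (\<exists>j<length es. bit_at X j \<and> mark1 c \<and> mark1 (es ! j)), rev es @ D)"
proof (induction es arbitrary: X bad d1 d2 D)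
  case (Cons e es)
  have "X = [] \<or> length (tl X) < length es \<longleftrightarrow> length X < Suc (length es)" by (cases X) auto
  then show ?case by (auto simp: Cons drop_Suc Ex_less_Suc2 bit_at_simps)
qed simp

lemma run_row:
  assumes "length es \<le> m" "0 \<notin> set es"
  shows "run m (whl vRow read_edge) (r(vWord := bits X, vDone := [], vCur := [c], vRow := es, vBad := fl bad,
      vDep1 := fl d1, vDep2 := fl d2)) =
    r(vWord := bits (drop (length es) X), vDone := rev es, vCur := [c], vRow := [],
      vBad := fl (bad \<or> length X < length es),
      vDep1 := fl (d1 \<or> (\<exists>j<length es. bit_at X j \<and> mark2 c \<and> mark2 (es ! j))),
      vDep2 := fl (d2 \<or> (\<exists>j<length es. bit_at X j \<and> mark1 c \<and> mark1 (es ! j))))"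
proof -
  define st where "st es = (\<lambda>(X, bad, d1, d2, D). r(vWord := bits X, vDone := D, vCur := [c], vRow := es,
      vBad := fl bad, vDep1 := fl d1, vDep2 := fl d2))" for es
  have "((\<lambda>s. if top_sym (s vRow) \<noteq> 0 then run m read_edge s else s) ^^ m) (st es (X, bad, d1, d2, []))
      = st [] (fold (edge_step c) es (X, bad, d1, d2, []))"
  proof (rule funpow_while_fold[where Q = "\<lambda>es _. 0 \<notin> set es"])
    fix e :: nat and es and a :: "bool list \<times> bool \<times> bool \<times> bool \<times> nat list"
    assume e: "0 \<notin> set (e # es)"
    obtain X bad d1 d2 D where a: "a = (X, bad, d1, d2, D)" by (cases a) auto
    show "top_sym (st (e # es) a vRow) \<noteq> 0 \<and> run m read_edge (st (e # es) a) = st es (edge_step c e a) \<and> 0 \<notin> set es"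
      using run_read_edge[of e m r X D c es bad d1 d2] e by (simp add: st_def a)
  qed (use assms in \<open>auto simp: st_def split: prod.splits\<close>)
  then show ?thesis unfolding fold_edge_step run_whl by (simp add: st_def)
qed

fun row_step :: "nat \<Rightarrow> bool list \<times> bool \<times> bool \<times> bool \<times> nat list \<Rightarrow> bool list \<times> bool \<times> bool \<times> bool \<times> nat list" where
  "row_step c (X, bad, d1, d2, D) = (drop (length D) X, bad \<or> length X < length D,
     d1 \<or> (\<exists>j<length D. bit_at X j \<and> mark2 c \<and> mark2 (rev D ! j)),
     d2 \<or> (\<exists>j<length D. bit_at X j \<and> mark1 c \<and> mark1 (rev D ! j)), c # D)"

text \<open>The number of matrix entries before row \<open>n\<close>, hence the offset of that row
  in the word.\<close>

definition tri :: "nat \<Rightarrow> nat" where "tri n = (\<Sum>i<n. i)"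

lemma tri_Suc [simp]: "tri 0 = 0" "tri (Suc n) = tri n + n"
  by (simp_all add: tri_def)

lemma fold_row_step:
  assumes "k \<le> length cs"
  shows "fold row_step (take k cs) (X, bad, False, False, []) = (drop (tri k) X, bad \<or> length X < tri k,
     (\<exists>i<k. \<exists>j<i. bit_at X (tri i + j) \<and> mark2 (cs ! i) \<and> mark2 (cs ! j)),
     (\<exists>i<k. \<exists>j<i. bit_at X (tri i + j) \<and> mark1 (cs ! i) \<and> mark1 (cs ! j)), rev (take k cs))"
  using assms
proof (induction k)
  case (Suc k)
  have e: "(\<exists>j<k. bit_at (drop (tri k) X) j \<and> mk (cs ! k) \<and> mk (take k cs ! j)) \<longleftrightarrow>
      (\<exists>j<k. bit_at X (tri k + j) \<and> mk (cs ! k) \<and> mk (cs ! j))" for mk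
    by (auto simp: bit_at_simps)
  have l: "length (drop (tri k) X) < k \<or> length X < tri k \<longleftrightarrow> length X < tri (Suc k)" by auto
  have "fold row_step (take (Suc k) cs) (X, bad, False, False, []) =
      row_step (cs ! k) (fold row_step (take k cs) (X, bad, False, False, []))"
    using Suc.prems by (simp add: take_Suc_conv_app_nth)
  also have "\<dots> = row_step (cs ! k) (drop (tri k) X, bad \<or> length X < tri k,
     (\<exists>i<k. \<exists>j<i. bit_at X (tri i + j) \<and> mark2 (cs ! i) \<and> mark2 (cs ! j)),
     (\<exists>i<k. \<exists>j<i. bit_at X (tri i + j) \<and> mark1 (cs ! i) \<and> mark1 (cs ! j)), rev (take k cs))"
    using Suc by simp
  finally show ?case
    using Suc.prems e[of mark1] e[of mark2] l
    by (simp add: take_Suc_conv_app_nth Ex_less_Suc add.commute del: length_drop) blast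
qed simp

lemma run_read_edges:
  assumes "length cs \<le> m" "0 \<notin> set cs"
  shows "run m read_edges (r(vWord := bits X, vDone := [], vTodo := cs, vCur := [], vRow := [], vBad := fl bad,
      vDep1 := [], vDep2 := [])) =
    r(vWord := bits (drop (tri (length cs)) X), vDone := [], vTodo := cs, vCur := [], vRow := [],
      vBad := fl (bad \<or> length X < tri (length cs)),
      vDep1 := fl (\<exists>i<length cs. \<exists>j<i. bit_at X (tri i + j) \<and> mark2 (cs ! i) \<and> mark2 (cs ! j)),
      vDep2 := fl (\<exists>i<length cs. \<exists>j<i. bit_at X (tri i + j) \<and> mark1 (cs ! i) \<and> mark1 (cs ! j)))"
proof -
  let ?body = "Move vTodo vCur ;; Loop (Move vDone vRow) ;; whl vRow read_edge ;; Move vCur vDone"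
  define st where "st cs = (\<lambda>(X, bad, d1, d2, D). r(vWord := bits X, vDone := D, vTodo := cs, vCur := [],
     vRow := [], vBad := fl bad, vDep1 := fl d1, vDep2 := fl d2))" for cs
  let ?Q = "\<lambda>cs (X :: bool list, bad :: bool, d1 :: bool, d2 :: bool, D). 0 \<notin> set cs \<and> 0 \<notin> set D \<and> length D + length cs \<le> m"
  have "((\<lambda>s. if top_sym (s vTodo) \<noteq> 0 then run m ?body s else s) ^^ m) (st cs (X, bad, False, False, []))
      = st [] (fold row_step cs (X, bad, False, False, []))"
  proof (rule funpow_while_fold[where Q = ?Q])
    fix c :: nat and cs and a :: "bool list \<times> bool \<times> bool \<times> bool \<times> nat list"
    assume Q: "?Q (c # cs) a"
    obtain X bad d1 d2 D where a: "a = (X, bad, d1, d2, D)" by (cases a) auto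
    have 1: "run m (Move vTodo vCur) (st (c # cs) a) = r(vWord := bits X, vDone := D, vTodo := cs, vCur := [c],
     vRow := [], vBad := fl bad, vDep1 := fl d1, vDep2 := fl d2)"
      by (simp add: st_def a move_simps)
    have 2: "run m (Loop (Move vDone vRow)) (r(vWord := bits X, vDone := D, vTodo := cs, vCur := [c],
     vRow := [], vBad := fl bad, vDep1 := fl d1, vDep2 := fl d2)) =
      (r(vTodo := cs))(vWord := bits X, vDone := [], vCur := [c],
     vRow := rev D, vBad := fl bad, vDep1 := fl d1, vDep2 := fl d2)"
      using Q by (subst run_Loop_Move) (auto simp: a)
    have "0 \<notin> set (rev D)" "length (rev D) \<le> m" using Q by (auto simp: a)
    note 3 = run_row[OF this(2,1), of "r(vTodo := cs)" X c bad d1 d2]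
    have "run m ?body (st (c # cs) a) = st cs (row_step c a)"
      unfolding run.simps(5) 1 2 3 by (simp add: a st_def move_simps)
    moreover have "top_sym (st (c # cs) a vTodo) \<noteq> 0" using Q by (simp add: st_def a)
    ultimately show "top_sym (st (c # cs) a vTodo) \<noteq> 0 \<and> run m ?body (st (c # cs) a) = st cs (row_step c a) \<and>
       ?Q cs (row_step c a)" using Q by (simp add: a)
  qed (use assms in \<open>auto simp: st_def split: prod.splits\<close>)
  then have 1: "run m (whl vTodo ?body) (st cs (X, bad, False, False, [])) = st [] (fold row_step cs (X, bad, False, False, []))"
    unfolding run_whl .
  have 2: "run m (Loop (Move vDone vTodo)) (st [] (X', bad', d1, d2, rev cs)) = r(vWord := bits X', vDone := [], vTodo := cs, vCur := [], vRow := [],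
      vBad := fl bad', vDep1 := fl d1, vDep2 := fl d2)" for X' bad' d1 d2
    using assms by (subst run_Loop_Move) (simp_all add: st_def)
  show ?thesis
    using 1 2 fold_row_step[of "length cs" cs X bad]
    by (simp add: read_edges_def st_def del: run.simps(2-4,6,7))
qed

lemma run_read_member:
  assumes "c \<noteq> 0"
  shows "run m read_member (r(vWord := bits X, vDone := D, vTodo := c # cs, vBad := fl bad,
      vWrong := fl wr, vDiff := fl df)) =
    r(vWord := bits (tl X), vDone := c # D, vTodo := cs, vBad := fl (bad \<or> X = []),
      vWrong := fl (wr \<or> hd0 X \<noteq> mark2 c), vDiff := fl (df \<or> hd0 X \<noteq> mark1 c))"
  using assms by (simp add: read_member_def run_flag_tests move_simps top_bits mark1_def mark2_def del: run.simps(6))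

fun member_step :: "nat \<Rightarrow> bool list \<times> bool \<times> bool \<times> bool \<times> nat list \<Rightarrow> bool list \<times> bool \<times> bool \<times> bool \<times> nat list" where
  "member_step c (X, bad, wr, df, D) = (tl X, bad \<or> X = [], wr \<or> hd0 X \<noteq> mark2 c, df \<or> hd0 X \<noteq> mark1 c, c # D)"

lemma fold_member_step: "fold member_step cs (X, bad, wr, df, D) = (drop (length cs) X, bad \<or> length X < length cs,
    wr \<or> (\<exists>i<length cs. bit_at X i \<noteq> mark2 (cs ! i)), df \<or> (\<exists>i<length cs. bit_at X i \<noteq> mark1 (cs ! i)), rev cs @ D)"
proof (induction cs arbitrary: X bad wr df D)
  case (Cons c cs)
  have "X = [] \<or> length (tl X) < length cs \<longleftrightarrow> length X < Suc (length cs)" by (cases X) auto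
  then show ?case by (auto simp: Cons drop_Suc Ex_less_Suc2 bit_at_simps)
qed simp

lemma run_read_members:
  assumes "length cs \<le> m" "0 \<notin> set cs"
  shows "run m read_members (r(vWord := bits X, vDone := [], vTodo := cs, vBad := fl bad, vWrong := [], vDiff := [])) =
    r(vWord := bits (drop (length cs) X), vDone := [], vTodo := cs,
      vBad := fl (bad \<or> length X < length cs),
      vWrong := fl (\<exists>i<length cs. bit_at X i \<noteq> mark2 (cs ! i)),
      vDiff := fl (\<exists>i<length cs. bit_at X i \<noteq> mark1 (cs ! i)))"
proof -
  define st where "st cs = (\<lambda>(X, bad, wr, df, D). r(vWord := bits X, vDone := D, vTodo := cs,
     vBad := fl bad, vWrong := fl wr, vDiff := fl df))" for cs
  have "((\<lambda>s. if top_sym (s vTodo) \<noteq> 0 then run m read_member s else s) ^^ m) (st cs (X, bad, False, False, []))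
      = st [] (fold member_step cs (X, bad, False, False, []))"
  proof (rule funpow_while_fold[where Q = "\<lambda>cs _. 0 \<notin> set cs"])
    fix c :: nat and cs and a :: "bool list \<times> bool \<times> bool \<times> bool \<times> nat list"
    assume c: "0 \<notin> set (c # cs)"
    obtain X bad wr df D where a: "a = (X, bad, wr, df, D)" by (cases a) auto
    show "top_sym (st (c # cs) a vTodo) \<noteq> 0 \<and> run m read_member (st (c # cs) a) = st cs (member_step c a) \<and> 0 \<notin> set cs"
      using run_read_member[of c m r X D cs bad wr df] c by (simp add: st_def a)
  qed (use assms in \<open>auto simp: st_def split: prod.splits\<close>)
  then have 1: "run m (whl vTodo read_member) (st cs (X, bad, False, False, [])) = st [] (fold member_step cs (X, bad, False, False, []))"
    unfolding run_whl .
  have 2: "run m (Loop (Move vDone vTodo)) (st [] (X', bad', d1, d2, rev cs)) = r(vWord := bits X', vDone := [], vTodo := cs,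
      vBad := fl bad', vWrong := fl d1, vDiff := fl d2)" for X' bad' d1 d2
    using assms by (subst run_Loop_Move) (simp_all add: st_def)
  show ?thesis
    using 1 2 by (simp add: read_members_def st_def fold_member_step del: run.simps(2-4,6,7))
qed

text \<open>The closing \<open>False\<close> is left for the caller, so an empty remainder signals
  that it is missing. A marker without its bit sets the flag.\<close>

fun take_number :: "bool list \<Rightarrow> bool list \<Rightarrow> bool \<Rightarrow> bool list \<times> bool list \<times> bool" where
  "take_number (True # b # X) z bad = take_number X (b # z) bad"
| "take_number [True] z bad = ([], z, True)"
| "take_number X z bad = (X, z, bad)"

lemma length_take_number:
  "take_number X z bad = (X', z', bad') \<Longrightarrow> length X' \<le> length X \<and> length z' \<le> length z + length X"
  by (induction X z bad rule: take_number.induct) auto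

lemma run_read_number:
  assumes "length X \<le> m" "take_number X [] bad = (X', z, bad')"
  shows "run m read_number (r(vWord := bits X, vNum := [], vBad := fl bad)) =
    r(vWord := bits (tl X'), vNum := bits z, vBad := fl (bad' \<or> X' = [] \<or> (z \<noteq> [] \<and> \<not> hd0 z)))"
proof -
  let ?b = "Test vWord {2} (Pop vWord ;; Test vWord {0} (flag vBad) Nop ;; Move vWord vNum) Nop"
  have "(run m ?b ^^ k) (r(vWord := bits X, vNum := bits z0, vBad := fl bad))
      = r(vWord := bits X', vNum := bits z, vBad := fl bad')"
    if "take_number X z0 bad = (X', z, bad')" "length X \<le> k" for k X z0 bad
    using that
  proof (induction X z0 bad arbitrary: k rule: take_number.induct)
    case (1 b X z0 bad)
    then obtain k' where k: "k = Suc k'" "length X \<le> k'" by (cases k) auto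
    have "run m ?b (r(vWord := bits (True # b # X), vNum := bits z0, vBad := fl bad)) =
        r(vWord := bits X, vNum := bits (b # z0), vBad := fl bad)"
      by (simp add: move_simps bit_symbol_def)
    then show ?case using 1 k by (simp add: funpow_Suc_right del: funpow.simps run.simps)
  next
    case (2 z0 bad)
    then obtain k' where k: "k = Suc k'" by (cases k) auto
    have "run m ?b (r(vWord := bits [True], vNum := bits z0, vBad := fl bad)) =
        r(vWord := [], vNum := bits z0, vBad := fl True)"
      by (cases bad) (simp_all add: move_simps flag_def)
    moreover have "(run m ?b ^^ k') (r(vWord := [], vNum := bits z0, vBad := fl True)) =
        r(vWord := [], vNum := bits z0, vBad := fl True)"
      by (induction k') simp_all
    ultimately show ?case using 2 k by (simp add: funpow_Suc_right del: funpow.simps run.simps)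
  next
    case ("3_1" z0 bad)
    have "(run m ?b ^^ k) (r(vWord := [], vNum := bits z0, vBad := fl bad)) =
        r(vWord := [], vNum := bits z0, vBad := fl bad)"
      by (induction k) simp_all
    then show ?case using "3_1" by (simp del: run.simps)
  next
    case ("3_2" X z0 bad)
    have "(run m ?b ^^ k) (r(vWord := bits (False # X), vNum := bits z0, vBad := fl bad)) =
        r(vWord := bits (False # X), vNum := bits z0, vBad := fl bad)"
      by (induction k) simp_all
    moreover have "X' = False # X" "z = z0" "bad' = bad" using "3_2"(1) by simp_all
    ultimately show ?case by (simp del: run.simps)
  next
    case ("3_3" z0 bad)
    have "(run m ?b ^^ k) (r(vWord := bits [False], vNum := bits z0, vBad := fl bad)) =
        r(vWord := bits [False], vNum := bits z0, vBad := fl bad)"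
      by (induction k) simp_all
    moreover have "X' = [False]" "z = z0" "bad' = bad" using "3_3"(1) by simp_all
    ultimately show ?case by (simp del: run.simps)
  qed
  from this[of X "[]" bad m] have 1: "run m (Loop ?b) (r(vWord := bits X, vNum := [], vBad := fl bad)) =
      r(vWord := bits X', vNum := bits z, vBad := fl bad')"
    using assms by simp
  have "run m (Test vWord {0} (flag vBad) (Pop vWord) ;; Test vNum {1} (flag vBad) Nop)
     (r(vWord := bits X', vNum := bits z, vBad := fl bad')) =
     r(vWord := bits (tl X'), vNum := bits z, vBad := fl (bad' \<or> X' = [] \<or> (z \<noteq> [] \<and> \<not> hd0 z)))"
    by (cases X'; cases z; cases bad'; simp add: flag_def bit_symbol_def)
  with 1 show ?thesis unfolding read_number_def run.simps(5) by simp
qed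

lemma run_spread:
  assumes "length z \<le> m"
  shows "run m spread (r(vTodo := c # cs, vNum := bits z, vAdd1 := [], vAdd2 := [])) =
    r(vTodo := c # cs, vNum := [], vAdd1 := bits (if mark1 c then rev z else []),
      vAdd2 := bits (if mark2 c then rev z else []))"
proof -
  let ?b = "Test vTodo {2, 4} (Copy vNum vAdd1) Nop ;; Test vTodo {3, 4} (Copy vNum vAdd2) Nop ;; Pop vNum"
  define S where "S k = r(vTodo := c # cs, vNum := bits (drop k z),
     vAdd1 := bits (if mark1 c then rev (take k z) else []),
     vAdd2 := bits (if mark2 c then rev (take k z) else []))" for k
  have S0: "S 0 = r(vTodo := c # cs, vNum := bits z, vAdd1 := [], vAdd2 := [])"
    by (simp add: S_def)
  have Sn: "S (length z) = r(vTodo := c # cs, vNum := [], vAdd1 := bits (if mark1 c then rev z else []),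
      vAdd2 := bits (if mark2 c then rev z else []))"
    by (simp add: S_def)
  have "((\<lambda>s. if top_sym (s vNum) \<noteq> 0 then run m ?b s else s) ^^ m) (S 0) = S (length z)"
  proof (rule funpow_while_states)
    fix k assume k: "k < length z"
    then have "drop k z = z ! k # drop (Suc k) z" by (simp add: Cons_nth_drop_Suc)
    then show "top_sym (S k vNum) \<noteq> 0 \<and> run m ?b (S k) = S (Suc k)"
      using k by (simp add: S_def take_Suc_conv_app_nth mark1_def mark2_def)
  qed (use assms in \<open>simp_all add: S_def\<close>)
  then show ?thesis unfolding spread_def run_whl S0 Sn .
qed

text \<open>Ripple-carry addition cut off after \<open>n\<close> digits, because the loop always
  runs for the full input length; exhausted summands supply zeros.\<close>

fun add_bits :: "nat \<Rightarrow> bool list \<Rightarrow> bool list \<Rightarrow> bool \<Rightarrow> bool list" where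
  "add_bits 0 ys as c = []"
| "add_bits (Suc n) ys as c = ((hd0 ys \<noteq> hd0 as) \<noteq> c) #
     add_bits n (tl ys) (tl as) (hd0 ys \<and> hd0 as \<or> c \<and> (hd0 ys \<or> hd0 as))"

lemma length_add_bits [simp]: "length (add_bits n ys as c) = n"
  by (induction n arbitrary: ys as c) auto

lemma run_add:
  assumes "y = vAdd1 \<and> a = vAcc1 \<or> y = vAdd2 \<and> a = vAcc2" "length ys \<le> m" "length as \<le> m"
  shows "run m (add y a) (r(y := bits ys, a := bits as, vSum := [], vCarry := [])) =
    r(y := [], a := bits (add_bits m ys as False), vSum := [], vCarry := [])"
proof -
  have step: "run m (add_step y a) (r(y := bits ys, a := bits as, vSum := ws, vCarry := fl c)) =
      r(y := bits (tl ys), a := bits (tl as), vSum := bit_symbol ((hd0 ys \<noteq> hd0 as) \<noteq> c) # ws,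
        vCarry := fl (hd0 ys \<and> hd0 as \<or> c \<and> (hd0 ys \<or> hd0 as)))" for ys as ws c
    using assms(1)
    by (elim disjE conjE; cases c; cases "hd0 ys"; cases "hd0 as"; simp add: add_step_def top_bits)
  have "\<exists>c'. (run m (add_step y a) ^^ k) (r(y := bits ys, a := bits as, vSum := ws, vCarry := fl c)) =
      r(y := bits (drop k ys), a := bits (drop k as), vSum := rev (bits (add_bits k ys as c)) @ ws, vCarry := fl c')"
    for k ys as ws c
  proof (induction k arbitrary: ys as ws c)
    case (Suc k)
    show ?case
      using Suc[of "tl ys" "tl as" "bit_symbol ((hd0 ys \<noteq> hd0 as) \<noteq> c) # ws" "hd0 ys \<and> hd0 as \<or> c \<and> (hd0 ys \<or> hd0 as)"]
      unfolding funpow_Suc_right o_apply step by (simp add: drop_Suc)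
  qed auto
  from this[of m ys as "[]" False] obtain c' where
    1: "run m (Loop (add_step y a)) (r(y := bits ys, a := bits as, vSum := [], vCarry := [])) =
      r(y := [], a := [], vSum := rev (bits (add_bits m ys as False)), vCarry := fl c')"
    using assms(2,3) by auto
  have 2: "run m (Pop vCarry) (r(y := [], a := [], vSum := rev (bits (add_bits m ys as False)), vCarry := fl c')) =
      r(y := [], a := [], vSum := rev (bits (add_bits m ys as False)), vCarry := [])"
    by (cases c') simp_all
  have 3: "run m (Loop (Move vSum a)) (r(y := [], a := [], vSum := rev (bits (add_bits m ys as False)), vCarry := [])) =
      r(y := [], a := bits (add_bits m ys as False), vSum := [], vCarry := [])"
    using assms(1) by (elim disjE conjE; subst run_Loop_Move; simp add: rev_map)
  show ?thesis unfolding add_def run.simps(5) 1 2 3 ..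
qed

fun weight_step :: "nat \<Rightarrow> nat \<Rightarrow> bool list \<times> bool \<times> bool list \<times> bool list \<Rightarrow> bool list \<times> bool \<times> bool list \<times> bool list" where
  "weight_step m c (X, bad, A, B) = (case take_number X [] bad of (X', z, bad') \<Rightarrow>
     (tl X', bad' \<or> X' = [] \<or> (z \<noteq> [] \<and> \<not> hd0 z),
      add_bits m (if mark1 c then rev z else []) A False,
      add_bits m (if mark2 c then rev z else []) B False))"

lemma run_read_weights:
  assumes "length cs \<le> m" "0 \<notin> set cs" "length X \<le> m"
    and "fold (weight_step m) cs (X, bad, [], []) = (X', bad', A, B)"
  shows "run m read_weights (r(vWord := bits X, vTodo := cs, vNum := [], vAdd1 := [], vAdd2 := [], vAcc1 := [], vAcc2 := [],
      vSum := [], vCarry := [], vBad := fl bad)) =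
    r(vWord := bits X', vTodo := [], vNum := [], vAdd1 := [], vAdd2 := [], vAcc1 := bits A, vAcc2 := bits B,
      vSum := [], vCarry := [], vBad := fl bad')"
proof -
  let ?body = "read_number ;; spread ;; add vAdd1 vAcc1 ;; add vAdd2 vAcc2 ;; Pop vTodo"
  define st where "st cs = (\<lambda>(X, bad, A, B). r(vWord := bits X, vTodo := cs, vNum := [], vAdd1 := [], vAdd2 := [],
      vAcc1 := bits A, vAcc2 := bits B, vSum := [], vCarry := [], vBad := fl bad))" for cs
  let ?Q = "\<lambda>cs (X :: bool list, bad :: bool, A :: bool list, B :: bool list).
     0 \<notin> set cs \<and> length X \<le> m \<and> length A \<le> m \<and> length B \<le> m"
  have "((\<lambda>s. if top_sym (s vTodo) \<noteq> 0 then run m ?body s else s) ^^ m) (st cs (X, bad, [], []))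
      = st [] (fold (weight_step m) cs (X, bad, [], []))"
  proof (rule funpow_while_fold[where Q = ?Q])
    fix c :: nat and cs and a :: "bool list \<times> bool \<times> bool list \<times> bool list"
    assume Q: "?Q (c # cs) a"
    obtain X bad A B where a: "a = (X, bad, A, B)" by (cases a) auto
    obtain X' z bad' where n: "take_number X [] bad = (X', z, bad')" by (cases "take_number X [] bad") auto
    have len: "length X' \<le> m" "length z \<le> m" using length_take_number[OF n] Q by (auto simp: a)
    define bad'' where "bad'' = (bad' \<or> X' = [] \<or> (z \<noteq> [] \<and> \<not> hd0 z))"
    let ?y1 = "if mark1 c then rev z else []" and ?y2 = "if mark2 c then rev z else []"
    define r0 where "r0 = r(vTodo := c # cs, vAdd1 := [], vAdd2 := [],
      vAcc1 := bits A, vAcc2 := bits B, vSum := [], vCarry := [])"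
    have 1: "run m read_number (st (c # cs) a) = r0(vWord := bits (tl X'), vNum := bits z, vBad := fl bad'')"
      using run_read_number[OF _ n, of m r0] Q by (simp add: a st_def r0_def bad''_def)
    define r1 where "r1 = r(vWord := bits (tl X'), vBad := fl bad'',
      vAcc1 := bits A, vAcc2 := bits B, vSum := [], vCarry := [])"
    have 2: "run m spread (r0(vWord := bits (tl X'), vNum := bits z, vBad := fl bad'')) =
      r1(vTodo := c # cs, vNum := [], vAdd1 := bits ?y1, vAdd2 := bits ?y2)"
      using run_spread[OF len(2), of r1 c cs] by (simp add: r0_def r1_def)
    define r2 where "r2 = r(vWord := bits (tl X'), vTodo := c # cs, vNum := [], vBad := fl bad'',
      vAcc2 := bits B, vAdd2 := bits ?y2)"
    have 3: "run m (add vAdd1 vAcc1) (r1(vTodo := c # cs, vNum := [], vAdd1 := bits ?y1, vAdd2 := bits ?y2)) =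
      r2(vAdd1 := [], vAcc1 := bits (add_bits m ?y1 A False), vSum := [], vCarry := [])"
      using run_add[of vAdd1 vAcc1 ?y1 m A r2] len Q by (simp add: r1_def r2_def a)
    define r3 where "r3 = r(vWord := bits (tl X'), vTodo := c # cs, vNum := [], vBad := fl bad'',
      vAdd1 := [], vAcc1 := bits (add_bits m ?y1 A False))"
    have 4: "run m (add vAdd2 vAcc2) (r2(vAdd1 := [], vAcc1 := bits (add_bits m ?y1 A False), vSum := [], vCarry := [])) =
      r3(vAdd2 := [], vAcc2 := bits (add_bits m ?y2 B False), vSum := [], vCarry := [])"
      using run_add[of vAdd2 vAcc2 ?y2 m B r3] len Q by (simp add: r2_def r3_def a)
    have "run m ?body (st (c # cs) a) = st cs (weight_step m c a)"
      unfolding run.simps(5) 1 2 3 4 by (simp add: a st_def r3_def n bad''_def)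
    moreover have "top_sym (st (c # cs) a vTodo) \<noteq> 0" using Q by (simp add: st_def a)
    ultimately show "top_sym (st (c # cs) a vTodo) \<noteq> 0 \<and> run m ?body (st (c # cs) a) = st cs (weight_step m c a) \<and>
       ?Q cs (weight_step m c a)" using Q len by (auto simp: a n)
  qed (use assms in \<open>auto simp: st_def split: prod.splits\<close>)
  then show ?thesis unfolding read_weights_def run_whl by (simp add: assms(4)) (simp add: st_def)
qed

fun compare_bits :: "nat \<Rightarrow> bool list \<Rightarrow> bool list \<Rightarrow> bool \<Rightarrow> bool" where
  "compare_bits 0 as bs g = g"
| "compare_bits (Suc n) as bs g =
     compare_bits n (tl as) (tl bs) (if hd0 as = hd0 bs then g else hd0 as)"

lemma run_compare_weights:
  "run m compare_weights (r(vWord := bits X, vAcc1 := bits A, vAcc2 := bits B, vBad := fl bad, vGe := [])) =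
    r(vWord := bits X, vAcc1 := bits (drop m A), vAcc2 := bits (drop m B), vBad := fl (bad \<or> X \<noteq> []),
      vGe := fl (compare_bits m A B True))"
proof -
  let ?b = "Test vAcc1 {2} (Test vAcc2 {2} Nop (flag vGe)) (Test vAcc2 {2} (Pop vGe) Nop) ;; Pop vAcc1 ;; Pop vAcc2"
  have step: "run m ?b (r(vAcc1 := bits A, vAcc2 := bits B, vGe := fl g)) =
     r(vAcc1 := bits (tl A), vAcc2 := bits (tl B), vGe := fl (if hd0 A = hd0 B then g else hd0 A))" for A B g r
    by (cases g; cases "hd0 A"; cases "hd0 B"; simp add: top_bits flag_def)
  have loop: "(run m ?b ^^ k) (r(vAcc1 := bits A, vAcc2 := bits B, vGe := fl g)) =
     r(vAcc1 := bits (drop k A), vAcc2 := bits (drop k B), vGe := fl (compare_bits k A B g))" for k A B g r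
  proof (induction k arbitrary: A B g)
    case (Suc k)
    then show ?case unfolding funpow_Suc_right o_apply step by (simp add: drop_Suc del: run.simps)
  qed simp
  have 1: "run m (Push vGe 1) (run m (Test vWord {0} Nop (flag vBad)) (r(vWord := bits X, vAcc1 := bits A, vAcc2 := bits B, vBad := fl bad, vGe := []))) =
     (r(vWord := bits X, vBad := fl (bad \<or> X \<noteq> [])))(vAcc1 := bits A, vAcc2 := bits B, vGe := fl True)"
    by (cases bad; cases X; simp add: flag_def)
  show ?thesis
    unfolding compare_weights_def run.simps(5) 1 unfolding run.simps(7) loop[unfolded run.simps(5)] loop by simp
qed

text \<open>Describes the verdict on every word: the verifier does not stop at an error but carries
  the flag to the end.\<close>

definition accepts :: "nat \<Rightarrow> bool list \<Rightarrow> bool list \<Rightarrow> bool" where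
  "accepts m x u = (let z = dropWhile id x; n = length (takeWhile id x); cs = certs n u; X = tl z in
     case fold (weight_step m) cs (drop (tri n + n) X, z = [] \<or> length X < tri n + n, [], []) of (X', bad, A, B) \<Rightarrow>
       bad \<or> X' \<noteq> [] \<or>
       (\<forall>i<n. bit_at X (tri n + i) = mark2 (cs ! i)) \<and>
       ((\<exists>i<n. \<exists>j<i. bit_at X (tri i + j) \<and> mark2 (cs ! i) \<and> mark2 (cs ! j)) \<or>
        \<not> (\<exists>i<n. \<exists>j<i. bit_at X (tri i + j) \<and> mark1 (cs ! i) \<and> mark1 (cs ! j)) \<and>
        (\<exists>i<n. bit_at X (tri n + i) \<noteq> mark1 (cs ! i)) \<and> compare_bits m A B True))"

definition scan :: com where
  "scan = decode_pair ;; read_size ;; read_edges ;; read_members ;; read_weights ;; compare_weights"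

lemma upd_Nil: "s v = [] \<Longrightarrow> upd v [] s = s"
  using upd_simps(5)[of v s] by simp

lemma run_decide:
  "run m decide (r(vOut := [], vBad := fl bad, vWrong := fl wr, vDep1 := fl d1, vDep2 := fl d2, vDiff := fl df, vGe := fl g)) vOut
    = [bit_symbol (bad \<or> \<not> wr \<and> (d1 \<or> \<not> d2 \<and> df \<and> g))]"
  by (cases bad; cases wr; cases d1; cases d2; cases df; cases g; simp add: decide_def)

lemma run_verifier:
  assumes y: "y = pair x u"
  shows "run (length y) (scan ;; decide) (\<lambda>v. if v = 1 then rev (bits y) else []) vOut
    = [bit_symbol (accepts (length y) x u)]"
proof -
  define m where "m = length y"
  define r0 :: store where "r0 = (\<lambda>_. [])"
  have r0: "r0 v = []" for v by (simp add: r0_def)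
  define z where "z = dropWhile id x"
  define n where "n = length (takeWhile id x)"
  define cs where "cs = certs n u"
  define X where "X = tl z"
  have xm: "length x \<le> m" by (simp add: m_def y pair_def length_delimit)
  have Xm: "length X \<le> m"
    using xm length_dropWhile_le[of id x] by (simp add: X_def z_def)
  have nm: "n \<le> m" using xm length_takeWhile_le[of id x] by (simp add: n_def)
  have cs: "length cs = n" "length cs \<le> m" "0 \<notin> set cs"
    using set_certs nm by (auto simp: cs_def length_certs)
  have init: "(\<lambda>v. if v = 1 then rev (bits y) else []) = r0(vInp := rev (bits y))"
    by (auto simp: r0_def fun_eq_iff simp del: fun_upd_eq_upd)
  have 0: "run m decode_pair (r0(vInp := rev (bits y))) = r0(vCert := bits u, vWord := bits x)"
    using run_decode_pair[OF y, of r0] by (simp add: upd_Nil r0 m_def)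
  have "\<exists>v. run m read_size (r0(vCert := bits u, vWord := bits x)) =
      r0(vCert := v, vWord := bits X, vTodo := cs, vBad := fl (z = []))"
    using run_read_size[OF xm, of r0 u] by (simp add: upd_Nil r0 X_def z_def n_def cs_def)
  then obtain v where 1: "run m read_size (r0(vCert := bits u, vWord := bits x)) =
      r0(vCert := v, vWord := bits X, vTodo := cs, vBad := fl (z = []))" by (elim exE)
  have 2: "run m read_edges (r0(vCert := v, vWord := bits X, vTodo := cs, vBad := fl (z = []))) =
    r0(vCert := v, vWord := bits (drop (tri n) X), vTodo := cs, vBad := fl (z = [] \<or> length X < tri n),
      vDep1 := fl (\<exists>i<n. \<exists>j<i. bit_at X (tri i + j) \<and> mark2 (cs ! i) \<and> mark2 (cs ! j)),
      vDep2 := fl (\<exists>i<n. \<exists>j<i. bit_at X (tri i + j) \<and> mark1 (cs ! i) \<and> mark1 (cs ! j)))"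
    using run_read_edges[OF cs(2,3), of "r0(vCert := v)" X "z = []"] by (simp add: upd_Nil r0 cs(1))
  define d1 where "d1 = (\<exists>i<n. \<exists>j<i. bit_at X (tri i + j) \<and> mark2 (cs ! i) \<and> mark2 (cs ! j))"
  define d2 where "d2 = (\<exists>i<n. \<exists>j<i. bit_at X (tri i + j) \<and> mark1 (cs ! i) \<and> mark1 (cs ! j))"
  define wr where "wr = (\<exists>i<n. bit_at X (tri n + i) \<noteq> mark2 (cs ! i))"
  define df where "df = (\<exists>i<n. bit_at X (tri n + i) \<noteq> mark1 (cs ! i))"
  define bad3 where "bad3 = (z = [] \<or> length X < tri n + n)"
  have "(z = [] \<or> length X < tri n) \<or> length (drop (tri n) X) < n \<longleftrightarrow> bad3"
    by (auto simp: bad3_def)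
  then have 3: "run m read_members (r0(vCert := v, vWord := bits (drop (tri n) X), vTodo := cs,
      vBad := fl (z = [] \<or> length X < tri n), vDep1 := fl d1, vDep2 := fl d2)) =
    r0(vCert := v, vWord := bits (drop (tri n + n) X), vTodo := cs, vBad := fl bad3,
      vDep1 := fl d1, vDep2 := fl d2, vWrong := fl wr, vDiff := fl df)"
    using run_read_members[OF cs(2,3), of "r0(vCert := v, vDep1 := fl d1, vDep2 := fl d2)" "drop (tri n) X"
        "z = [] \<or> length X < tri n"]
    by (simp add: upd_Nil r0 cs(1) bit_at_simps wr_def df_def add.commute del: length_drop)
  obtain X' bad A B where f: "fold (weight_step m) cs (drop (tri n + n) X, bad3, [], []) = (X', bad, A, B)"
    by (cases "fold (weight_step m) cs (drop (tri n + n) X, bad3, [], [])") auto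
  have "length (drop (tri n + n) X) \<le> m" using Xm by simp
  note p4 = run_read_weights[OF cs(2,3) this f]
  have 4: "run m read_weights (r0(vCert := v, vWord := bits (drop (tri n + n) X), vTodo := cs, vBad := fl bad3,
      vDep1 := fl d1, vDep2 := fl d2, vWrong := fl wr, vDiff := fl df)) =
    r0(vCert := v, vWord := bits X', vAcc1 := bits A, vAcc2 := bits B, vBad := fl bad,
      vDep1 := fl d1, vDep2 := fl d2, vWrong := fl wr, vDiff := fl df)"
    using p4[of "r0(vCert := v, vDep1 := fl d1, vDep2 := fl d2, vWrong := fl wr, vDiff := fl df)"]
    by (simp add: upd_Nil r0)
  define r5 where "r5 = r0(vCert := v, vWord := bits X', vAcc1 := bits (drop m A), vAcc2 := bits (drop m B))"
  have 5: "run m compare_weights (r0(vCert := v, vWord := bits X', vAcc1 := bits A, vAcc2 := bits B, vBad := fl bad,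
      vDep1 := fl d1, vDep2 := fl d2, vWrong := fl wr, vDiff := fl df)) =
    r5(vOut := [], vBad := fl (bad \<or> X' \<noteq> []), vWrong := fl wr, vDep1 := fl d1, vDep2 := fl d2,
      vDiff := fl df, vGe := fl (compare_bits m A B True))"
    using run_compare_weights[of m "r0(vCert := v, vDep1 := fl d1, vDep2 := fl d2, vWrong := fl wr, vDiff := fl df)" X' A B bad]
    by (simp add: upd_Nil r0 r5_def)
  have acc: "accepts m x u \<longleftrightarrow> (bad \<or> X' \<noteq> []) \<or> \<not> wr \<and> (d1 \<or> \<not> d2 \<and> df \<and> compare_bits m A B True)"
    unfolding accepts_def Let_def z_def[symmetric] n_def[symmetric] cs_def[symmetric] X_def[symmetric]
      bad3_def[symmetric] f by (auto simp: d1_def d2_def wr_def df_def)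
  show ?thesis
    unfolding init m_def[symmetric] scan_def run.simps(5) 0 1 2 d1_def[symmetric] d2_def[symmetric] 3 4 5
      run_decide acc ..
qed

text \<open>Shows that the scan leaves the output stack empty on every input, also on those that are
  not of the form \<open>pair x u\<close>; the decision then leaves exactly one bit there.\<close>

fun writes :: "com \<Rightarrow> nat set" where
  "writes (Push v a) = {v}"
| "writes (Pop v) = {v}"
| "writes (Copy u v) = {v}"
| "writes (c ;; d) = writes c \<union> writes d"
| "writes (Test v A c d) = writes c \<union> writes d"
| "writes (Loop c) = writes c"
| "writes Nop = {}"

lemma run_unwritten: "v \<notin> writes c \<Longrightarrow> run m c s v = s v"
proof (induction c arbitrary: s)
  case (Loop c)
  then have "(run m c ^^ k) s v = s v" for k by (induction k) auto
  then show ?case by simp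
qed (auto simp del: fun_upd_eq_upd)

lemmas prog_defs = decode_pair_def read_size_def read_edges_def read_members_def read_weights_def compare_weights_def read_mark_def read_edge_def
  read_member_def read_number_def spread_def add_def add_step_def flag_def whl_def

text \<open>Taking what the program accepts as the language puts it in \<open>class_P\<close>
  without describing it on inputs that are not pairs; \<open>class_NP\<close> asks about pairs
  only.\<close>

definition verifier :: language where
  "verifier = {y. run (length y) (scan ;; decide) (\<lambda>v. if v = 1 then rev (bits y) else []) vOut = [2]}"

lemma verifier_in_P: "verifier \<in> class_P"
proof -
  \<comment> \<open>The stacks are numbered up to \<open>21\<close>, and the largest symbol is the
    mark \<open>4\<close>.\<close>
  have wf: "wf_com 22 5 (scan ;; decide)"
    by (simp add: scan_def decide_def prog_defs)
  have "run (length y) (scan ;; decide) (\<lambda>v. if v = 1 then rev (bits y) else []) 0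
     = rev (bits [y \<in> verifier])" for y
  proof -
    define s where "s = run (length y) scan (\<lambda>v. if v = 1 then rev (bits y) else [])"
    have "vOut \<notin> writes scan" by (simp add: scan_def prog_defs Move_def)
    then have "s vOut = []" unfolding s_def by (subst run_unwritten) simp_all
    then have "run (length y) decide s vOut \<in> {[1], [2]}"
      by (simp add: decide_def)
    from this[unfolded s_def] show ?thesis
      unfolding verifier_def mem_Collect_eq run.simps(5) by (auto simp: bit_symbol_def)
  qed
  then have "polytime (\<lambda>y. [y \<in> verifier])"
    by (intro polytime_com[OF wf]) simp_all
  then show ?thesis by (simp add: class_P_def)
qed

lemma pair_in_verifier: "pair x u \<in> verifier \<longleftrightarrow> accepts (length (pair x u)) x u"
  unfolding verifier_def mem_Collect_eq run_verifier[OF refl] by (simp add: bit_symbol_def)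

subsection \<open>Correctness of the verifier\<close>

fun val :: "bool list \<Rightarrow> nat" where
  "val [] = 0"
| "val (b # xs) = of_bool b + 2 * val xs"

lemma val_hd_tl: "val xs = of_bool (hd0 xs) + 2 * val (tl xs)"
  by (cases xs) auto

lemma val_add_bits:
  "val ys + val as + of_bool c < 2 ^ n \<Longrightarrow> val (add_bits n ys as c) = val ys + val as + of_bool c"
proof (induction n arbitrary: ys as c)
  case (Suc n)
  let ?c = "hd0 ys \<and> hd0 as \<or> c \<and> (hd0 ys \<or> hd0 as)"
  have eq: "val ys + val as + of_bool c = of_bool ((hd0 ys \<noteq> hd0 as) \<noteq> c) + 2 * (val (tl ys) + val (tl as) + of_bool ?c)"
    by (subst val_hd_tl[of ys], subst val_hd_tl[of as]) auto
  then have "val (tl ys) + val (tl as) + of_bool ?c < 2 ^ n" using Suc.prems by simp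
  from Suc.IH[OF this] show ?case unfolding eq by simp
qed auto

lemma compare_bits_iff:
  "length as \<le> n \<Longrightarrow> length bs \<le> n \<Longrightarrow> compare_bits n as bs g \<longleftrightarrow> val bs < val as \<or> val as = val bs \<and> g"
proof (induction n arbitrary: as bs g)
  case (Suc n)
  have "length (tl as) \<le> n" "length (tl bs) \<le> n" using Suc.prems by auto
  note IH = Suc.IH[OF this]
  have v: "val as = of_bool (hd0 as) + 2 * val (tl as)" "val bs = of_bool (hd0 bs) + 2 * val (tl bs)"
    by (rule val_hd_tl)+
  show ?case unfolding compare_bits.simps IH v by (cases "hd0 as"; cases "hd0 bs") (simp_all, arith+)
qed simp

text \<open>This is the image of \<open>binary\<close>: the last bit is the most significant
  one.\<close>

definition canonical :: "bool list \<Rightarrow> bool" where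
  "canonical z \<longleftrightarrow> z = [] \<or> last z"

lemma val_binary: "val (binary k) = k"
proof (induction k rule: less_induct)
  case (less k)
  then show ?case by (subst binary.simps) (auto simp: odd_two_times_div_two_succ)
qed

lemma binary_Nil: "binary k = [] \<longleftrightarrow> k = 0"
  by (subst binary.simps) simp

lemma canonical_binary: "canonical (binary k)"
proof (induction k rule: less_induct)
  case (less k)
  show ?case
  proof (cases "k = 0")
    case False
    have "k div 2 = 0 \<Longrightarrow> odd k" using False by (cases "k = 1") auto
    with less[of "k div 2"] False show ?thesis
      by (subst binary.simps) (auto simp: canonical_def binary_Nil)
  qed (simp add: canonical_def binary_Nil)
qed


lemma binary_val: "canonical z \<Longrightarrow> binary (val z) = z"
proof (induction z)
  case (Cons b z)
  then have "canonical z" by (auto simp: canonical_def split: if_splits)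
  have "val (b # z) \<noteq> 0"
  proof (cases b)
    case False
    then have "z \<noteq> []" using Cons.prems by (auto simp: canonical_def)
    then have "val z \<noteq> 0" using Cons.IH[OF \<open>canonical z\<close>] by (metis binary_Nil)
    then show ?thesis by simp
  qed simp
  then show ?case using Cons.IH[OF \<open>canonical z\<close>] by (subst binary.simps) auto
qed (simp add: binary_Nil)

section \<open>Recovering the instance from the word\<close>

lemma length_tri: "length (concat (map (\<lambda>i. map (f i) [0..<i]) [0..<n])) = tri n"
  by (induction n) auto

lemma bit_at_append: "bit_at (xs @ ys) (length xs + j) = bit_at ys j"
  by (simp add: bit_at_def)

lemma bit_at_rows:
  "j < i \<Longrightarrow> i < n \<Longrightarrow> bit_at (concat (map (\<lambda>i. map (f i) [0..<i]) [0..<n]) @ R) (tri i + j) = f i j"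
proof (induction n arbitrary: R)
  case (Suc n)
  show ?case
  proof (cases "i < n")
    case True
    then show ?thesis using Suc.IH[of "map (f n) [0..<n] @ R"] Suc.prems by simp
  next
    case False
    then have i: "i = n" using Suc.prems by simp
    have "bit_at (concat (map (\<lambda>i. map (f i) [0..<i]) [0..<n]) @ map (f n) [0..<n] @ R) (tri n + j) = bit_at (map (f n) [0..<n] @ R) j"
      using bit_at_append[of "concat (map (\<lambda>i. map (f i) [0..<i]) [0..<n])"] by (simp add: length_tri)
    also have "\<dots> = f n j" using Suc.prems i by (subst bit_at_nth) (simp_all add: nth_append)
    finally show ?thesis using i by simp
  qed
qed simp

lemma take_rows:
  "tri n \<le> length X \<Longrightarrow> take (tri n) X = concat (map (\<lambda>i. map (\<lambda>j. bit_at X (tri i + j)) [0..<i]) [0..<n])"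
proof (induction n)
  case (Suc n)
  have "take n (drop (tri n) X) = map (\<lambda>j. bit_at X (tri n + j)) [0..<n]"
    using Suc.prems by (intro nth_equalityI) (auto simp: bit_at_nth)
  then show ?case using Suc by (simp add: take_add)
qed simp

lemma take_number_delimit: "take_number (delimit z @ R) acc bad = (False # R, rev z @ acc, bad)"
  by (induction z arbitrary: acc) (auto simp: delimit_def)

lemma take_number_conv:
  "take_number X acc bad = (X', z', bad') \<Longrightarrow> \<not> bad' \<Longrightarrow> X' \<noteq> [] \<Longrightarrow>
   \<not> bad \<and> (\<exists>ys. X = delimit ys @ tl X' \<and> z' = rev ys @ acc)"
proof (induction X acc bad rule: take_number.induct)
  case (1 b X z bad)
  then obtain ys where "\<not> bad" "X = delimit ys @ tl X'" "z' = rev ys @ b # z" by auto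
  then have "\<not> bad \<and> True # b # X = delimit (b # ys) @ tl X' \<and> z' = rev (b # ys) @ z"
    by (simp add: delimit_def)
  then show ?case by blast
next
  case ("3_2" X z bad)
  then show ?case by (auto simp: delimit_def intro!: exI[of _ "[]"])
next
  case ("3_3" z bad)
  then show ?case by (auto simp: delimit_def intro!: exI[of _ "[]"])
qed auto

lemma hd0_rev: "z \<noteq> [] \<Longrightarrow> hd0 (rev z) = last z"
  by (cases z rule: rev_cases) auto

lemma weight_step_delimit:
  assumes "canonical z"
  shows "weight_step m c (delimit z @ R, bad, A, B) = (R, bad,
    add_bits m (if mark1 c then z else []) A False, add_bits m (if mark2 c then z else []) B False)"
  using assms by (auto simp: take_number_delimit canonical_def hd0_rev)

definition weight :: "(nat \<Rightarrow> bool) \<Rightarrow> nat list \<Rightarrow> bool list list \<Rightarrow> nat" where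
  "weight mk cs zs = (\<Sum>(c, z)\<leftarrow>zip cs zs. if mk c then val z else 0)"

lemma fold_weight_step:
  assumes "length zs = length cs" "\<forall>z\<in>set zs. canonical z"
    "val A + (\<Sum>z\<leftarrow>zs. val z) < 2 ^ m" "val B + (\<Sum>z\<leftarrow>zs. val z) < 2 ^ m" "length A \<le> m" "length B \<le> m"
  shows "\<exists>A' B'. fold (weight_step m) cs (concat (map delimit zs) @ R, bad, A, B) = (R, bad, A', B') \<and>
    val A' = val A + weight mark1 cs zs \<and> val B' = val B + weight mark2 cs zs \<and> length A' \<le> m \<and> length B' \<le> m"
  using assms
proof (induction cs arbitrary: zs A B)
  case Nil
  then show ?case by (simp add: weight_def)
next
  case (Cons c cs)
  then obtain z zs' where zs: "zs = z # zs'" by (cases zs) auto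
  define A1 where "A1 = add_bits m (if mark1 c then z else []) A False"
  define B1 where "B1 = add_bits m (if mark2 c then z else []) B False"
  have A1: "val A1 = val A + (if mark1 c then val z else 0)"
    unfolding A1_def using Cons.prems(3) by (subst val_add_bits) (auto simp: zs)
  have B1: "val B1 = val B + (if mark2 c then val z else 0)"
    unfolding B1_def using Cons.prems(4) by (subst val_add_bits) (auto simp: zs)
  have "\<exists>A' B'. fold (weight_step m) cs (concat (map delimit zs') @ R, bad, A1, B1) = (R, bad, A', B') \<and>
    val A' = val A1 + weight mark1 cs zs' \<and> val B' = val B1 + weight mark2 cs zs' \<and> length A' \<le> m \<and> length B' \<le> m"
    by (rule Cons.IH) (use Cons.prems in \<open>auto simp: zs A1 B1 A1_def[symmetric]\<close>, simp_all add: A1_def B1_def)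
  moreover have "canonical z" using Cons.prems by (simp add: zs)
  ultimately show ?case
    using weight_step_delimit[of z m c "concat (map delimit zs') @ R" bad A B]
    by (auto simp: zs A1_def[symmetric] B1_def[symmetric] A1 B1 weight_def simp del: weight_step.simps)
qed

text \<open>The flag is never cleared, so a clean flag at the end shows that each number was well
  formed and canonical.\<close>

lemma fold_weight_step_conv:
  "fold (weight_step m) cs (X, bad, A, B) = (X', False, A', B') \<Longrightarrow>
   \<not> bad \<and> (\<exists>zs. length zs = length cs \<and> (\<forall>z\<in>set zs. canonical z) \<and> X = concat (map delimit zs) @ X')"
proof (induction cs arbitrary: X bad A B)
  case (Cons c cs)
  obtain X1 z bad1 where n: "take_number X [] bad = (X1, z, bad1)" by (cases "take_number X [] bad") auto
  define bad2 where "bad2 = (bad1 \<or> X1 = [] \<or> (z \<noteq> [] \<and> \<not> hd0 z))"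
  have "fold (weight_step m) cs (tl X1, bad2, add_bits m (if mark1 c then rev z else []) A False,
      add_bits m (if mark2 c then rev z else []) B False) = (X', False, A', B')"
    using Cons.prems by (simp add: n bad2_def)
  from Cons.IH[OF this] obtain zs where zs: "\<not> bad2" "length zs = length cs" "\<forall>z\<in>set zs. canonical z"
    "tl X1 = concat (map delimit zs) @ X'" by blast
  then obtain ys where ys: "\<not> bad" "X = delimit ys @ tl X1" "z = rev ys"
    using take_number_conv[OF n] by (auto simp: bad2_def)
  have "canonical ys" using zs(1) ys(3) hd0_rev[of ys] by (auto simp: bad2_def canonical_def)
  then have "length (ys # zs) = length (c # cs) \<and> (\<forall>z\<in>set (ys # zs). canonical z) \<and>
      X = concat (map delimit (ys # zs)) @ X'"
    using zs ys by simp
  then show ?case using ys(1) by blast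
qed auto

lemma val_less: "val z < 2 ^ length z"
  by (induction z) auto

text \<open>Keeps the accumulators from overflowing: they have as many digits as the input has
  letters, and the input contains all these delimited numbers.\<close>

lemma sum_val_less: "(\<Sum>z\<leftarrow>zs. val z) < 2 ^ length (concat (map delimit zs))"
proof (induction zs)
  case (Cons z zs)
  have "val z + (\<Sum>z\<leftarrow>zs. val z) < 2 ^ length z + 2 ^ length (concat (map delimit zs))"
    using Cons val_less[of z] by linarith
  also have "\<dots> \<le> 2 ^ (length z + length (concat (map delimit zs))) + 2 ^ (length z + length (concat (map delimit zs)))"
    by (intro add_mono power_increasing) simp_all
  also have "\<dots> = 2 ^ Suc (length z + length (concat (map delimit zs)))" by simp
  also have "\<dots> \<le> 2 ^ length (concat (map delimit (z # zs)))"
    by (intro power_increasing) (simp_all add: length_delimit)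
  finally show ?case by simp
qed simp

text \<open>A rejected word was parsed without error. Reading a graph, a set and weights off its
  bits gives an instance, and canonicity of the numbers ensures that encoding this instance returns
  the same word.\<close>

lemma accepts_malformed:
  assumes "\<not> accepts m x u"
  shows "\<exists>n E w I. simple_graph {..<n} E \<and> I \<subseteq> {..<n} \<and> x = encode_instance n E w I"
proof -
  define z where "z = dropWhile id x"
  define n where "n = length (takeWhile id x)"
  define cs where "cs = certs n u"
  define X where "X = tl z"
  obtain X' bad A B where f: "fold (weight_step m) cs (drop (tri n + n) X, z = [] \<or> length X < tri n + n, [], []) = (X', bad, A, B)"
    by (cases "fold (weight_step m) cs (drop (tri n + n) X, z = [] \<or> length X < tri n + n, [], [])") auto
  have b: "\<not> bad" "X' = []"
    using assms unfolding accepts_def Let_def z_def[symmetric] n_def[symmetric] cs_def[symmetric] X_def[symmetric] f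
    by auto
  have "fold (weight_step m) cs (drop (tri n + n) X, z = [] \<or> length X < tri n + n, [], []) = ([], False, A, B)"
    using f b by simp
  from fold_weight_step_conv[OF this] obtain zs where
    X: "z \<noteq> []" "tri n + n \<le> length X" and zs: "length zs = n" "\<forall>z\<in>set zs. canonical z"
      "drop (tri n + n) X = concat (map delimit zs)"
    by (auto simp: cs_def length_certs)
  define E where "E = {{i, j} | i j. j < i \<and> i < n \<and> bit_at X (tri i + j)}"
  define I where "I = {i. i < n \<and> bit_at X (tri n + i)}"
  define w where "w i = val (zs ! i)" for i
  have E: "{i, j} \<in> E \<longleftrightarrow> bit_at X (tri i + j)" if "j < i" "i < n" for i j
    using that by (auto simp: E_def doubleton_eq_iff)
  have rows: "concat (map (\<lambda>i. map (\<lambda>j. {i, j} \<in> E) [0..<i]) [0..<n]) = take (tri n) X"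
  proof -
    have tr: "tri n \<le> length X" using X(2) by simp
    have eq: "map (\<lambda>i. map (\<lambda>j. {i, j} \<in> E) [0..<i]) [0..<n] = map (\<lambda>i. map (\<lambda>j. bit_at X (tri i + j)) [0..<i]) [0..<n]"
      using E by (intro map_cong refl) auto
    show ?thesis unfolding eq take_rows[OF tr] ..
  qed
  have mem: "map (\<lambda>i. i \<in> I) [0..<n] = take n (drop (tri n) X)"
    using X(2) by (intro nth_equalityI) (auto simp: I_def bit_at_nth)
  have weights: "concat (map (\<lambda>i. delimit (binary (w i))) [0..<n]) = drop (tri n + n) X"
  proof -
    have "map (\<lambda>i. delimit (binary (w i))) [0..<n] = map delimit zs"
      using zs(1,2) by (intro nth_equalityI) (auto simp: w_def binary_val)
    then show ?thesis using zs(3) by simp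
  qed
  have "takeWhile id x = replicate n True"
    unfolding n_def by (rule replicate_length_same[symmetric]) (auto dest: set_takeWhileD)
  \<comment> \<open>\<open>dropWhile\<close> stops at the first \<open>False\<close>, the end of the
    unary count.\<close>
  moreover have "z = False # X" using X(1) hd_dropWhile[of id x] by (cases z) (auto simp: z_def X_def)
  ultimately have x: "x = replicate n True @ [False] @ X"
    using takeWhile_dropWhile_id[of id x] by (simp add: z_def)
  have "X = take (tri n) X @ take n (drop (tri n) X) @ drop (tri n + n) X"
    by (metis append_take_drop_id drop_drop add.commute)
  then have "x = encode_instance n E w I"
    unfolding encode_instance_def rows mem weights using x by simp
  moreover have "simple_graph {..<n} E" by (auto simp: simple_graph_def E_def card_2_iff)
  moreover have "I \<subseteq> {..<n}" by (auto simp: I_def)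
  ultimately show ?thesis by blast
qed

text \<open>\<open>S\<close> is the competing set and \<open>T\<close> the guess of
  \<open>I\<close>. Independence is tested while the matrix is read, when only \<open>T\<close> is
  known; the later check \<open>T = I\<close> turns the result for \<open>T\<close> into one for
  \<open>I\<close>.\<close>

lemma accepts_encoding:
  fixes x u :: "bool list" and n m :: nat and I :: "nat set"
  assumes x: "x = encode_instance n E w I" and m: "length x \<le> m" and G: "simple_graph {..<n} E" "I \<subseteq> {..<n}"
  defines "S \<equiv> {i. i < n \<and> mark1 (certs n u ! i)}" and "T \<equiv> {i. i < n \<and> mark2 (certs n u ! i)}"
  shows "accepts m x u \<longleftrightarrow> T = I \<and> (\<not> independent_set {..<n} E I \<or>
     independent_set {..<n} E S \<and> S \<noteq> I \<and> set_weight w I \<le> set_weight w S)"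
proof -
  define mat where "mat = concat (map (\<lambda>i. map (\<lambda>j. {i, j} \<in> E) [0..<i]) [0..<n])"
  define mem where "mem = map (\<lambda>i. i \<in> I) [0..<n]"
  define zs where "zs = map (\<lambda>i. binary (w i)) [0..<n]"
  define cs where "cs = certs n u"
  have ws: "concat (map (\<lambda>i. delimit (binary (w i))) [0..<n]) = concat (map delimit zs)"
    by (simp add: zs_def o_def)
  define X where "X = mat @ mem @ concat (map delimit zs)"
  have x': "x = replicate n True @ False # X"
    unfolding x encode_instance_def mat_def[symmetric] mem_def[symmetric] ws by (simp add: X_def)
  have tw: "takeWhile id x = replicate n True" "dropWhile id x = False # X"
  proof -
    have "takeWhile id (replicate k True @ False # X) = replicate k True"
      "dropWhile id (replicate k True @ False # X) = False # X" for k by (induction k) auto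
    then show "takeWhile id x = replicate n True" "dropWhile id x = False # X" by (simp_all add: x')
  qed
  have len: "length mat = tri n" "length mem = n" by (simp_all add: mat_def mem_def length_tri)
  have csl: "length cs = n" by (simp add: cs_def length_certs)
  have dr: "drop (tri n + n) X = concat (map delimit zs) @ []" "\<not> length X < tri n + n"
    using len by (simp_all add: X_def)
  have "length (concat (map delimit zs)) \<le> m" using m by (simp add: x' X_def)
  then have bound: "(\<Sum>z\<leftarrow>zs. val z) < 2 ^ m"
    using sum_val_less[of zs] by (meson less_le_trans one_le_numeral power_increasing)
  have "\<exists>A' B'. fold (weight_step m) cs (concat (map delimit zs) @ [], False, [], []) = ([], False, A', B') \<and>
    val A' = val [] + weight mark1 cs zs \<and> val B' = val [] + weight mark2 cs zs \<and> length A' \<le> m \<and> length B' \<le> m"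
    by (rule fold_weight_step) (use bound in \<open>auto simp: csl zs_def canonical_binary\<close>)
  then obtain A B where f: "fold (weight_step m) cs (concat (map delimit zs) @ [], False, [], []) = ([], False, A, B)"
    and v: "val A = weight mark1 cs zs" "val B = weight mark2 cs zs" "length A \<le> m" "length B \<le> m"
    by auto
  have weight: "weight mk cs zs = set_weight w {i. i < n \<and> mk (cs ! i)}" for mk
  proof -
    have "weight mk cs zs = (\<Sum>i = 0..<n. if mk (cs ! i) then w i else 0)"
      unfolding weight_def by (subst sum_list_sum_nth) (simp add: csl zs_def val_binary cong: if_cong)
    also have "\<dots> = (\<Sum>i\<in>{i \<in> {0..<n}. mk (cs ! i)}. w i)" by (rule sum.inter_filter[symmetric]) simp
    also have "{i \<in> {0..<n}. mk (cs ! i)} = {i. i < n \<and> mk (cs ! i)}" by auto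
    finally show ?thesis by (simp add: set_weight_def)
  qed
  have ST: "S = {i. i < n \<and> mark1 (cs ! i)}" "T = {i. i < n \<and> mark2 (cs ! i)}"
    by (simp_all add: S_def T_def cs_def)
  have edge: "bit_at X (tri i + j) \<longleftrightarrow> {i, j} \<in> E" if "j < i" "i < n" for i j
    using bit_at_rows[OF that] by (simp add: X_def mat_def)
  have memb: "bit_at X (tri n + i) \<longleftrightarrow> i \<in> I" if "i < n" for i
  proof -
    have "bit_at X (tri n + i) = bit_at (mem @ concat (map delimit zs)) i"
      using bit_at_append[of mat] len by (simp add: X_def)
    also have "\<dots> = (i \<in> I)" using that len by (subst bit_at_nth) (simp_all add: nth_append mem_def)
    finally show ?thesis .
  qed
  have indep: "independent_set {..<n} E {i. i < n \<and> mk (cs ! i)} \<longleftrightarrow>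
      \<not> (\<exists>i<n. \<exists>j<i. bit_at X (tri i + j) \<and> mk (cs ! i) \<and> mk (cs ! j))" for mk
  proof
    assume ind: "independent_set {..<n} E {i. i < n \<and> mk (cs ! i)}"
    show "\<not> (\<exists>i<n. \<exists>j<i. bit_at X (tri i + j) \<and> mk (cs ! i) \<and> mk (cs ! j))"
    proof
      assume "\<exists>i<n. \<exists>j<i. bit_at X (tri i + j) \<and> mk (cs ! i) \<and> mk (cs ! j)"
      then obtain i j where ij: "i < n" "j < i" "bit_at X (tri i + j)" "mk (cs ! i)" "mk (cs ! j)" by blast
      then have "{i, j} \<in> E" using edge by simp
      moreover have "{i, j} \<notin> E" using ind ij(1,2,4,5) unfolding independent_set_def by auto
      ultimately show False by blast
    qed
  next
    assume no: "\<not> (\<exists>i<n. \<exists>j<i. bit_at X (tri i + j) \<and> mk (cs ! i) \<and> mk (cs ! j))"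
    have "{i, j} \<notin> E" if "i < n" "j < n" "mk (cs ! i)" "mk (cs ! j)" "i \<noteq> j" for i j
    proof (cases "j < i")
      case True
      then show ?thesis using no edge[OF True that(1)] that by blast
    next
      case False
      then have "i < j" using that(5) by simp
      then show ?thesis using no edge[OF \<open>i < j\<close> that(2)] that by (metis insert_commute)
    qed
    then show "independent_set {..<n} E {i. i < n \<and> mk (cs ! i)}"
      unfolding independent_set_def by blast
  qed
  have eqI: "(\<forall>i<n. bit_at X (tri n + i) = mk (cs ! i)) \<longleftrightarrow> {i. i < n \<and> mk (cs ! i)} = I" for mk
    using memb G(2) by auto
  have neI: "(\<exists>i<n. bit_at X (tri n + i) \<noteq> mark1 (cs ! i)) \<longleftrightarrow> S \<noteq> I"
    using eqI[of mark1] unfolding ST by blast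
  have f': "fold (weight_step m) cs (drop (tri n + n) X, False # X = [] \<or> length X < tri n + n, [], []) = ([], False, A, B)"
    using f dr by simp
  have dep: "(\<exists>i<n. \<exists>j<i. bit_at X (tri i + j) \<and> mark1 (cs ! i) \<and> mark1 (cs ! j)) \<longleftrightarrow> \<not> independent_set {..<n} E S"
    "(\<exists>i<n. \<exists>j<i. bit_at X (tri i + j) \<and> mark2 (cs ! i) \<and> mark2 (cs ! j)) \<longleftrightarrow> \<not> independent_set {..<n} E T"
    using indep[of mark1] indep[of mark2] unfolding ST by blast+
  have "accepts m x u \<longleftrightarrow> T = I \<and> (\<not> independent_set {..<n} E T \<or>
     independent_set {..<n} E S \<and> S \<noteq> I \<and> compare_bits m A B True)"
    unfolding accepts_def Let_def tw length_replicate cs_def[symmetric] list.sel(3) f' prod.case dep neI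
      eqI[of mark2] ST(2)[symmetric] by simp
  also have "compare_bits m A B True \<longleftrightarrow> set_weight w T \<le> set_weight w S"
    using compare_bits_iff[OF v(3,4)] v(1,2) unfolding ST weight by auto
  finally show ?thesis by blast
qed

lemma certs_concat: "certs (length ps) (concat (map (\<lambda>(a, b). [a, b]) ps)) = map (\<lambda>(a, b). mark a b) ps"
  by (induction ps) auto

lemma mark_simps: "mark1 (mark a b) = a" "mark2 (mark a b) = b"
  by (simp_all add: mark_def mark1_def mark2_def)

theorem UI1_in_coNP: "UI\<^sub>1 \<in> class_coNP"
proof -
  \<comment> \<open>Two bits per vertex; the number of vertices is at most the length of the word
    because it is written in unary.\<close>
  have "x \<in> - UI\<^sub>1 \<longleftrightarrow> (\<exists>u. length u \<le> poly [:0, 2:] (length x) \<and> pair x u \<in> verifier)" for x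
  proof (cases "\<exists>n E w I. simple_graph {..<n} E \<and> I \<subseteq> {..<n} \<and> x = encode_instance n E w I")
    case False
    then have "x \<in> - UI\<^sub>1" unfolding UI\<^sub>1_def by blast
    moreover have "pair x [] \<in> verifier"
      unfolding pair_in_verifier using accepts_malformed False by blast
    ultimately show ?thesis by (intro iffI exI[of _ "[]"]) auto
  next
    case True
    then obtain n E w I where G: "simple_graph {..<n} E" "I \<subseteq> {..<n}" and x: "x = encode_instance n E w I"
      by blast
    have UI: "x \<in> UI\<^sub>1 \<longleftrightarrow> unique_max_weight_independent_set {..<n} E w I"
      unfolding x by (rule encode_in_UI1[OF G])
    have lx: "length x \<le> length (pair x u)" for u by (simp add: pair_def length_delimit)
    have nx: "n \<le> length x" by (simp add: x encode_instance_def)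
    note acc = accepts_encoding[OF x lx G]
    show ?thesis
    proof
      assume "x \<in> - UI\<^sub>1"
      \<comment> \<open>If \<open>I\<close> is dependent, any set of vertices serves as
        \<open>S\<close>.\<close>
      then obtain S where S: "S \<subseteq> {..<n}" "\<not> independent_set {..<n} E I \<or>
          independent_set {..<n} E S \<and> S \<noteq> I \<and> set_weight w I \<le> set_weight w S"
        using UI unfolding unique_max_weight_independent_set_def
        by (metis ComplD G(2) independent_set_def not_le)
      define u where "u = concat (map (\<lambda>(a, b). [a, b]) (map (\<lambda>i. (i \<in> S, i \<in> I)) [0..<n]))"
      have cs: "certs n u = map (\<lambda>i. mark (i \<in> S) (i \<in> I)) [0..<n]"
        using certs_concat[of "map (\<lambda>i. (i \<in> S, i \<in> I)) [0..<n]"] by (simp add: u_def o_def)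
      have "{i. i < n \<and> mark1 (certs n u ! i)} = S" "{i. i < n \<and> mark2 (certs n u ! i)} = I"
        using S(1) G(2) by (auto simp: cs mark_simps)
      then have "accepts (length (pair x u)) x u" using acc[of u] S(2) by simp
      moreover have "length u = 2 * n"
        unfolding u_def by (induction n) auto
      ultimately show "\<exists>u. length u \<le> poly [:0, 2:] (length x) \<and> pair x u \<in> verifier"
        using nx by (intro exI[of _ u]) (simp add: pair_in_verifier)
    next
      assume "\<exists>u. length u \<le> poly [:0, 2:] (length x) \<and> pair x u \<in> verifier"
      then obtain u where "accepts (length (pair x u)) x u" by (auto simp: pair_in_verifier)
      then show "x \<in> - UI\<^sub>1"
        using acc[of u] UI unfolding unique_max_weight_independent_set_def by (auto simp: not_less[symmetric])
    qed
  qed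
  then show ?thesis
    unfolding class_coNP_def class_NP_def using verifier_in_P by blast
qed

theorem theorem3p1:
  shows "coNP_complete UI\<^sub>1"
  using UI1_in_coNP coNP_hard by (simp add: coNP_complete_def)

end
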